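(* Let $[\nabla]$ be a projective structure on a smooth manifold $N$ of dimension $n\ge3$. The projective Weyl curvature of $[\nabla]$ is exactly the obstruction to integrability of the bundle $H^L$ on $\mathcal P(T^*N)$, i.e. to flatness of the induced partial connection on $\mathcal P(T^*N)\to N$: the distribution $H^L\subset T\mathcal P(T^*N)$ is integrable if and only if the projective Weyl curvature vanishes identically.
   Context: A projective structure on $N$ is an equivalence class $[\nabla]$ of torsion-free linear connections on $TN$, where $\hat\nabla\sim\nabla$ iff $\hat\nabla_\xi\eta=\nabla_\xi\eta+\Upsilon(\xi)\eta+\Upsilon(\eta)\xi$ for some $\Upsilon\in\Omega^1(N)$. The projective Weyl curvature is the totally trace-free part of the curvature of any connection in the class: $R_{ab}{}^c{}_d=W_{ab}{}^c{}_d+\delta_a^c\mathsf P_{bd}-\delta_b^c\mathsf P_{ad}+\beta_{ab}\delta^c_d$ with all traces of $W$ zero; $W$ depends only on $[\nabla]$. On $\pi:\mathcal P(T^*N)\to N$ (the projectivized cotangent bundle) let $H$ be the canonical contact distribution, $H_\ell=\{\xi\in T_\ell\mathcal P(T^*N):\ell(T\pi\cdot\xi)=0\}$, and $H^R\subset H$ the vertical subbundle of $\pi$. For $\nabla\in[\nabla]$, the induced linear connection on $T^*N$ induces a horizontal distribution on $\mathcal P(T^*N)$; its intersection with $H$ is a subbundle $H^L\subset H$ complementary to $H^R$, which depends only on $[\nabla]$. This $H^L$ is called the induced partial connection on $\mathcal P(T^*N)\to N$ (a horizontal complement defined only inside $H$); flatness means that $H^L$ is an integrable distribution. *)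

theory Defs
  imports "HOL-Analysis.Analysis"
begin

section \<open>Smooth manifolds\<close>

primrec Ck_on :: "nat \<Rightarrow> ('a::real_normed_vector \<Rightarrow> 'b::real_normed_vector) \<Rightarrow> 'a set \<Rightarrow> bool" where
  "Ck_on 0 f S \<longleftrightarrow> continuous_on S f"
| "Ck_on (Suc k) f S \<longleftrightarrow>
     (\<forall>x\<in>S. f differentiable (at x)) \<and> (\<forall>v. Ck_on k (\<lambda>x. frechet_derivative f (at x) v) S)"

text \<open>Only used for open \<open>S\<close>.\<close>

definition smooth_on :: "('a::real_normed_vector \<Rightarrow> 'b::real_normed_vector) \<Rightarrow> 'a set \<Rightarrow> bool" where
  "smooth_on f S \<longleftrightarrow> (\<forall>k. Ck_on k f S)"

text \<open>A chart is a pair of its domain and its coordinate map; the values of the coordinate map outside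
  the domain carry no meaning.\<close>

type_synonym ('p, 'e) chart = "'p set \<times> ('p \<Rightarrow> 'e)"

definition chart_inv :: "('p, 'e) chart \<Rightarrow> 'e \<Rightarrow> 'p" where
  "chart_inv c = inv_into (fst c) (snd c)"

definition atlas_topology ::
  "'p set \<Rightarrow> ('p, 'e::euclidean_space) chart set \<Rightarrow> 'p topology" where
  "atlas_topology M A = topology (\<lambda>U. U \<subseteq> M \<and> (\<forall>c\<in>A. open (snd c ` (U \<inter> fst c))))"

definition smooth_manifold :: "'p set \<Rightarrow> ('p, 'e::euclidean_space) chart set \<Rightarrow> bool" where
  "smooth_manifold M A \<longleftrightarrow>
     (\<Union>c\<in>A. fst c) = M \<and>
     (\<forall>c\<in>A. inj_on (snd c) (fst c) \<and> open (snd c ` fst c)) \<and>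
     (\<forall>c\<in>A. \<forall>d\<in>A. open (snd c ` (fst c \<inter> fst d)) \<and>
        smooth_on (snd d \<circ> chart_inv c) (snd c ` (fst c \<inter> fst d))) \<and>
     Hausdorff_space (atlas_topology M A) \<and> second_countable (atlas_topology M A)"

definition chart_at :: "('p, 'e) chart set \<Rightarrow> 'p \<Rightarrow> ('p, 'e) chart" where
  "chart_at A p = (SOME c. c \<in> A \<and> p \<in> fst c)"

definition smooth_fun_on ::
  "('p, 'e::euclidean_space) chart set \<Rightarrow> 'p set \<Rightarrow> ('p \<Rightarrow> real) \<Rightarrow> bool" where
  "smooth_fun_on A U f \<longleftrightarrow> (\<forall>c\<in>A. smooth_on (f \<circ> chart_inv c) (snd c ` (U \<inter> fst c)))"


section \<open>Tangent vectors, vector fields and one-forms\<close>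

text \<open>A tangent vector at \<open>p\<close> is the family of its coordinate expressions in the charts around
  \<open>p\<close>, related by the derivatives of the chart transitions. The family is \<open>0\<close> at all other
  charts, so that equality of tangent vectors is equality of functions.\<close>

type_synonym ('p, 'e) tvec = "('p, 'e) chart \<Rightarrow> 'e"

definition transition_deriv ::
  "('p, 'e::euclidean_space) chart \<Rightarrow> ('p, 'e) chart \<Rightarrow> 'p \<Rightarrow> 'e \<Rightarrow> 'e" where
  "transition_deriv c d p = frechet_derivative (snd d \<circ> chart_inv c) (at (snd c p))"

definition tangent_space :: "('p, 'e::euclidean_space) chart set \<Rightarrow> 'p \<Rightarrow> ('p, 'e) tvec set" where
  "tangent_space A p =
     {v. (\<forall>c\<in>A. \<forall>d\<in>A. p \<in> fst c \<and> p \<in> fst d \<longrightarrow> v d = transition_deriv c d p (v c)) \<and>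
         (\<forall>c. \<not> (c \<in> A \<and> p \<in> fst c) \<longrightarrow> v c = 0)}"

text \<open>The tangent vector at \<open>p\<close> whose coordinate expression in the chart \<open>c\<close> is \<open>e\<close>.\<close>

definition coord_tvec ::
  "('p, 'e::euclidean_space) chart set \<Rightarrow> ('p, 'e) chart \<Rightarrow> 'p \<Rightarrow> 'e \<Rightarrow> ('p, 'e) tvec" where
  "coord_tvec A c p e = (\<lambda>d. if d \<in> A \<and> p \<in> fst d then transition_deriv c d p e else 0)"

type_synonym ('p, 'e) vfield = "'p \<Rightarrow> ('p, 'e) tvec"

definition restrict_field :: "'p set \<Rightarrow> ('p \<Rightarrow> 'i \<Rightarrow> 'z::zero) \<Rightarrow> 'p \<Rightarrow> 'i \<Rightarrow> 'z" where
  "restrict_field U X = (\<lambda>p. if p \<in> U then X p else (\<lambda>_. 0))"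

definition field_add ::
  "('p \<Rightarrow> 'i \<Rightarrow> 'z::real_vector) \<Rightarrow> ('p \<Rightarrow> 'i \<Rightarrow> 'z) \<Rightarrow> 'p \<Rightarrow> 'i \<Rightarrow> 'z" where
  "field_add X Y = (\<lambda>p i. X p i + Y p i)"

definition field_diff ::
  "('p \<Rightarrow> 'i \<Rightarrow> 'z::real_vector) \<Rightarrow> ('p \<Rightarrow> 'i \<Rightarrow> 'z) \<Rightarrow> 'p \<Rightarrow> 'i \<Rightarrow> 'z" where
  "field_diff X Y = (\<lambda>p i. X p i - Y p i)"

definition field_scale ::
  "('p \<Rightarrow> real) \<Rightarrow> ('p \<Rightarrow> 'i \<Rightarrow> 'z::real_vector) \<Rightarrow> 'p \<Rightarrow> 'i \<Rightarrow> 'z" where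
  "field_scale f X = (\<lambda>p i. f p *\<^sub>R X p i)"

text \<open>Smooth vector fields and one-forms on \<open>U\<close>, extended by zero outside \<open>U\<close> (so again
  equality is equality of functions). The value of a one-form at \<open>p\<close> is a linear functional on
  the tangent space, extended by zero to all families.\<close>

definition vector_fields ::
  "('p, 'e::euclidean_space) chart set \<Rightarrow> 'p set \<Rightarrow> ('p, 'e) vfield set" where
  "vector_fields A U =
     {X. (\<forall>p\<in>U. X p \<in> tangent_space A p) \<and> (\<forall>p. p \<notin> U \<longrightarrow> X p = (\<lambda>_. 0)) \<and>
         (\<forall>c\<in>A. smooth_on (\<lambda>x. X (chart_inv c x) c) (snd c ` (U \<inter> fst c)))}"

type_synonym ('p, 'e) covec = "('p, 'e) tvec \<Rightarrow> real"

definition cotangent_space ::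
  "('p, 'e::euclidean_space) chart set \<Rightarrow> 'p \<Rightarrow> ('p, 'e) covec set" where
  "cotangent_space A p =
     {\<alpha>. (\<forall>v\<in>tangent_space A p. \<forall>w\<in>tangent_space A p. \<alpha> (\<lambda>c. v c + w c) = \<alpha> v + \<alpha> w) \<and>
         (\<forall>r. \<forall>v\<in>tangent_space A p. \<alpha> (\<lambda>c. r *\<^sub>R v c) = r * \<alpha> v) \<and>
         (\<forall>v. v \<notin> tangent_space A p \<longrightarrow> \<alpha> v = 0)}"

definition one_forms ::
  "('p, 'e::euclidean_space) chart set \<Rightarrow> 'p set \<Rightarrow> ('p \<Rightarrow> ('p, 'e) covec) set" where
  "one_forms A U =
     {\<alpha>. (\<forall>p\<in>U. \<alpha> p \<in> cotangent_space A p) \<and> (\<forall>p. p \<notin> U \<longrightarrow> \<alpha> p = (\<lambda>_. 0)) \<and>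
         (\<forall>c\<in>A. \<forall>e. smooth_on (\<lambda>x. \<alpha> (chart_inv c x) (coord_tvec A c (chart_inv c x) e))
                       (snd c ` (U \<inter> fst c)))}"

definition dir_deriv ::
  "('p, 'e::euclidean_space) chart set \<Rightarrow> ('p, 'e) vfield \<Rightarrow> ('p \<Rightarrow> real) \<Rightarrow> 'p \<Rightarrow> real" where
  "dir_deriv A X f p =
     (let c = chart_at A p
      in frechet_derivative (f \<circ> chart_inv c) (at (snd c p)) (X p c))"

definition lie_bracket ::
  "('p, 'e::euclidean_space) chart set \<Rightarrow> 'p set \<Rightarrow> ('p, 'e) vfield \<Rightarrow> ('p, 'e) vfield \<Rightarrow> ('p, 'e) vfield"
  where
  "lie_bracket A U X Y = (\<lambda>p c.
     if p \<in> U \<and> c \<in> A \<and> p \<in> fst c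
     then frechet_derivative (\<lambda>x. Y (chart_inv c x) c) (at (snd c p)) (X p c)
        - frechet_derivative (\<lambda>x. X (chart_inv c x) c) (at (snd c p)) (Y p c)
     else 0)"

definition tangent_map ::
  "('p, 'e::euclidean_space) chart set \<Rightarrow> ('q, 'f::euclidean_space) chart set \<Rightarrow>
   ('p \<Rightarrow> 'q) \<Rightarrow> 'p \<Rightarrow> ('p, 'e) tvec \<Rightarrow> ('q, 'f) tvec" where
  "tangent_map A B f p v = (\<lambda>d.
     if d \<in> B \<and> f p \<in> fst d
     then let c = chart_at A p
          in frechet_derivative (snd d \<circ> f \<circ> chart_inv c) (at (snd c p)) (v c)
     else 0)"


section \<open>Integrable distributions\<close>

text \<open>A distribution is given by its fibres \<open>D p\<close>. It is integrable if through every point there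
  is an injectively immersed submanifold whose tangent spaces are the fibres of \<open>D\<close>. The type
  argument is the model space of the integral submanifolds; since an immersion is injective on tangent
  spaces, its dimension is the rank of \<open>D\<close>.\<close>

definition param_tangent_map ::
  "('p, 'e::euclidean_space) chart set \<Rightarrow> ('k::euclidean_space \<Rightarrow> 'p) \<Rightarrow> 'k \<Rightarrow> 'k \<Rightarrow> ('p, 'e) tvec" where
  "param_tangent_map A \<phi> u h = (\<lambda>d.
     if d \<in> A \<and> \<phi> u \<in> fst d then frechet_derivative (snd d \<circ> \<phi>) (at u) h else 0)"

definition injective_immersion ::
  "'p set \<Rightarrow> ('p, 'e::euclidean_space) chart set \<Rightarrow> 'k::euclidean_space set \<Rightarrow> ('k \<Rightarrow> 'p) \<Rightarrow> bool" where
  "injective_immersion M A S \<phi> \<longleftrightarrow>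
     open S \<and> \<phi> ` S \<subseteq> M \<and> inj_on \<phi> S \<and>
     (\<forall>d\<in>A. open (S \<inter> \<phi> -` fst d) \<and> smooth_on (snd d \<circ> \<phi>) (S \<inter> \<phi> -` fst d)) \<and>
     (\<forall>u\<in>S. inj (param_tangent_map A \<phi> u))"

definition integrable_distribution ::
  "'k::euclidean_space itself \<Rightarrow> 'p set \<Rightarrow> ('p, 'e::euclidean_space) chart set \<Rightarrow>
   ('p \<Rightarrow> ('p, 'e) tvec set) \<Rightarrow> bool" where
  "integrable_distribution K M A D \<longleftrightarrow>
     (\<forall>p\<in>M. \<exists>(S :: 'k set) \<phi>. injective_immersion M A S \<phi> \<and> p \<in> \<phi> ` S \<and>
        (\<forall>u\<in>S. range (param_tangent_map A \<phi> u) = D (\<phi> u)))"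


section \<open>Linear connections and projective structures\<close>

text \<open>A linear connection on the tangent bundle is a covariant derivative. As it is a local operator,
  it is given here on the vector fields over each open set \<open>U\<close>, compatibly with restriction.\<close>

type_synonym ('p, 'e) connection = "'p set \<Rightarrow> ('p, 'e) vfield \<Rightarrow> ('p, 'e) vfield \<Rightarrow> ('p, 'e) vfield"

definition linear_connection ::
  "'p set \<Rightarrow> ('p, 'e::euclidean_space) chart set \<Rightarrow> ('p, 'e) connection \<Rightarrow> bool" where
  "linear_connection M A nabla \<longleftrightarrow>
     (\<forall>U. openin (atlas_topology M A) U \<longrightarrow>
        (\<forall>X\<in>vector_fields A U. \<forall>Y\<in>vector_fields A U.
           nabla U X Y \<in> vector_fields A U \<and>
           (\<forall>Z\<in>vector_fields A U.
              nabla U (field_add X Z) Y = field_add (nabla U X Y) (nabla U Z Y) \<and>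
              nabla U X (field_add Y Z) = field_add (nabla U X Y) (nabla U X Z)) \<and>
           (\<forall>f. smooth_fun_on A U f \<longrightarrow>
              nabla U (field_scale f X) Y = field_scale f (nabla U X Y) \<and>
              nabla U X (field_scale f Y) =
                field_add (field_scale (dir_deriv A X f) Y) (field_scale f (nabla U X Y))) \<and>
           (\<forall>V. openin (atlas_topology M A) V \<and> V \<subseteq> U \<longrightarrow>
              nabla V (restrict_field V X) (restrict_field V Y) = restrict_field V (nabla U X Y))))"

definition torsion_free ::
  "'p set \<Rightarrow> ('p, 'e::euclidean_space) chart set \<Rightarrow> ('p, 'e) connection \<Rightarrow> bool" where
  "torsion_free M A nabla \<longleftrightarrow>
     (\<forall>U. openin (atlas_topology M A) U \<longrightarrow>
        (\<forall>X\<in>vector_fields A U. \<forall>Y\<in>vector_fields A U.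
           field_diff (nabla U X Y) (nabla U Y X) = lie_bracket A U X Y))"

definition projectively_equivalent ::
  "'p set \<Rightarrow> ('p, 'e::euclidean_space) chart set \<Rightarrow> ('p, 'e) connection \<Rightarrow> ('p, 'e) connection \<Rightarrow> bool"
  where
  "projectively_equivalent M A nabla nabla' \<longleftrightarrow>
     (\<exists>\<Upsilon>\<in>one_forms A M. \<forall>U. openin (atlas_topology M A) U \<longrightarrow>
        (\<forall>X\<in>vector_fields A U. \<forall>Y\<in>vector_fields A U.
           nabla' U X Y =
             field_add (nabla U X Y)
               (field_add (field_scale (\<lambda>p. \<Upsilon> p (X p)) Y) (field_scale (\<lambda>p. \<Upsilon> p (Y p)) X))))"

definition projective_structure ::
  "'p set \<Rightarrow> ('p, 'e::euclidean_space) chart set \<Rightarrow> ('p, 'e) connection set \<Rightarrow> bool" where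
  "projective_structure M A P \<longleftrightarrow>
     (\<exists>nabla. linear_connection M A nabla \<and> torsion_free M A nabla \<and>
        P = {nabla'. linear_connection M A nabla' \<and> torsion_free M A nabla' \<and>
                     projectively_equivalent M A nabla nabla'})"


section \<open>Projective Weyl curvature\<close>

definition curvature ::
  "('p, 'e::euclidean_space) chart set \<Rightarrow> ('p, 'e) connection \<Rightarrow> 'p set \<Rightarrow>
   ('p, 'e) vfield \<Rightarrow> ('p, 'e) vfield \<Rightarrow> ('p, 'e) vfield \<Rightarrow> ('p, 'e) vfield" where
  "curvature A nabla U X Y Z =
     field_diff (field_diff (nabla U X (nabla U Y Z)) (nabla U Y (nabla U X Z)))
       (nabla U (lie_bracket A U X Y) Z)"

definition coord_field ::
  "('p, real^'n) chart set \<Rightarrow> ('p, real^'n) chart \<Rightarrow> 'n::finite \<Rightarrow> ('p, real^'n) vfield" where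
  "coord_field A c i = restrict_field (fst c) (\<lambda>p. coord_tvec A c p (axis i 1))"

text \<open>The components $R_{ab}{}^i{}_d$ in the chart \<open>c\<close>, with the indices in this order.\<close>

definition curvature_comp ::
  "('p, real^'n) chart set \<Rightarrow> ('p, real^'n) connection \<Rightarrow> ('p, real^'n) chart \<Rightarrow> 'p \<Rightarrow>
   'n::finite \<Rightarrow> 'n \<Rightarrow> 'n \<Rightarrow> 'n \<Rightarrow> real" where
  "curvature_comp A nabla c p a b i d =
     curvature A nabla (fst c) (coord_field A c a) (coord_field A c b) (coord_field A c d) p c $ i"

definition totally_trace_free :: "('n::finite \<Rightarrow> 'n \<Rightarrow> 'n \<Rightarrow> 'n \<Rightarrow> real) \<Rightarrow> bool" where
  "totally_trace_free W \<longleftrightarrow>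
     (\<forall>b d. (\<Sum>a\<in>UNIV. W a b a d) = 0) \<and>
     (\<forall>a d. (\<Sum>b\<in>UNIV. W a b b d) = 0) \<and>
     (\<forall>a b. (\<Sum>d\<in>UNIV. W a b d d) = 0)"

definition kdelta :: "'n \<Rightarrow> 'n \<Rightarrow> real" where
  "kdelta i j = (if i = j then 1 else 0)"

text \<open>For dimension at least three the decomposition determines \<open>W\<close> uniquely.\<close>

definition weyl_curvature ::
  "('p, real^'n) chart set \<Rightarrow> ('p, real^'n) connection \<Rightarrow> ('p, real^'n) chart \<Rightarrow> 'p \<Rightarrow>
   'n::finite \<Rightarrow> 'n \<Rightarrow> 'n \<Rightarrow> 'n \<Rightarrow> real" where
  "weyl_curvature A nabla c p =
     (THE W. totally_trace_free W \<and>
        (\<exists>P \<beta>. \<forall>a b i d. curvature_comp A nabla c p a b i d =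
           W a b i d + kdelta a i * P b d - kdelta b i * P a d + \<beta> a b * kdelta i d))"

definition weyl_curvature_vanishes ::
  "('p, real^'n) chart set \<Rightarrow> ('p, real^'n::finite) connection \<Rightarrow> bool" where
  "weyl_curvature_vanishes A nabla \<longleftrightarrow>
     (\<forall>c\<in>A. \<forall>p\<in>fst c. \<forall>a b i d. weyl_curvature A nabla c p a b i d = 0)"


section \<open>The projectivized cotangent bundle\<close>

definition covec_line :: "('p, 'e) covec \<Rightarrow> ('p, 'e) covec set" where
  "covec_line \<alpha> = {(\<lambda>v. t * \<alpha> v) |t. True}"

definition proj_cotangent ::
  "'p set \<Rightarrow> ('p, 'e::euclidean_space) chart set \<Rightarrow> ('p \<times> ('p, 'e) covec set) set" where
  "proj_cotangent M A =
     {(p, covec_line \<alpha>) |p \<alpha>. p \<in> M \<and> \<alpha> \<in> cotangent_space A p \<and> \<alpha> \<noteq> (\<lambda>_. 0)}"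

definition coord_covec ::
  "('p, 'e::euclidean_space) chart set \<Rightarrow> ('p, 'e) chart \<Rightarrow> 'p \<Rightarrow> 'e \<Rightarrow> ('p, 'e) covec" where
  "coord_covec A c p w = (\<lambda>v. if v \<in> tangent_space A p then w \<bullet> v c else 0)"

text \<open>The charts are the products of charts \<open>c\<close> of the base with affine charts of projective
  space: the latter parametrize by \<open>y \<mapsto> [w + L y]\<close> the lines meeting an affine subspace
  that does not contain the origin. If the dimension of the model space \<open>'f\<close> is one less than that of
  \<open>'e\<close>, as in all uses, this affine subspace is a hyperplane.\<close>

definition proj_cotangent_param ::
  "('p, 'e::euclidean_space) chart set \<Rightarrow> ('p, 'e) chart \<Rightarrow> 'e \<Rightarrow> ('f::euclidean_space \<Rightarrow> 'e) \<Rightarrow>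
   'e \<times> 'f \<Rightarrow> 'p \<times> ('p, 'e) covec set" where
  "proj_cotangent_param A c w L = (\<lambda>(x, y).
     (chart_inv c x, covec_line (coord_covec A c (chart_inv c x) (w + L y))))"

definition proj_cotangent_atlas ::
  "('p, 'e::euclidean_space) chart set \<Rightarrow>
   ('p \<times> ('p, 'e) covec set, 'e \<times> 'f::euclidean_space) chart set" where
  "proj_cotangent_atlas A =
     {(proj_cotangent_param A c w L ` (snd c ` fst c \<times> UNIV),
       inv_into (snd c ` fst c \<times> UNIV) (proj_cotangent_param A c w L)) |c w L.
      c \<in> A \<and> linear L \<and> inj L \<and> w \<notin> range L}"

text \<open>In the following, \<open>B\<close> is the atlas of the projectivized cotangent bundle. It is kept as an
  argument because it determines the model space.\<close>

definition contact_distribution ::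
  "('p, 'e::euclidean_space) chart set \<Rightarrow>
   ('p \<times> ('p, 'e) covec set, 'e \<times> 'f::euclidean_space) chart set \<Rightarrow>
   'p \<times> ('p, 'e) covec set \<Rightarrow> ('p \<times> ('p, 'e) covec set, 'e \<times> 'f) tvec set" where
  "contact_distribution A B q =
     {\<xi>\<in>tangent_space B q. \<forall>\<alpha>\<in>snd q. \<alpha> (tangent_map B A fst q \<xi>) = 0}"

text \<open>The induced connection on the cotangent bundle:
  \<open>(\<nabla>\<^sub>X \<sigma>)(Y) = X(\<sigma>(Y)) - \<sigma>(\<nabla>\<^sub>X Y)\<close>.\<close>

definition dual_nabla ::
  "('p, 'e::euclidean_space) chart set \<Rightarrow> ('p, 'e) connection \<Rightarrow> 'p set \<Rightarrow>
   ('p, 'e) vfield \<Rightarrow> ('p \<Rightarrow> ('p, 'e) covec) \<Rightarrow> ('p, 'e) vfield \<Rightarrow> 'p \<Rightarrow> real" where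
  "dual_nabla A nabla U X \<sigma> Y p = dir_deriv A X (\<lambda>p'. \<sigma> p' (Y p')) p - \<sigma> p (nabla U X Y p)"

text \<open>The horizontal space at \<open>\<alpha>\<close> of a linear connection consists of the vectors
  \<open>T\<sigma> X\<close> for local sections \<open>\<sigma>\<close> with \<open>\<sigma> p = \<alpha>\<close> and
  \<open>\<nabla>\<^sub>X \<sigma> = 0\<close> at \<open>p\<close>; here it is projected to the projectivization. The test
  fields \<open>Y\<close> range over all neighbourhoods \<open>V\<close> of \<open>p\<close>, so that only the value of
  \<open>\<nabla>\<^sub>X \<sigma>\<close> at \<open>p\<close> matters.\<close>

definition horizontal_distribution ::
  "'p set \<Rightarrow> ('p, 'e::euclidean_space) chart set \<Rightarrow>
   ('p \<times> ('p, 'e) covec set, 'e \<times> 'f::euclidean_space) chart set \<Rightarrow> ('p, 'e) connection \<Rightarrow>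
   'p \<times> ('p, 'e) covec set \<Rightarrow> ('p \<times> ('p, 'e) covec set, 'e \<times> 'f) tvec set" where
  "horizontal_distribution M A B nabla q = (let p = fst q in
     {tangent_map A B (\<lambda>p'. (p', covec_line (\<sigma> p'))) p (X p) |U \<sigma> X.
        openin (atlas_topology M A) U \<and> p \<in> U \<and>
        \<sigma> \<in> one_forms A U \<and> (\<forall>p'\<in>U. \<sigma> p' \<noteq> (\<lambda>_. 0)) \<and> covec_line (\<sigma> p) = snd q \<and>
        X \<in> vector_fields A U \<and>
        (\<forall>V. openin (atlas_topology M A) V \<and> p \<in> V \<and> V \<subseteq> U \<longrightarrow>
           (\<forall>Y\<in>vector_fields A V.
              dual_nabla A nabla V (restrict_field V X) (restrict_field V \<sigma>) Y p = 0))})"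

definition HL ::
  "'p set \<Rightarrow> ('p, 'e::euclidean_space) chart set \<Rightarrow>
   ('p \<times> ('p, 'e) covec set, 'e \<times> 'f::euclidean_space) chart set \<Rightarrow> ('p, 'e) connection \<Rightarrow>
   'p \<times> ('p, 'e) covec set \<Rightarrow> ('p \<times> ('p, 'e) covec set, 'e \<times> 'f) tvec set" where
  "HL M A B nabla q = horizontal_distribution M A B nabla q \<inter> contact_distribution A B q"

end

theory Submission
  imports Defs
begin

text \<open>In a chart a point of the projectivized cotangent bundle is a base point \<open>x\<close> with a covector
  \<open>\<omega> = w + L y\<close>, and the fibre of \<open>H\<^sup>L\<close> consists of the vectors \<open>(a, b)\<close> with \<open>\<omega> \<bullet> a = 0\<close>
  whose fibre component \<open>b\<close> is the restriction of \<open>\<omega> \<bullet> \<Gamma>(a, -)\<close> to the kernel of \<open>\<omega>\<close>. A projective change of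
  the connection alters \<open>\<Gamma>\<close> only by terms that vanish there.

  The tangent vectors \<open>(a, b)\<close> of an integral manifold satisfy this equation identically, so the
  symmetry of second derivatives gives \<open>\<omega> \<bullet> R(a, b) e = 0\<close> whenever \<open>\<omega>\<close> annihilates \<open>a\<close>, \<open>b\<close> and \<open>e\<close>.
  Conversely, integral manifolds are graphs over $\mathbf{R}^{n-1}$ of solutions of a total differential system
  whose integrability condition is the same identity. The identity for all \<open>\<omega>\<close> says that the
  curvature is a pure trace, that is, that the Weyl curvature vanishes.\<close>

section \<open>Calculus of smooth maps\<close>

text \<open>\<open>integrable_distribution\<close> asks for integral manifolds, not for closure
  under brackets, so both directions work with parametrizations. The geometry is done in one bundle
  chart adapted to the given point: its covector is normalized to a unit vector \<open>w\<close>,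
  and \<open>L\<close> is an isometry onto the orthogonal complement, so the point has fibre
  coordinate \<open>y = 0\<close>. Nearby, the kernel of \<open>w + L y\<close> is parametrized by
  \<open>tangent_frame y h = L h - (y \<bullet> h) *\<^sub>R w\<close>. Integral manifolds can
  therefore be sought with base point \<open>x0 + L z + s *\<^sub>R w\<close> and unknowns
  \<open>s\<close> and \<open>y\<close>, the base velocity being forced to equal
  \<open>tangent_frame y h\<close>. The integrability condition for \<open>s\<close> is the symmetry
  of the Christoffel symbols, that is, torsion-freeness; the one for \<open>y\<close> is the
  curvature identity. The bound n \<ge> 3 enters through the algebra: the trace equations are
  solvable because (n - 2) (n + 1) is nonzero, and a third index is at hand to read off the trace
  part from test covectors.\<close>

lemma frechet_derivative_eq: "(f has_derivative f') (at x) \<Longrightarrow> frechet_derivative f (at x) = f'"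
  by (metis frechet_derivative_at)

text \<open>\<open>frechet_derivative\<close> chooses among the maps satisfying
  \<open>has_derivative\<close>, and functions that agree near \<open>x\<close> admit the same ones;
  this covers also points where neither is differentiable.\<close>

lemma frechet_derivative_cong_open:
  assumes "open S" "x \<in> S" "\<And>y. y \<in> S \<Longrightarrow> f y = g y"
  shows "frechet_derivative f (at x) = frechet_derivative g (at x)"
proof -
  have "(f has_derivative f') (at x) \<longleftrightarrow> (g has_derivative f') (at x)" for f'
    using assms has_derivative_transform_within_open[of f f' x UNIV S g]
      has_derivative_transform_within_open[of g f' x UNIV S f] by fastforce
  then show ?thesis
    by (simp add: frechet_derivative_def)
qed

section \<open>Maps of class C^k\<close>

lemma Ck_on_cong:
  assumes "open S" "\<And>x. x \<in> S \<Longrightarrow> f x = g x"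
  shows "Ck_on k f S \<longleftrightarrow> Ck_on k g S"
proof -
  have imp: "Ck_on k g S" if "Ck_on k f S" "\<And>x. x \<in> S \<Longrightarrow> f x = g x" for f g
    using that
  proof (induction k arbitrary: f g)
    case 0
    then show ?case by (simp cong: continuous_on_cong)
  next
    case (Suc k)
    have "g differentiable (at x)" if x: "x \<in> S" for x
    proof -
      obtain f' where "(f has_derivative f') (at x)"
        using Suc.prems(1) x by (auto simp: differentiable_def)
      then have "(g has_derivative f') (at x)"
        using has_derivative_transform_within_open[OF _ assms(1) x] Suc.prems(2) by blast
      then show ?thesis by (auto simp: differentiable_def)
    qed
    moreover have "Ck_on k (\<lambda>x. frechet_derivative g (at x) v) S" for v
    proof (rule Suc.IH)
      show "Ck_on k (\<lambda>x. frechet_derivative f (at x) v) S" using Suc.prems by simp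
      show "frechet_derivative f (at x) v = frechet_derivative g (at x) v" if "x \<in> S" for x
        using frechet_derivative_cong_open[OF assms(1) that Suc.prems(2)] by simp
    qed
    ultimately show ?case by simp
  qed
  show ?thesis
    using imp[of f g] imp[of g f] assms(2) by auto
qed

lemma Ck_on_subset: "Ck_on k f S \<Longrightarrow> T \<subseteq> S \<Longrightarrow> Ck_on k f T"
  by (induction k arbitrary: f) (auto intro: continuous_on_subset)

text \<open>At level \<open>Suc k\<close> the definition speaks of differentiability and of
  directional derivatives, so lower regularity has to be recovered: at the bottom differentiability
  gives continuity, above it the claim passes to the derivatives.\<close>

lemma Ck_on_Suc_D: "Ck_on (Suc k) f S \<Longrightarrow> Ck_on k f S"
proof (induction k arbitrary: f)
  case 0
  then have "\<forall>x\<in>S. f differentiable (at x)" by simp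
  then have "\<forall>x\<in>S. continuous (at x) f" using differentiable_imp_continuous_within by auto
  then show ?case by (simp add: continuous_at_imp_continuous_on)
next
  case (Suc k)
  have "Ck_on k (\<lambda>x. frechet_derivative f (at x) v) S" for v
    by (rule Suc.IH) (use Suc.prems in simp)
  moreover have "\<forall>x\<in>S. f differentiable (at x)"
    using Suc.prems by simp
  ultimately show ?case by simp
qed

lemma Ck_on_has_derivative:
  "Ck_on (Suc k) f S \<Longrightarrow> x \<in> S \<Longrightarrow> (f has_derivative frechet_derivative f (at x)) (at x)"
  by (simp add: frechet_derivative_works)

text \<open>The working induction step: since derivatives are unique, one found by any calculation
  may replace the chosen \<open>frechet_derivative\<close>.\<close>

lemma Ck_on_SucI:
  assumes "open S" "\<And>x. x \<in> S \<Longrightarrow> (f has_derivative f' x) (at x)"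
    "\<And>v. Ck_on k (\<lambda>x. f' x v) S"
  shows "Ck_on (Suc k) f S"
proof -
  have "Ck_on k (\<lambda>x. frechet_derivative f (at x) v) S" for v
    using assms(3)[of v] Ck_on_cong[OF assms(1), of "\<lambda>x. frechet_derivative f (at x) v" "\<lambda>x. f' x v" k]
      frechet_derivative_eq[OF assms(2)] by simp
  with assms(2) show ?thesis by (auto simp: differentiable_def)
qed

lemma Ck_on_const: "open S \<Longrightarrow> Ck_on k (\<lambda>x. a) S"
proof (induction k arbitrary: a)
  case (Suc k)
  then show ?case by (intro Ck_on_SucI[where f'="\<lambda>x v. 0"]) simp_all
qed simp

lemma Ck_on_ident: "open S \<Longrightarrow> Ck_on k (\<lambda>x. x) S"
proof (cases k)
  case (Suc j)
  assume "open S"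
  then show ?thesis unfolding Suc
    by (intro Ck_on_SucI[where f'="\<lambda>x v. v"]) (auto intro: Ck_on_const)
qed simp

lemma Ck_on_add:
  "open S \<Longrightarrow> Ck_on k f S \<Longrightarrow> Ck_on k g S \<Longrightarrow> Ck_on k (\<lambda>x. f x + g x) S"
proof (induction k arbitrary: f g)
  case (Suc k)
  show ?case
  proof (rule Ck_on_SucI[OF Suc.prems(1)])
    show "((\<lambda>x. f x + g x) has_derivative
        (\<lambda>v. frechet_derivative f (at x) v + frechet_derivative g (at x) v)) (at x)" if "x \<in> S" for x
      by (rule has_derivative_add[OF Ck_on_has_derivative[OF Suc.prems(2) that] Ck_on_has_derivative[OF Suc.prems(3) that]])
    show "Ck_on k (\<lambda>x. frechet_derivative f (at x) v + frechet_derivative g (at x) v) S" for v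
      using Suc by simp
  qed
qed (auto intro: continuous_on_add)

lemma Ck_on_sum:
  "open S \<Longrightarrow> (\<And>i. i \<in> I \<Longrightarrow> Ck_on k (f i) S) \<Longrightarrow> Ck_on k (\<lambda>x. \<Sum>i\<in>I. f i x) S"
  by (induction I rule: infinite_finite_induct) (auto intro: Ck_on_const Ck_on_add)

lemma Ck_on_bilinear:
  assumes "bounded_bilinear pr" "open S"
  shows "Ck_on k f S \<Longrightarrow> Ck_on k g S \<Longrightarrow> Ck_on k (\<lambda>x. pr (f x) (g x)) S"
proof (induction k arbitrary: f g)
  case 0
  then show ?case using bounded_bilinear.continuous_on[OF assms(1)] by auto
next
  case (Suc k)
  show ?case
  proof (rule Ck_on_SucI[OF assms(2)])
    show "((\<lambda>x. pr (f x) (g x)) has_derivative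
        (\<lambda>v. pr (f x) (frechet_derivative g (at x) v) + pr (frechet_derivative f (at x) v) (g x))) (at x)"
      if "x \<in> S" for x
      by (rule bounded_bilinear.FDERIV[OF assms(1) Ck_on_has_derivative[OF Suc.prems(1) that]
          Ck_on_has_derivative[OF Suc.prems(2) that]])
    show "Ck_on k (\<lambda>x. pr (f x) (frechet_derivative g (at x) v)
        + pr (frechet_derivative f (at x) v) (g x)) S" for v
      by (intro Ck_on_add assms Suc.IH Ck_on_Suc_D[OF Suc.prems(1)] Ck_on_Suc_D[OF Suc.prems(2)])
        (use Suc.prems in simp_all)
  qed
qed

lemma Ck_on_bounded_linear:
  assumes "bounded_linear h" "open S"
  shows "Ck_on k f S \<Longrightarrow> Ck_on k (\<lambda>x. h (f x)) S"
proof (induction k arbitrary: f)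
  case 0
  then show ?case using bounded_linear.continuous_on[OF assms(1)] by auto
next
  case (Suc k)
  show ?case
  proof (rule Ck_on_SucI[OF assms(2)])
    show "((\<lambda>x. h (f x)) has_derivative (\<lambda>v. h (frechet_derivative f (at x) v))) (at x)"
      if "x \<in> S" for x
      by (rule bounded_linear.has_derivative[OF assms(1) Ck_on_has_derivative[OF Suc.prems that]])
    show "Ck_on k (\<lambda>x. h (frechet_derivative f (at x) v)) S" for v
      using Suc by simp
  qed
qed

text \<open>\<open>Ck_on\<close> controls derivatives in a fixed direction, while the chain rule
  applies the derivative of \<open>f\<close> to the moving vector
  \<open>frechet_derivative g (at x) v\<close>. Expanding that vector in a basis leaves sums of
  products covered by the induction, which is why the inner map takes values in a Euclidean
  space.\<close>

lemma Ck_on_compose: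
  fixes g :: "'a::real_normed_vector \<Rightarrow> 'b::euclidean_space"
  assumes "open S" "open T"
  shows "Ck_on k f T \<Longrightarrow> Ck_on k g S \<Longrightarrow> g ` S \<subseteq> T \<Longrightarrow> Ck_on k (\<lambda>x. f (g x)) S"
proof (induction k arbitrary: f)
  case 0
  then show ?case by (auto intro: continuous_on_compose2)
next
  case (Suc k)
  show ?case
  proof (rule Ck_on_SucI[OF assms(1)])
    fix x assume x: "x \<in> S"
    have "g x \<in> T" using Suc.prems(3) x by auto
    note f = Ck_on_has_derivative[OF Suc.prems(1) this]
    note g = Ck_on_has_derivative[OF Suc.prems(2) x]
    interpret linear "frechet_derivative f (at (g x))"
      using f by (simp add: has_derivative_linear)
    have "frechet_derivative f (at (g x)) (frechet_derivative g (at x) v) =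
        (\<Sum>b\<in>Basis. (frechet_derivative g (at x) v \<bullet> b) *\<^sub>R frechet_derivative f (at (g x)) b)" for v
      by (subst euclidean_representation[symmetric]) (simp add: sum scale)
    then show "((\<lambda>x. f (g x)) has_derivative
       (\<lambda>v. \<Sum>b\<in>Basis. (frechet_derivative g (at x) v \<bullet> b) *\<^sub>R frechet_derivative f (at (g x)) b)) (at x)"
      using has_derivative_compose[OF g f] by simp
  next
    fix v
    have g: "Ck_on k g S" by (rule Ck_on_Suc_D[OF Suc.prems(2)])
    have "Ck_on k (\<lambda>x. frechet_derivative f (at (g x)) b) S" for b
      by (rule Suc.IH[OF _ g Suc.prems(3)]) (use Suc.prems(1) in simp)
    moreover have "Ck_on k (\<lambda>x. frechet_derivative g (at x) v \<bullet> b) S" for b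
      by (rule Ck_on_bounded_linear[OF bounded_linear_inner_left assms(1)]) (use Suc.prems(2) in simp)
    ultimately show "Ck_on k (\<lambda>x. \<Sum>b\<in>Basis. (frechet_derivative g (at x) v \<bullet> b) *\<^sub>R
        frechet_derivative f (at (g x)) b) S"
      by (intro Ck_on_sum Ck_on_bilinear[OF bounded_bilinear_scaleR] assms(1))
  qed
qed

lemma Ck_on_inverse:
  fixes f :: "'a::real_normed_vector \<Rightarrow> real"
  assumes "open S" "\<And>x. x \<in> S \<Longrightarrow> f x \<noteq> 0"
  shows "Ck_on k f S \<Longrightarrow> Ck_on k (\<lambda>x. inverse (f x)) S"
proof (induction k)
  case 0
  then show ?case using assms by (auto intro!: continuous_on_inverse)
next
  case (Suc k)
  show ?case
  proof (rule Ck_on_SucI[OF assms(1)])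
    fix x assume x: "x \<in> S"
    show "((\<lambda>x. inverse (f x)) has_derivative
        (\<lambda>v. - (inverse (f x) * frechet_derivative f (at x) v * inverse (f x)))) (at x)"
      by (rule Deriv.has_derivative_inverse[OF assms(2)[OF x] Ck_on_has_derivative[OF Suc.prems x]])
  next
    fix v
    have "Ck_on k (\<lambda>x. inverse (f x)) S"
      by (rule Suc.IH[OF Ck_on_Suc_D[OF Suc.prems]])
    then have "Ck_on k (\<lambda>x. inverse (f x) * frechet_derivative f (at x) v * inverse (f x)) S"
      by (intro Ck_on_bilinear[OF bounded_bilinear_mult assms(1)]) (use Suc.prems in simp_all)
    from Ck_on_bounded_linear[OF bounded_linear_minus[OF bounded_linear_ident] assms(1) this]
    show "Ck_on k (\<lambda>x. - (inverse (f x) * frechet_derivative f (at x) v * inverse (f x))) S" .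
  qed
qed

section \<open>Smooth maps\<close>

lemma smooth_on_cong:
  "open S \<Longrightarrow> (\<And>x. x \<in> S \<Longrightarrow> f x = g x) \<Longrightarrow> smooth_on f S \<longleftrightarrow> smooth_on g S"
  using Ck_on_cong by (metis smooth_on_def)

lemma smooth_on_subset: "smooth_on f S \<Longrightarrow> T \<subseteq> S \<Longrightarrow> smooth_on f T"
  using Ck_on_subset by (metis smooth_on_def)

lemma smooth_on_continuous: "smooth_on f S \<Longrightarrow> continuous_on S f"
  using Ck_on.simps(1) by (metis smooth_on_def)

lemma smooth_on_has_derivative:
  "smooth_on f S \<Longrightarrow> x \<in> S \<Longrightarrow> (f has_derivative frechet_derivative f (at x)) (at x)"
  using Ck_on_has_derivative by (metis smooth_on_def)

lemma smooth_on_frechet_derivative: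
  "smooth_on f S \<Longrightarrow> smooth_on (\<lambda>x. frechet_derivative f (at x) v) S"
  using Ck_on.simps(2) by (metis smooth_on_def)

lemma smooth_on_const: "open S \<Longrightarrow> smooth_on (\<lambda>x. a) S"
  by (simp add: smooth_on_def Ck_on_const)

lemma smooth_on_ident: "open S \<Longrightarrow> smooth_on (\<lambda>x. x) S"
  by (simp add: smooth_on_def Ck_on_ident)

lemma smooth_on_bilinear:
  "bounded_bilinear pr \<Longrightarrow> open S \<Longrightarrow> smooth_on f S \<Longrightarrow> smooth_on g S \<Longrightarrow>
    smooth_on (\<lambda>x. pr (f x) (g x)) S"
  by (simp add: smooth_on_def Ck_on_bilinear)

lemma smooth_on_bounded_linear:
  "bounded_linear h \<Longrightarrow> open S \<Longrightarrow> smooth_on f S \<Longrightarrow> smooth_on (\<lambda>x. h (f x)) S"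
  by (simp add: smooth_on_def Ck_on_bounded_linear)

lemma smooth_on_linear:
  fixes h :: "'a::euclidean_space \<Rightarrow> 'b::real_normed_vector"
  shows "linear h \<Longrightarrow> open S \<Longrightarrow> smooth_on f S \<Longrightarrow> smooth_on (\<lambda>x. h (f x)) S"
  by (simp add: smooth_on_bounded_linear linear_conv_bounded_linear)

lemma smooth_on_compose:
  fixes g :: "'a::real_normed_vector \<Rightarrow> 'b::euclidean_space"
  shows "open S \<Longrightarrow> open T \<Longrightarrow> smooth_on f T \<Longrightarrow> smooth_on g S \<Longrightarrow> g ` S \<subseteq> T \<Longrightarrow>
    smooth_on (\<lambda>x. f (g x)) S"
  by (simp add: smooth_on_def Ck_on_compose)

lemma smooth_on_add:
  "open S \<Longrightarrow> smooth_on f S \<Longrightarrow> smooth_on g S \<Longrightarrow> smooth_on (\<lambda>x. f x + g x) S"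
  by (simp add: smooth_on_def Ck_on_add)

lemma smooth_on_minus: "open S \<Longrightarrow> smooth_on f S \<Longrightarrow> smooth_on (\<lambda>x. - f x) S"
  using smooth_on_bounded_linear[OF bounded_linear_minus[OF bounded_linear_ident]] by blast

lemma smooth_on_diff:
  "open S \<Longrightarrow> smooth_on f S \<Longrightarrow> smooth_on g S \<Longrightarrow> smooth_on (\<lambda>x. f x - g x) S"
  using smooth_on_add[of S f "\<lambda>x. - g x"] smooth_on_minus by auto

lemma smooth_on_sum:
  "open S \<Longrightarrow> (\<And>i. i \<in> I \<Longrightarrow> smooth_on (f i) S) \<Longrightarrow> smooth_on (\<lambda>x. \<Sum>i\<in>I. f i x) S"
  by (simp add: smooth_on_def Ck_on_sum)

lemma smooth_on_inverse:
  fixes f :: "'a::real_normed_vector \<Rightarrow> real"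
  shows "open S \<Longrightarrow> (\<And>x. x \<in> S \<Longrightarrow> f x \<noteq> 0) \<Longrightarrow> smooth_on f S \<Longrightarrow> smooth_on (\<lambda>x. inverse (f x)) S"
  by (simp add: smooth_on_def Ck_on_inverse)

lemma smooth_on_Pair:
  assumes "open S" "smooth_on f S" "smooth_on g S"
  shows "smooth_on (\<lambda>x. (f x, g x)) S"
proof -
  have "smooth_on (\<lambda>x. (f x, 0) + (0, g x)) S"
    using assms
      smooth_on_bounded_linear[OF bounded_linear_Pair[OF bounded_linear_ident bounded_linear_zero], of S f]
      smooth_on_bounded_linear[OF bounded_linear_Pair[OF bounded_linear_zero bounded_linear_ident], of S g]
    by (intro smooth_on_add) auto
  then show ?thesis by simp
qed

lemmas smooth_on_scaleR = smooth_on_bilinear[OF bounded_bilinear_scaleR]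
lemmas smooth_on_inner = smooth_on_bilinear[OF bounded_bilinear_inner]
lemmas smooth_on_mult = smooth_on_bilinear[OF bounded_bilinear_mult]
lemmas smooth_on_fst = smooth_on_bounded_linear[OF bounded_linear_fst]
lemmas smooth_on_snd = smooth_on_bounded_linear[OF bounded_linear_snd]
lemmas smooth_on_vec_nth = smooth_on_bounded_linear[OF bounded_linear_vec_nth]
lemmas smooth_on_inner_left = smooth_on_bounded_linear[OF bounded_linear_inner_left]

text \<open>Bootstrapping: if \<open>f\<close> is of class C^k, then so is its derivative
  \<open>F z (f z) h\<close>, and \<open>f\<close> is of class C^(k+1). This upgrades the solution
  of a total differential system, which at first is only known to be differentiable.\<close>

lemma smooth_on_integral_curve:
  fixes f :: "'a::euclidean_space \<Rightarrow> 'b::euclidean_space" and F :: "'a \<Rightarrow> 'b \<Rightarrow> 'a \<Rightarrow> 'b"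
  assumes "open S" "open W" and in_W: "\<And>z. z \<in> S \<Longrightarrow> (z, f z) \<in> W"
    and F: "\<And>h. smooth_on (\<lambda>p. F (fst p) (snd p) h) W"
    and f: "\<And>z. z \<in> S \<Longrightarrow> (f has_derivative F z (f z)) (at z)"
  shows "smooth_on f S"
proof -
  have "Ck_on k f S" for k
  proof (induction k)
    case 0
    show ?case
      using f by (auto intro!: continuous_at_imp_continuous_on has_derivative_continuous)
  next
    case (Suc k)
    have pair: "Ck_on k (\<lambda>z. (z, f z)) S"
    proof -
      have "Ck_on k (\<lambda>z. (z, 0) + (0, f z)) S"
        using assms(1) Suc
          Ck_on_bounded_linear[OF bounded_linear_Pair[OF bounded_linear_ident bounded_linear_zero], of S k "\<lambda>x. x"]
          Ck_on_bounded_linear[OF bounded_linear_Pair[OF bounded_linear_zero bounded_linear_ident], of S k f]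
        by (intro Ck_on_add) (auto intro: Ck_on_ident)
      then show ?thesis by simp
    qed
    show ?case
    proof (rule Ck_on_SucI[OF assms(1) f])
      show "Ck_on k (\<lambda>z. F z (f z) v) S" for v
        using Ck_on_compose[OF assms(1,2) _ pair, of "\<lambda>p. F (fst p) (snd p) v"] F[of v] in_W
        by (auto simp: smooth_on_def)
    qed
  qed
  then show ?thesis by (simp add: smooth_on_def)
qed

text \<open>Mean value theorem for the difference \<phi> of \<open>f\<close> along two parallel
  segments: the second difference is \<open>t\<close> times a difference of two values of
  \<open>f' y h\<close>, and differentiability at the single point \<open>x\<close> approximates
  that difference by \<open>t * f'' k\<close>.\<close>

lemma second_difference_bound:
  fixes f :: "'a::real_normed_vector \<Rightarrow> real"
  assumes "open S" "x \<in> S"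
    and f: "\<And>y. y \<in> S \<Longrightarrow> (f has_derivative f' y) (at y)"
    and f'': "((\<lambda>y. f' y h) has_derivative f'') (at x)"
    and "\<epsilon> > 0"
  shows "\<exists>t0>0. \<forall>t. 0 < t \<and> t < t0 \<longrightarrow>
    \<bar>f (x + t *\<^sub>R h + t *\<^sub>R k) - f (x + t *\<^sub>R h) - f (x + t *\<^sub>R k) + f x - t\<^sup>2 * f'' k\<bar> \<le> \<epsilon> * t\<^sup>2"
proof -
  \<comment> \<open>\<open>t * m\<close> bounds every displacement along \<open>h\<close> and
    \<open>k\<close> with coefficients up to \<open>t\<close>; the summand 1 keeps \<open>m\<close>
    positive. With the tolerance \<open>\<epsilon> / (2 * m)\<close> each of the two remainders
    below is at most \<open>\<epsilon> / 2 * t\<close>.\<close>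
  define m where "m = norm h + norm k + 1"
  have m: "m > 0" "norm h + norm k \<le> m" by (auto simp: m_def add_nonneg_pos)
  have "\<epsilon> / (2 * m) > 0" using \<open>\<epsilon> > 0\<close> m by simp
  then obtain d where d: "d > 0"
    "\<And>y. norm (y - x) < d \<Longrightarrow> norm (f' y h - f' x h - f'' (y - x)) \<le> \<epsilon> / (2 * m) * norm (y - x)"
    using f'' unfolding has_derivative_at_alt by blast
  obtain r where r: "r > 0" "ball x r \<subseteq> S"
    using assms(1,2) open_contains_ball by blast
  interpret f'': linear f'' using f'' by (rule has_derivative_linear)
  define t0 where "t0 = min d r / m"
  have "t0 > 0" using d r m by (simp add: t0_def)
  moreover have "\<bar>f (x + t *\<^sub>R h + t *\<^sub>R k) - f (x + t *\<^sub>R h) - f (x + t *\<^sub>R k) + f x - t\<^sup>2 * f'' k\<bar> \<le> \<epsilon> * t\<^sup>2"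
    if t: "0 < t" "t < t0" for t
  proof -
    have tm: "t * m < d" "t * m < r"
      using t m by (auto simp: t0_def field_simps)
    have small: "norm (s *\<^sub>R h + u *\<^sub>R k) \<le> t * m" if "0 \<le> s" "s \<le> t" "0 \<le> u" "u \<le> t" for s u
    proof -
      have "norm (s *\<^sub>R h + u *\<^sub>R k) \<le> s * norm h + u * norm k"
        using norm_triangle_ineq[of "s *\<^sub>R h" "u *\<^sub>R k"] that by simp
      also have "\<dots> \<le> t * norm h + t * norm k"
        using that by (intro add_mono mult_right_mono) auto
      also have "\<dots> \<le> t * m" using t m(2) by (simp flip: distrib_left)
      finally show ?thesis .
    qed
    have inS: "x + s *\<^sub>R h + u *\<^sub>R k \<in> S" if "0 \<le> s" "s \<le> t" "0 \<le> u" "u \<le> t" for s u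
    proof -
      have "norm (s *\<^sub>R h + u *\<^sub>R k) < r" using small[OF that] tm by simp
      then have "x + s *\<^sub>R h + u *\<^sub>R k \<in> ball x r"
        by (metis add.assoc add_diff_cancel_left' dist_norm dist_commute mem_ball)
      then show ?thesis using r by blast
    qed
    define \<phi> where "\<phi> s = f (x + s *\<^sub>R h + t *\<^sub>R k) - f (x + s *\<^sub>R h)" for s
    define \<phi>' where "\<phi>' s = f' (x + s *\<^sub>R h + t *\<^sub>R k) h - f' (x + s *\<^sub>R h) h" for s
    have lin: "linear (f' y)" if "y \<in> S" for y
      using f[OF that] by (rule has_derivative_linear)
    have "(\<phi> has_derivative (\<lambda>v. v * \<phi>' s)) (at s within {0..t})" if s: "0 \<le> s" "s \<le> t" for s
    proof -
      have S: "x + s *\<^sub>R h + t *\<^sub>R k \<in> S" "x + s *\<^sub>R h \<in> S"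
        using inS[of s t] inS[of s 0] s t by auto
      have "((\<lambda>s. f (x + s *\<^sub>R h + t *\<^sub>R k)) has_derivative (\<lambda>v. f' (x + s *\<^sub>R h + t *\<^sub>R k) (v *\<^sub>R h))) (at s within {0..t})"
        by (rule has_derivative_compose[where f="\<lambda>s. x + s *\<^sub>R h + t *\<^sub>R k" and g=f, OF _ f[OF S(1)]]) (auto intro!: derivative_eq_intros)
      moreover have "((\<lambda>s. f (x + s *\<^sub>R h)) has_derivative (\<lambda>v. f' (x + s *\<^sub>R h) (v *\<^sub>R h))) (at s within {0..t})"
        by (rule has_derivative_compose[where f="\<lambda>s. x + s *\<^sub>R h" and g=f, OF _ f[OF S(2)]]) (auto intro!: derivative_eq_intros)
      ultimately have "(\<phi> has_derivative (\<lambda>v. f' (x + s *\<^sub>R h + t *\<^sub>R k) (v *\<^sub>R h) - f' (x + s *\<^sub>R h) (v *\<^sub>R h))) (at s within {0..t})"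
        unfolding \<phi>_def by (rule has_derivative_diff)
      then show ?thesis
        using S[THEN lin] by (simp add: \<phi>'_def linear_scale right_diff_distrib)
    qed
    then obtain s where s: "s \<in> {0<..<t}" "\<phi> t - \<phi> 0 = (t - 0) * \<phi>' s"
      using mvt_simple[of 0 t \<phi> "\<lambda>s v. v * \<phi>' s"] t by auto
    let ?y1 = "s *\<^sub>R h + t *\<^sub>R k" and ?y2 = "s *\<^sub>R h + 0 *\<^sub>R k"
    have y: "norm ?y1 \<le> t * m" "norm ?y2 \<le> t * m"
      using small[of s t] small[of s 0] s t by auto
    have e: "norm (f' (x + y) h - f' x h - f'' y) \<le> \<epsilon> / 2 * t" if "norm y \<le> t * m" for y
    proof -
      have "norm (f' (x + y) h - f' x h - f'' y) \<le> \<epsilon> / (2 * m) * norm y"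
        using d(2)[of "x + y"] that tm by simp
      also have "\<dots> \<le> \<epsilon> / (2 * m) * (t * m)"
        using that \<open>\<epsilon> / (2 * m) > 0\<close> by (intro mult_left_mono) auto
      also have "\<dots> = \<epsilon> / 2 * t" using m by simp
      finally show ?thesis .
    qed
    have "f'' ?y1 - f'' ?y2 = t * f'' k" by (simp add: f''.add f''.scale)
    then have "\<phi>' s - t * f'' k = (f' (x + ?y1) h - f' x h - f'' ?y1) - (f' (x + ?y2) h - f' x h - f'' ?y2)"
      by (simp add: \<phi>'_def add.assoc)
    then have "\<bar>\<phi>' s - t * f'' k\<bar> \<le> \<bar>f' (x + ?y1) h - f' x h - f'' ?y1\<bar> + \<bar>f' (x + ?y2) h - f' x h - f'' ?y2\<bar>"
      by (metis abs_triangle_ineq4)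
    then have "\<bar>\<phi>' s - t * f'' k\<bar> \<le> \<epsilon> * t"
      using e[OF y(1)] e[OF y(2)] by simp
    then have "t * \<bar>\<phi>' s - t * f'' k\<bar> \<le> t * (\<epsilon> * t)"
      using t by (intro mult_left_mono) auto
    moreover have "t * \<bar>\<phi>' s - t * f'' k\<bar> = \<bar>(\<phi> t - \<phi> 0) - t\<^sup>2 * f'' k\<bar>"
    proof -
      have "(\<phi> t - \<phi> 0) - t\<^sup>2 * f'' k = t * (\<phi>' s - t * f'' k)"
        unfolding s(2) by (simp add: power2_eq_square algebra_simps)
      then show ?thesis using t by (simp add: abs_mult)
    qed
    ultimately show ?thesis
      by (simp add: \<phi>_def power2_eq_square algebra_simps)
  qed
  ultimately show ?thesis by blast
qed

text \<open>The second difference is symmetric in \<open>h\<close> and \<open>k\<close>, and both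
  mixed derivatives are its limit after division by t^2.\<close>

lemma second_derivative_symmetric_real:
  fixes f :: "'a::real_normed_vector \<Rightarrow> real"
  assumes "open S" "smooth_on f S" "x \<in> S"
  shows "frechet_derivative (\<lambda>x. frechet_derivative f (at x) h) (at x) k =
         frechet_derivative (\<lambda>x. frechet_derivative f (at x) k) (at x) h" (is "?a = ?b")
proof -
  have "\<bar>?a - ?b\<bar> \<le> 2 * \<epsilon>" if "\<epsilon> > 0" for \<epsilon>
  proof -
    have D: "((\<lambda>x. frechet_derivative f (at x) h) has_derivative
        frechet_derivative (\<lambda>x. frechet_derivative f (at x) h) (at x)) (at x)" for h
      by (rule smooth_on_has_derivative[OF smooth_on_frechet_derivative[OF assms(2)] assms(3)])
    have B: "\<exists>t0>0. \<forall>t. 0 < t \<and> t < t0 \<longrightarrow> \<bar>f (x + t *\<^sub>R h + t *\<^sub>R k) - f (x + t *\<^sub>R h) - f (x + t *\<^sub>R k) + f x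
        - t\<^sup>2 * frechet_derivative (\<lambda>x. frechet_derivative f (at x) h) (at x) k\<bar> \<le> \<epsilon> * t\<^sup>2" for h k
      by (rule second_difference_bound[OF assms(1,3) _ D that]) (rule smooth_on_has_derivative[OF assms(2)])
    obtain t1 where t1: "t1 > 0" "\<And>t. 0 < t \<and> t < t1 \<Longrightarrow>
      \<bar>f (x + t *\<^sub>R h + t *\<^sub>R k) - f (x + t *\<^sub>R h) - f (x + t *\<^sub>R k) + f x - t\<^sup>2 * ?a\<bar> \<le> \<epsilon> * t\<^sup>2"
      using B[of h k] by blast
    obtain t2 where t2: "t2 > 0" "\<And>t. 0 < t \<and> t < t2 \<Longrightarrow>
      \<bar>f (x + t *\<^sub>R k + t *\<^sub>R h) - f (x + t *\<^sub>R k) - f (x + t *\<^sub>R h) + f x - t\<^sup>2 * ?b\<bar> \<le> \<epsilon> * t\<^sup>2"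
      using B[of k h] by blast
    define t where "t = min t1 t2 / 2"
    have t: "0 < t" "t < t1" "t < t2" using t1(1) t2(1) by (auto simp: t_def)
    define F where "F = f (x + t *\<^sub>R h + t *\<^sub>R k)"
    have F: "f (x + t *\<^sub>R k + t *\<^sub>R h) = F" by (simp add: F_def add.assoc add.commute[of "t *\<^sub>R h"])
    have "\<bar>F - f (x + t *\<^sub>R k) - f (x + t *\<^sub>R h) + f x - t\<^sup>2 * ?b\<bar> \<le> \<epsilon> * t\<^sup>2"
      using t2(2)[of t] t unfolding F by simp
    moreover have "\<bar>F - f (x + t *\<^sub>R h) - f (x + t *\<^sub>R k) + f x - t\<^sup>2 * ?a\<bar> \<le> \<epsilon> * t\<^sup>2"
      using t1(2)[of t] t unfolding F_def by simp
    ultimately have "\<bar>t\<^sup>2 * ?a - t\<^sup>2 * ?b\<bar> \<le> 2 * (\<epsilon> * t\<^sup>2)"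
      by (auto simp: abs_le_iff)
    moreover have "t\<^sup>2 * ?a - t\<^sup>2 * ?b = t\<^sup>2 * (?a - ?b)"
      by (simp add: right_diff_distrib)
    ultimately have "t\<^sup>2 * \<bar>?a - ?b\<bar> \<le> t\<^sup>2 * (2 * \<epsilon>)"
      by (simp add: abs_mult mult_ac)
    then show ?thesis using t by simp
  qed
  \<comment> \<open>With this choice of \<epsilon> the distance of the two derivatives is at most
    half of itself.\<close>
  from this[of "\<bar>?a - ?b\<bar> / 4"] show ?thesis by (cases "?a = ?b") auto
qed

lemma second_derivative_symmetric:
  fixes f :: "'a::real_normed_vector \<Rightarrow> 'b::euclidean_space"
  assumes "open S" "smooth_on f S" "x \<in> S"
  shows "frechet_derivative (\<lambda>x. frechet_derivative f (at x) h) (at x) k =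
         frechet_derivative (\<lambda>x. frechet_derivative f (at x) k) (at x) h"
proof (rule euclidean_eqI)
  fix b :: 'b assume "b \<in> Basis"
  have smooth_b: "smooth_on (\<lambda>x. f x \<bullet> b) S"
    using assms smooth_on_inner_left by blast
  have 1: "frechet_derivative (\<lambda>x. f x \<bullet> b) (at y) v = frechet_derivative f (at y) v \<bullet> b" if "y \<in> S" for y v
    using frechet_derivative_eq[OF has_derivative_inner_left[OF smooth_on_has_derivative[OF assms(2) that]]]
    by simp
  have 2: "frechet_derivative (\<lambda>x. frechet_derivative f (at x) h) (at x) k \<bullet> b =
      frechet_derivative (\<lambda>y. frechet_derivative (\<lambda>x. f x \<bullet> b) (at y) h) (at x) k" for h k
  proof -
    have "frechet_derivative (\<lambda>y. frechet_derivative (\<lambda>x. f x \<bullet> b) (at y) h) (at x) =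
        frechet_derivative (\<lambda>y. frechet_derivative f (at y) h \<bullet> b) (at x)"
      by (rule frechet_derivative_cong_open[OF assms(1,3) 1])
    also have "\<dots> = (\<lambda>k. frechet_derivative (\<lambda>x. frechet_derivative f (at x) h) (at x) k \<bullet> b)"
      by (rule frechet_derivative_eq[OF has_derivative_inner_left[OF
        smooth_on_has_derivative[OF smooth_on_frechet_derivative[OF assms(2)] assms(3)]]])
    finally show ?thesis by simp
  qed
  show "frechet_derivative (\<lambda>x. frechet_derivative f (at x) h) (at x) k \<bullet> b =
      frechet_derivative (\<lambda>x. frechet_derivative f (at x) k) (at x) h \<bullet> b"
    unfolding 2 by (rule second_derivative_symmetric_real[OF assms(1) smooth_b assms(3)])
qed

section \<open>The Frobenius theorem for graphs\<close>

text \<open>Picard iteration on the whole unit interval at once: Lipschitz constant one half makes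
  the integral operator a contraction there, and the speed bound \<open>R\<close> confines solutions
  to the ball.\<close>

lemma ode_solution_exists:
  fixes G :: "real \<Rightarrow> 'y::euclidean_space \<Rightarrow> 'y"
  assumes "R > 0"
    and cont: "continuous_on ({0..1} \<times> cball y0 R) (\<lambda>p. G (fst p) (snd p))"
    and bound: "\<And>t y. t \<in> {0..1} \<Longrightarrow> y \<in> cball y0 R \<Longrightarrow> norm (G t y) \<le> R"
    and lip: "\<And>t x y. t \<in> {0..1} \<Longrightarrow> x \<in> cball y0 R \<Longrightarrow> y \<in> cball y0 R \<Longrightarrow>
      norm (G t x - G t y) \<le> 1/2 * norm (x - y)"
  shows "\<exists>y. y 0 = y0 \<and> (\<forall>t\<in>{0..1}. y t \<in> cball y0 R \<and>
    (y has_vector_derivative G t (y t)) (at t within {0..1}))"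
proof -
  \<comment> \<open>Clamping time to the unit interval and projecting states to the ball extends
    \<open>G\<close> to all arguments, so that the operator acts on the complete space of bounded
    continuous functions on the line. The projection \<open>pr\<close> is 1-Lipschitz and does not
    spoil the contraction.\<close>
  define cl :: "real \<Rightarrow> real" where "cl t = max 0 (min 1 t)" for t
  define pr where "pr = closest_point (cball y0 R)"
  have cl: "cl t \<in> {0..1}" for t by (auto simp: cl_def)
  have cl_id: "cl t = t" if "t \<in> {0..1}" for t using that by (auto simp: cl_def)
  have cl_cont: "continuous_on S cl" for S unfolding cl_def by (intro continuous_intros)
  have ne: "cball y0 R \<noteq> {}" using \<open>R > 0\<close> by simp
  have pr: "pr y \<in> cball y0 R" for y
    unfolding pr_def using ne by (intro closest_point_in_set) auto
  have pr_id: "pr y = y" if "y \<in> cball y0 R" for y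
    unfolding pr_def using that by (rule closest_point_self)
  have pr_lip: "norm (pr x - pr y) \<le> norm (x - y)" for x y
    unfolding pr_def using closest_point_lipschitz[of "cball y0 R" x y] ne by (simp add: dist_norm)
  have pr_cont: "continuous_on S pr" for S
    unfolding pr_def using ne by (intro continuous_on_closest_point) auto
  have H_cont: "continuous_on S (\<lambda>s. G (cl s) (pr (f s)))" if "continuous_on S f" for S f
  proof -
    have "continuous_on S (\<lambda>s. (\<lambda>p. G (fst p) (snd p)) (cl s, pr (f s)))"
    proof (rule continuous_on_compose2[OF cont])
      show "continuous_on S (\<lambda>s. (cl s, pr (f s)))"
        by (intro continuous_on_Pair cl_cont continuous_on_compose2[OF pr_cont that subset_UNIV])
      show "(\<lambda>s. (cl s, pr (f s))) ` S \<subseteq> {0..1} \<times> cball y0 R"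
        using cl pr by blast
    qed
    then show ?thesis by simp
  qed
  define T where "T f t = y0 + integral {0..cl t} (\<lambda>s. G (cl s) (pr (apply_bcontfun f s)))"
    for f :: "real \<Rightarrow>\<^sub>C 'y" and t
  have T: "T f \<in> bcontfun" for f
  proof (rule bcontfun_normI)
    have "continuous_on {0..1} (\<lambda>u. integral {0..u} (\<lambda>s. G (cl s) (pr (apply_bcontfun f s))))"
      by (intro indefinite_integral_continuous_1 integrable_continuous_real H_cont) auto
    from continuous_on_compose2[OF this cl_cont[of UNIV]]
    show "continuous_on UNIV (T f)"
      unfolding T_def using cl by (intro continuous_on_add continuous_on_const) blast
    show "norm (T f t) \<le> norm y0 + R" for t
    proof -
      have "norm (integral {0..cl t} (\<lambda>s. G (cl s) (pr (apply_bcontfun f s)))) \<le> R * (cl t - 0)"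
        using cl[of t] bound[OF cl pr] by (intro integral_bound H_cont) auto
      also have "\<dots> \<le> R" using cl[of t] \<open>R > 0\<close> by (simp add: mult_left_le)
      finally show ?thesis unfolding T_def by norm
    qed
  qed
  define T' where "T' f = Bcontfun (T f)" for f
  have T': "apply_bcontfun (T' f) = T f" for f
    unfolding T'_def using T by (rule Bcontfun_inverse)
  have "dist (T' f) (T' g) \<le> 1/2 * dist f g" for f g
  proof (rule dist_bound)
    fix t
    let ?F = "\<lambda>f s. G (cl s) (pr (apply_bcontfun f s))"
    have int: "?F f integrable_on {0..cl t}" for f
      by (intro integrable_continuous_real H_cont) auto
    have "norm (integral {0..cl t} (\<lambda>s. ?F f s - ?F g s)) \<le> (1/2 * dist f g) * (cl t - 0)"
    proof (rule integral_bound)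
      show "0 \<le> cl t" using cl[of t] by simp
      show "continuous_on {0..cl t} (\<lambda>s. ?F f s - ?F g s)"
        by (intro continuous_on_diff H_cont) auto
      fix s assume "s \<in> {0..cl t}"
      have "norm (?F f s - ?F g s) \<le> 1/2 * norm (pr (apply_bcontfun f s) - pr (apply_bcontfun g s))"
        by (rule lip[OF cl pr pr])
      also have "\<dots> \<le> 1/2 * norm (apply_bcontfun f s - apply_bcontfun g s)"
        using pr_lip by simp
      also have "\<dots> \<le> 1/2 * dist f g"
        using dist_bounded[of f s g] by (simp add: dist_norm)
      finally show "norm (?F f s - ?F g s) \<le> 1/2 * dist f g" .
    qed
    also have "\<dots> \<le> (1/2 * dist f g) * 1"
      using cl[of t] by (intro mult_left_mono) auto
    finally show "dist (apply_bcontfun (T' f) t) (apply_bcontfun (T' g) t) \<le> 1/2 * dist f g"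
      using integral_diff[OF int int, of f g] by (simp add: T' T_def dist_norm)
  qed
  then obtain f where f: "T' f = f"
    using banach_fix_type[of "1/2" T'] by auto
  define y where "y = apply_bcontfun f"
  have y: "y t = y0 + integral {0..cl t} (\<lambda>s. G (cl s) (pr (y s)))" for t
    using T'[of f] unfolding f y_def T_def by metis
  have "continuous_on S y" for S unfolding y_def by simp
  note cont_y = H_cont[OF this]
  \<comment> \<open>Speed at most \<open>R\<close> over time at most one keeps the fixed point in
    the ball; there \<open>pr\<close> is the identity, and the modified equation is the original
    one.\<close>
  have in_ball: "y t \<in> cball y0 R" for t
  proof -
    have "norm (integral {0..cl t} (\<lambda>s. G (cl s) (pr (y s)))) \<le> R * (cl t - 0)"
      using cl[of t] bound[OF cl pr] cont_y by (intro integral_bound) auto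
    also have "\<dots> \<le> R" using cl[of t] \<open>R > 0\<close> by (simp add: mult_left_le)
    finally show ?thesis using y[of t] by (simp add: dist_norm)
  qed
  have "(y has_vector_derivative G t (y t)) (at t within {0..1})" if t: "t \<in> {0..1}" for t
  proof -
    have "((\<lambda>u. y0 + integral {0..u} (\<lambda>s. G (cl s) (pr (y s)))) has_vector_derivative
        0 + G (cl t) (pr (y t))) (at t within {0..1})"
      using cont_y t by (intro has_vector_derivative_add integral_has_vector_derivative) auto
    then have "((\<lambda>u. y0 + integral {0..u} (\<lambda>s. G (cl s) (pr (y s)))) has_vector_derivative
        G t (y t)) (at t within {0..1})"
      using cl_id[OF t] pr_id[OF in_ball] by simp
    then show ?thesis
    proof (rule has_vector_derivative_transform[OF t, rotated])
      show "y u = y0 + integral {0..u} (\<lambda>s. G (cl s) (pr (y s)))" if "u \<in> {0..1}" for u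
        using y[of u] unfolding cl_id[OF that] .
    qed
  qed
  moreover have "y 0 = y0" using y[of 0] cl_id[of 0] by simp
  ultimately show ?thesis using in_ball by blast
qed

text \<open>At the maximum m of \<open>norm (e t)\<close> the mean value inequality gives m \<le> c
  + m / 2. The unit interval and the coefficient one half thus replace the exponential
  estimate.\<close>

lemma gronwall_half:
  fixes e :: "real \<Rightarrow> 'y::real_normed_vector"
  assumes e0: "e 0 = 0"
    and e': "\<And>t. t \<in> {0..1} \<Longrightarrow> (e has_vector_derivative e' t) (at t within {0..1})"
    and bound: "\<And>t. t \<in> {0..1} \<Longrightarrow> norm (e' t) \<le> c + 1/2 * norm (e t)"
    and "t \<in> {0..1}"
  shows "norm (e t) \<le> 2 * c"
proof -
  have "continuous_on {0..1} (\<lambda>t. norm (e t))"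
    using e' has_vector_derivative_continuous
    by (intro continuous_on_norm) (fastforce simp: continuous_on_eq_continuous_within)
  then obtain t1 where t1: "t1 \<in> {0..1}" "\<And>t. t \<in> {0..1} \<Longrightarrow> norm (e t) \<le> norm (e t1)"
    using continuous_attains_sup[of "{0..1::real}" "\<lambda>t. norm (e t)"] by auto
  let ?m = "norm (e t1)"
  have B: "onorm (\<lambda>h. h *\<^sub>R e' t) \<le> c + 1/2 * ?m" if t: "t \<in> {0..1}" for t
    by (rule onorm_le) (use bound[OF t] t1(2)[OF t] in \<open>auto simp: mult.commute intro!: mult_left_mono\<close>)
  have "norm (e t1 - e 0) \<le> (c + 1/2 * ?m) * norm (t1 - 0)"
    using e' B t1(1)
    by (intro differentiable_bound[of "{0..1}" e "\<lambda>t h. h *\<^sub>R e' t"])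
      (auto simp: has_vector_derivative_def)
  moreover have "(c + 1/2 * ?m) * norm (t1 - 0) \<le> (c + 1/2 * ?m) * 1"
  proof (rule mult_left_mono)
    have "0 \<le> norm (e' t1)" by simp
    also have "\<dots> \<le> c + 1/2 * ?m" using bound t1 by blast
    finally show "0 \<le> c + 1/2 * ?m" .
  qed (use t1 in auto)
  ultimately have "?m \<le> 2 * c" using e0 by simp
  then show ?thesis using t1(2)[OF assms(4)] by simp
qed

text \<open>\<open>smooth_on\<close> speaks of derivatives in fixed directions; this passes from
  finitely many of them to a bound for the whole linear map.\<close>

lemma linear_norm_le_Basis:
  fixes f :: "'a::euclidean_space \<Rightarrow> 'b::real_normed_vector"
  assumes "linear f" "\<And>b. b \<in> Basis \<Longrightarrow> norm (f b) \<le> c b"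
  shows "norm (f v) \<le> (\<Sum>b\<in>Basis. c b) * norm v"
proof -
  have "norm (f v) = norm (\<Sum>b\<in>Basis. (v \<bullet> b) *\<^sub>R f b)"
    by (subst (1) euclidean_representation[symmetric])
      (simp add: linear_sum[OF assms(1)] linear_scale[OF assms(1)] del: euclidean_representation)
  also have "\<dots> \<le> (\<Sum>b\<in>Basis. norm v * c b)"
  proof (rule order_trans[OF norm_sum sum_mono])
    fix b :: 'a assume b: "b \<in> Basis"
    then show "norm ((v \<bullet> b) *\<^sub>R f b) \<le> norm v * c b"
      using assms(2)[OF b] Basis_le_norm[OF b, of v] by (simp add: mult_mono)
  qed
  also have "\<dots> = (\<Sum>b\<in>Basis. c b) * norm v"
    by (simp add: sum_distrib_left mult.commute)
  finally show ?thesis .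
qed

section \<open>Uniform estimates on compact sets\<close>

lemma smooth_on_derivative_bound:
  fixes g :: "'a::euclidean_space \<Rightarrow> 'b::real_normed_vector"
  assumes "smooth_on g W" "compact K" "K \<subseteq> W"
  shows "\<exists>C\<ge>0. \<forall>p\<in>K. \<forall>v. norm (frechet_derivative g (at p) v) \<le> C * norm v"
proof -
  have "\<exists>c. \<forall>p\<in>K. norm (frechet_derivative g (at p) b) \<le> c" for b
  proof -
    have "continuous_on K (\<lambda>p. frechet_derivative g (at p) b)"
      using smooth_on_continuous[OF smooth_on_frechet_derivative[OF assms(1)]] assms(3)
        continuous_on_subset by blast
    then have "bounded ((\<lambda>p. frechet_derivative g (at p) b) ` K)"
      using assms(2) compact_continuous_image compact_imp_bounded by blast
    then show ?thesis by (auto simp: bounded_iff)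
  qed
  then obtain c where c: "\<And>b p. p \<in> K \<Longrightarrow> norm (frechet_derivative g (at p) b) \<le> c b" by metis
  have "norm (frechet_derivative g (at p) v) \<le> (\<Sum>b\<in>Basis. \<bar>c b\<bar>) * norm v" if "p \<in> K" for p v
  proof (rule linear_norm_le_Basis)
    show "linear (frechet_derivative g (at p))"
      using smooth_on_has_derivative[OF assms(1)] that assms(3) has_derivative_linear by blast
    show "norm (frechet_derivative g (at p) b) \<le> \<bar>c b\<bar>" for b
      using c[OF that, of b] by linarith
  qed
  then show ?thesis by (intro exI[of _ "\<Sum>b\<in>Basis. \<bar>c b\<bar>"]) (auto intro: sum_nonneg)
qed

lemma smooth_on_lipschitz:
  fixes g :: "'a::euclidean_space \<Rightarrow> 'b::real_normed_vector"
  assumes "smooth_on g W" "compact K" "convex K" "K \<subseteq> W"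
  shows "\<exists>C\<ge>0. \<forall>p\<in>K. \<forall>q\<in>K. norm (g q - g p) \<le> C * norm (q - p)"
proof -
  obtain C where C: "C \<ge> 0" "\<And>p v. p \<in> K \<Longrightarrow> norm (frechet_derivative g (at p) v) \<le> C * norm v"
    using smooth_on_derivative_bound[OF assms(1,2,4)] by blast
  have "norm (g q - g p) \<le> C * norm (q - p)" if "p \<in> K" "q \<in> K" for p q
  proof (rule differentiable_bound[OF assms(3) _ _ that(2,1)])
    show "(g has_derivative frechet_derivative g (at x)) (at x within K)" if "x \<in> K" for x
      using smooth_on_has_derivative[OF assms(1)] that assms(4) has_derivative_at_withinI by blast
    show "onorm (frechet_derivative g (at x)) \<le> C" if "x \<in> K" for x
      using C(2)[OF that] by (rule onorm_le)
  qed
  with C(1) show ?thesis by blast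
qed

text \<open>The derivative is Lipschitz on \<open>K\<close>, one basis direction at a time, so along
  the segment from \<open>p\<close> to \<open>q\<close> it deviates from its value at
  \<open>p\<close> by a multiple of \<open>norm (q - p)\<close>; convexity keeps the segment in
  \<open>K\<close>.\<close>

lemma smooth_on_taylor:
  fixes g :: "'a::euclidean_space \<Rightarrow> 'b::real_normed_vector"
  assumes "smooth_on g W" "compact K" "convex K" "K \<subseteq> W"
  shows "\<exists>C\<ge>0. \<forall>p\<in>K. \<forall>q\<in>K. norm (g q - g p - frechet_derivative g (at p) (q - p)) \<le> C * (norm (q - p))\<^sup>2"
proof -
  let ?g' = "\<lambda>p. frechet_derivative g (at p)"
  have "\<exists>C\<ge>0. \<forall>p\<in>K. \<forall>q\<in>K. norm (?g' q b - ?g' p b) \<le> C * norm (q - p)" for b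
    by (rule smooth_on_lipschitz[OF smooth_on_frechet_derivative[OF assms(1)] assms(2-4)])
  then obtain c where c: "\<And>b. c b \<ge> 0" "\<And>b p q. p \<in> K \<Longrightarrow> q \<in> K \<Longrightarrow> norm (?g' q b - ?g' p b) \<le> c b * norm (q - p)"
    by metis
  let ?C = "\<Sum>b\<in>Basis. c b"
  have C0: "?C \<ge> 0" using c(1) by (simp add: sum_nonneg)
  have g': "(g has_derivative ?g' p) (at p)" if "p \<in> K" for p
    using smooth_on_has_derivative[OF assms(1)] that assms(4) by blast
  have lip: "norm (?g' q v - ?g' p v) \<le> ?C * norm (q - p) * norm v" if "p \<in> K" "q \<in> K" for p q v
  proof -
    have "norm (?g' q v - ?g' p v) \<le> (\<Sum>b\<in>Basis. c b * norm (q - p)) * norm v"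
    proof (rule linear_norm_le_Basis)
      show "linear (\<lambda>v. ?g' q v - ?g' p v)"
        using that g' by (intro linear_compose_sub has_derivative_linear) blast+
    qed (use c(2) that in auto)
    then show ?thesis by (simp add: sum_distrib_right)
  qed
  have "norm (g q - g p - ?g' p (q - p)) \<le> ?C * (norm (q - p))\<^sup>2" if pq: "p \<in> K" "q \<in> K" for p q
  proof -
    have sub: "closed_segment p q \<subseteq> K" using pq assms(3) by (simp add: closed_segment_subset)
    have "norm (g q - g p - ?g' p (q - p)) \<le> norm (q - p) * (?C * norm (q - p))"
    proof (rule differentiable_bound_linearization[where S="closed_segment p q"])
      show "p + t *\<^sub>R (q - p) \<in> closed_segment p q" if "t \<in> {0..1}" for t
        using that unfolding closed_segment_def by (auto intro!: exI[of _ t] simp: algebra_simps)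
      show "(g has_derivative ?g' x) (at x within closed_segment p q)" if "x \<in> closed_segment p q" for x
        using g' sub that has_derivative_at_withinI by blast
      show "onorm (?g' x - ?g' p) \<le> ?C * norm (q - p)" if x: "x \<in> closed_segment p q" for x
      proof (rule onorm_le)
        fix v
        have "norm ((?g' x - ?g' p) v) \<le> ?C * norm (x - p) * norm v"
          using lip[of p x v] pq x sub by auto
        also have "\<dots> \<le> ?C * norm (q - p) * norm v"
          using segment_bound1[OF x] C0 by (intro mult_right_mono mult_left_mono) auto
        finally show "norm ((?g' x - ?g' p) v) \<le> ?C * norm (q - p) * norm v" .
      qed
    qed auto
    then show ?thesis by (simp add: power2_eq_square mult_ac)
  qed
  with C0 show ?thesis by blast
qed

lemma has_derivative_of_quadratic_bound:
  fixes f :: "'a::euclidean_space \<Rightarrow> 'b::real_normed_vector"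
  assumes "linear f'" "open S" "x \<in> S"
    and bound: "\<And>y. y \<in> S \<Longrightarrow> norm (f y - f x - f' (y - x)) \<le> C * (norm (y - x))\<^sup>2"
  shows "(f has_derivative f') (at x)"
  unfolding has_derivative_at_alt
proof (intro conjI allI impI)
  show "bounded_linear f'" using assms(1) by (simp add: linear_conv_bounded_linear)
  fix e :: real assume "e > 0"
  obtain d where d: "d > 0" "ball x d \<subseteq> S" using assms(2,3) open_contains_ball by blast
  let ?d = "min d (e / (\<bar>C\<bar> + 1))"
  have "?d > 0" using d \<open>e > 0\<close> by simp
  moreover have "norm (f y - f x - f' (y - x)) \<le> e * norm (y - x)" if "norm (y - x) < ?d" for y
  proof -
    have "y \<in> S" using that d by (auto simp: dist_norm norm_minus_commute subset_iff)
    then have "norm (f y - f x - f' (y - x)) \<le> C * (norm (y - x))\<^sup>2" by (rule bound)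
    also have "\<dots> \<le> (\<bar>C\<bar> + 1) * norm (y - x) * norm (y - x)"
      by (simp add: power2_eq_square mult.assoc mult_right_mono)
    also have "\<dots> \<le> e * norm (y - x)"
      using that by (intro mult_right_mono) (auto simp: field_simps)
    finally show ?thesis .
  qed
  ultimately show "\<exists>d>0. \<forall>y. norm (y - x) < d \<longrightarrow> norm (f y - f x - f' (y - x)) \<le> e * norm (y - x)"
    by blast
qed

text \<open>The solution at \<open>v\<close> is obtained by integrating along the ray from \<open>0\<close> to \<open>v\<close>. On a small ball the
  radial equations have Lipschitz constant at most one half, and the integrability condition says
  that \<open>t \<mapsto> t F (t v) (y t) w\<close> solves the equation linearised in the direction \<open>w\<close> up to an error
  of second order.\<close>

lemma frobenius_graph:
  fixes F :: "'k::euclidean_space \<Rightarrow> 'y::euclidean_space \<Rightarrow> 'k \<Rightarrow> 'y"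
  assumes W: "open W" "(0, y0) \<in> W"
    and smooth: "\<And>h. smooth_on (\<lambda>p. F (fst p) (snd p) h) W"
    and lin: "\<And>z y. (z, y) \<in> W \<Longrightarrow> linear (F z y)"
    and integrable: "\<And>z y h k. (z, y) \<in> W \<Longrightarrow>
      frechet_derivative (\<lambda>p. F (fst p) (snd p) h) (at (z, y)) (k, F z y k) =
      frechet_derivative (\<lambda>p. F (fst p) (snd p) k) (at (z, y)) (h, F z y h)"
  shows "\<exists>r>0. \<exists>f. f 0 = y0 \<and>
    (\<forall>z\<in>ball 0 r. (z, f z) \<in> W \<and> (f has_derivative F z (f z)) (at z))"
proof -
  obtain R0 where R0: "R0 > 0" "cball (0, y0) R0 \<subseteq> W"
    using W open_contains_cball by blast
  \<comment> \<open>By the triangle inequality for pairs, the product of two balls of radius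
    \<open>R0 / 2\<close> fits into the ball of radius \<open>R0\<close>. The product shape keeps
    the constraints on position and state independent.\<close>
  define R where "R = R0 / 2"
  have "R > 0" using R0 by (simp add: R_def)
  define K where "K = cball (0::'k) R \<times> cball y0 R"
  have K: "compact K" "convex K"
    by (auto simp: K_def intro: compact_Times convex_Times)
  have KW: "K \<subseteq> W"
  proof
    fix p assume "p \<in> K"
    then have "norm (fst p) \<le> R" "norm (snd p - y0) \<le> R"
      by (auto simp: K_def dist_norm norm_minus_commute)
    then have "norm (fst p, snd p - y0) \<le> R0"
      using norm_Pair_le[of "fst p" "snd p - y0"] by (simp add: R_def)
    moreover have "(fst p, snd p - y0) = p - (0, y0)" by (simp add: prod_eq_iff)
    ultimately have "p \<in> cball (0, y0) R0" by (simp only: dist_norm mem_cball norm_minus_commute)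
    then show "p \<in> W" using R0 by blast
  qed
  define H where "H h p = F (fst p) (snd p) h" for h p
  define H' where "H' h p = frechet_derivative (H h) (at p)" for h p
  have smoothH: "smooth_on (H h) W" for h
    using smooth[of h] unfolding H_def .
  have linH: "linear (\<lambda>h. H h p)" if "p \<in> K" for p
    using lin[of "fst p" "snd p"] that KW unfolding H_def by auto
  have H': "(H h has_derivative H' h p) (at p)" if "p \<in> K" for h p
    unfolding H'_def using smooth_on_has_derivative[OF smoothH] that KW by blast
  \<comment> \<open>Linearity in \<open>h\<close> is known over \<open>W\<close> only; as
    \<open>W\<close> is open, the basis expansion of \<open>H h\<close> may be differentiated
    there.\<close>
  have H'_lin: "linear (\<lambda>h. H' h p u)" if p: "p \<in> K" for p u
  proof -
    have "H' h p = (\<lambda>u. \<Sum>b\<in>Basis. (h \<bullet> b) *\<^sub>R H' b p u)" for h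
    proof -
      have "((\<lambda>p. \<Sum>b\<in>Basis. (h \<bullet> b) *\<^sub>R H b p) has_derivative (\<lambda>u. \<Sum>b\<in>Basis. (h \<bullet> b) *\<^sub>R H' b p u)) (at p)"
        by (intro has_derivative_sum has_derivative_scaleR_right H' p)
      moreover have "(\<Sum>b\<in>Basis. (h \<bullet> b) *\<^sub>R H b q) = H h q" if "q \<in> W" for q
      proof -
        have l: "linear (\<lambda>h. H h q)" using lin[of "fst q" "snd q"] that unfolding H_def by auto
        show ?thesis
          using linear_sum[OF l, of "\<lambda>b. (h \<bullet> b) *\<^sub>R b" Basis]
          by (simp add: linear_scale[OF l] euclidean_representation)
      qed
      ultimately have "(H h has_derivative (\<lambda>u. \<Sum>b\<in>Basis. (h \<bullet> b) *\<^sub>R H' b p u)) (at p)"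
        using has_derivative_transform_within_open[OF _ W(1)] p KW by blast
      then show ?thesis unfolding H'_def by (rule frechet_derivative_eq)
    qed
    then have "(\<lambda>h. H' h p u) = (\<lambda>h. \<Sum>b\<in>Basis. (h \<bullet> b) *\<^sub>R H' b p u)" by metis
    then show ?thesis
      by (simp add: linear_iff inner_add_left scaleR_add_left sum.distrib scaleR_sum_right)
  qed
  have b1: "\<exists>C\<ge>0. \<forall>p\<in>K. norm (H b p) \<le> C" for b
  proof -
    have "continuous_on K (H b)"
      by (rule continuous_on_subset[OF smooth_on_continuous[OF smoothH] KW])
    from compact_imp_bounded[OF compact_continuous_image[OF this K(1)]]
    obtain C where "\<forall>p\<in>K. norm (H b p) \<le> C" by (auto simp: bounded_iff)
    then show ?thesis
      by (intro exI[of _ "\<bar>C\<bar>"]) (auto intro: order_trans[OF _ abs_ge_self])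
  qed
  obtain c1 where c1: "\<And>b. c1 b \<ge> 0" "\<And>b p. p \<in> K \<Longrightarrow> norm (H b p) \<le> c1 b"
    using b1 by metis
  have "\<exists>C\<ge>0. \<forall>p\<in>K. \<forall>q\<in>K. norm (H b q - H b p) \<le> C * norm (q - p)" for b
    by (rule smooth_on_lipschitz[OF smoothH K KW])
  then obtain c2 where c2: "\<And>b. c2 b \<ge> 0"
    "\<And>b p q. p \<in> K \<Longrightarrow> q \<in> K \<Longrightarrow> norm (H b q - H b p) \<le> c2 b * norm (q - p)"
    by metis
  have "\<exists>C\<ge>0. \<forall>p\<in>K. \<forall>q\<in>K. norm (H b q - H b p - H' b p (q - p)) \<le> C * (norm (q - p))\<^sup>2" for b
    unfolding H'_def by (rule smooth_on_taylor[OF smoothH K KW])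
  then obtain c3 where c3: "\<And>b. c3 b \<ge> 0"
    "\<And>b p q. p \<in> K \<Longrightarrow> q \<in> K \<Longrightarrow> norm (H b q - H b p - H' b p (q - p)) \<le> c3 b * (norm (q - p))\<^sup>2"
    by metis
  have "\<exists>C\<ge>0. \<forall>p\<in>K. \<forall>v. norm (H' b p v) \<le> C * norm v" for b
    unfolding H'_def by (rule smooth_on_derivative_bound[OF smoothH K(1) KW])
  then obtain c4 where c4: "\<And>b. c4 b \<ge> 0" "\<And>b p v. p \<in> K \<Longrightarrow> norm (H' b p v) \<le> c4 b * norm v"
    by metis
  \<comment> \<open>One constant for four estimates of \<open>H b\<close>: values, Lipschitz
    continuity, Taylor remainder and derivative. The summand 1 makes it positive.\<close>
  define M where "M = (\<Sum>b\<in>Basis. c1 b + c2 b + c3 b + c4 b) + 1"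
  have "M > 0" unfolding M_def using c1(1) c2(1) c3(1) c4(1) by (intro add_nonneg_pos sum_nonneg) auto
  have M: "norm (T h) \<le> M * s * norm h"
    if "linear T" "s \<ge> 0" "\<And>b. norm (T b) \<le> (c1 b + c2 b + c3 b + c4 b) * s" for T :: "'k \<Rightarrow> 'y" and s h
  proof -
    have "norm (T h) \<le> (\<Sum>b\<in>Basis. (c1 b + c2 b + c3 b + c4 b) * s) * norm h"
      by (rule linear_norm_le_Basis) (use that in auto)
    also have "\<dots> = (M - 1) * s * norm h" by (simp add: M_def sum_distrib_right)
    also have "\<dots> \<le> M * s * norm h" using that(2) by (intro mult_right_mono) auto
    finally show ?thesis .
  qed
  have M1: "norm (H h p) \<le> M * norm h" if p: "p \<in> K" for h p
    using M[OF linH[OF p], of 1 h] c1(2)[OF p] c2(1) c3(1) c4(1)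
    by (simp add: add_increasing2)
  have M2: "norm (H h q - H h p) \<le> M * norm (q - p) * norm h" if p: "p \<in> K" "q \<in> K" for h p q
  proof (rule M)
    show "linear (\<lambda>h. H h q - H h p)" using linH p by (intro linear_compose_sub)
    show "norm (H b q - H b p) \<le> (c1 b + c2 b + c3 b + c4 b) * norm (q - p)" for b
      by (rule order_trans[OF c2(2)[OF p] mult_right_mono])
        (use c1(1)[of b] c2(1)[of b] c3(1)[of b] c4(1)[of b] in auto)
  qed simp
  have M3: "norm (H h q - H h p - H' h p (q - p)) \<le> M * (norm (q - p))\<^sup>2 * norm h" if p: "p \<in> K" "q \<in> K" for h p q
  proof (rule M)
    show "linear (\<lambda>h. H h q - H h p - H' h p (q - p))" using linH H'_lin p by (intro linear_compose_sub)
    show "norm (H b q - H b p - H' b p (q - p)) \<le> (c1 b + c2 b + c3 b + c4 b) * (norm (q - p))\<^sup>2" for b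
      by (rule order_trans[OF c3(2)[OF p] mult_right_mono])
        (use c1(1)[of b] c2(1)[of b] c3(1)[of b] c4(1)[of b] in auto)
  qed simp
  have M4: "norm (H' h p u) \<le> M * norm u * norm h" if p: "p \<in> K" for h p u
  proof (rule M)
    show "linear (\<lambda>h. H' h p u)" by (rule H'_lin[OF p])
    show "norm (H' b p u) \<le> (c1 b + c2 b + c3 b + c4 b) * norm u" for b
      by (rule order_trans[OF c4(2)[OF p] mult_right_mono])
        (use c1(1)[of b] c2(1)[of b] c3(1)[of b] c4(1)[of b] in auto)
  qed simp
  \<comment> \<open>For \<open>v\<close> in this ball the ray equation has Lipschitz constant
    \<open>M * norm v \<le> 1/2\<close> and speed at most \<open>R\<close>, and the ray stays where
    the estimates hold: the demands of \<open>ode_solution_exists\<close>.\<close>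
  define r where "r = min R (min (1/2) R / M)"
  have "r > 0" using \<open>R > 0\<close> \<open>M > 0\<close> by (simp add: r_def)
  have r: "norm v \<le> R" "M * norm v \<le> 1/2" "M * norm v \<le> R" if "v \<in> ball 0 r" for v :: 'k
    using that \<open>M > 0\<close> by (auto simp: r_def field_simps)
  have inK: "(t *\<^sub>R v, y) \<in> K" if "v \<in> ball 0 r" "t \<in> {0..1}" "y \<in> cball y0 R" for v :: 'k and t y
    using that r(1)[OF that(1)] mult_left_le_one_le[of "norm v" t] by (auto simp: K_def)
  have "\<exists>y. y 0 = y0 \<and> (\<forall>t\<in>{0..1}. y t \<in> cball y0 R \<and>
    (y has_vector_derivative H v (t *\<^sub>R v, y t)) (at t within {0..1}))" if v: "v \<in> ball 0 r" for v
  proof (rule ode_solution_exists[OF \<open>R > 0\<close>])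
    have "continuous_on ({0..1} \<times> cball y0 R) (\<lambda>p. H v (fst p *\<^sub>R v, snd p))"
    proof (rule continuous_on_compose2[OF smooth_on_continuous[OF smoothH]])
      show "continuous_on ({0..1} \<times> cball y0 R) (\<lambda>p. (fst p *\<^sub>R v, snd p))"
        by (intro continuous_intros)
      show "(\<lambda>p. (fst p *\<^sub>R v, snd p)) ` ({0..1} \<times> cball y0 R) \<subseteq> W"
        using inK[OF v] KW by auto
    qed
    then show "continuous_on ({0..1} \<times> cball y0 R) (\<lambda>p. H v (fst p *\<^sub>R v, snd p))" .
    show "norm (H v (t *\<^sub>R v, y)) \<le> R" if "t \<in> {0..1}" "y \<in> cball y0 R" for t y
      using M1[OF inK[OF v that], of v] r(3)[OF v] by linarith
    show "norm (H v (t *\<^sub>R v, x) - H v (t *\<^sub>R v, y)) \<le> 1/2 * norm (x - y)"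
      if "t \<in> {0..1}" "x \<in> cball y0 R" "y \<in> cball y0 R" for t x y
    proof -
      have "norm (H v (t *\<^sub>R v, x) - H v (t *\<^sub>R v, y)) \<le> M * norm (x - y) * norm v"
        using M2[OF inK[OF v that(1,3)] inK[OF v that(1,2)], of v] by (simp add: norm_Pair)
      also have "\<dots> = (M * norm v) * norm (x - y)" by simp
      also have "\<dots> \<le> 1/2 * norm (x - y)" using r(2)[OF v] by (rule mult_right_mono) simp
      finally show ?thesis .
    qed
  qed
  then obtain Y where Y: "\<And>v. v \<in> ball 0 r \<Longrightarrow> Y v 0 = y0"
    "\<And>v t. v \<in> ball 0 r \<Longrightarrow> t \<in> {0..1} \<Longrightarrow> Y v t \<in> cball y0 R"
    "\<And>v t. v \<in> ball 0 r \<Longrightarrow> t \<in> {0..1} \<Longrightarrow>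
      (Y v has_vector_derivative H v (t *\<^sub>R v, Y v t)) (at t within {0..1})"
    by metis
  define f where "f v = Y v 1" for v
  have f_in: "(v, f v) \<in> K" if "v \<in> ball 0 r" for v
    using inK[OF that _ Y(2)[OF that], of 1 1] by (simp add: f_def)
  \<comment> \<open>Along the degenerate ray in direction 0 the velocity vanishes;
    \<open>gronwall_half\<close> with \<open>c = 0\<close> shows that the solution is
    constant.\<close>
  have "norm (Y 0 1 - y0) \<le> 2 * 0"
  proof (rule gronwall_half)
    show "((\<lambda>t. Y 0 t - y0) has_vector_derivative H 0 (t *\<^sub>R 0, Y 0 t) - 0) (at t within {0..1})"
      if "t \<in> {0..1}" for t
      using Y(3)[of 0 t] that \<open>r > 0\<close> by (intro derivative_intros) auto
    show "norm (H 0 (t *\<^sub>R 0, Y 0 t) - 0) \<le> 0 + 1/2 * norm (Y 0 t - y0)" if "t \<in> {0..1}" for t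
      using linear_0[OF linH[OF inK[OF _ that Y(2)[OF _ that]]], of 0 0] \<open>r > 0\<close> by simp
  qed (use Y(1) \<open>r > 0\<close> in auto)
  then have f0: "f 0 = y0" by (simp add: f_def)
  have "(f has_derivative F v (f v)) (at v)" if v: "v \<in> ball 0 r" for v
  proof -
    \<comment> \<open>The constant that \<open>gronwall_half\<close> yields for the difference of
      two rays, see \<open>d_le\<close>.\<close>
    define n where "n = 2 * (M + 1)"
    have "n > 0" using \<open>M > 0\<close> by (simp add: n_def)
    have "norm (f v' - f v - F v (f v) (v' - v)) \<le>
        2 * (M * (n + 1) + (n + 1)\<^sup>2) * (norm (v' - v))\<^sup>2" if v': "v' \<in> ball 0 r" for v'
    proof -
      define w where "w = v' - v"
      define p where "p t = (t *\<^sub>R v, Y v t)" for t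
      define q where "q t = (t *\<^sub>R v', Y v' t)" for t
      define d where "d t = Y v' t - Y v t" for t
      \<comment> \<open>\<open>t *\<^sub>R H w (p t)\<close> is the expected variation of the ray in
        the direction \<open>w\<close>; at \<open>t = 1\<close> the error is the remainder
        \<open>f v' - f v - F v (f v) (v' - v)\<close> to be estimated.\<close>
      define e where "e t = d t - t *\<^sub>R H w (p t)" for t
      have p: "p t \<in> K" and q: "q t \<in> K" if "t \<in> {0..1}" for t
        using inK[OF _ that Y(2)[OF _ that]] v v' by (auto simp: p_def q_def)
      have qp: "q t - p t = (t *\<^sub>R w, d t)" for t
        by (simp add: q_def p_def w_def d_def algebra_simps)
      have qp_norm: "norm (q t - p t) \<le> norm w + norm (d t)" if "t \<in> {0..1}" for t
        using norm_Pair_le[of "t *\<^sub>R w" "d t"] mult_left_le_one_le[of "norm w" t] that unfolding qp by auto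
      have v1: "M * norm v \<le> 1/2" by (rule r(2)[OF v])
      have Hv': "H v' x = H w x + H v x" if "x \<in> K" for x
        using linear_add[OF linH[OF that], of w v] by (simp add: w_def)
      have d': "(d has_vector_derivative H v' (q t) - H v (p t)) (at t within {0..1})" if "t \<in> {0..1}" for t
        unfolding d_def q_def p_def by (intro has_vector_derivative_diff Y(3) v v' that)
      have d_le: "norm (d t) \<le> n * norm w" if t: "t \<in> {0..1}" for t
      proof -
        have "norm (d t) \<le> 2 * ((M + 1) * norm w)"
        proof (rule gronwall_half[OF _ d' _ t])
          show "d 0 = 0" using Y(1) v v' by (simp add: d_def)
          fix t :: real assume t: "t \<in> {0..1}"
          have "norm (H v' (q t) - H v (p t)) \<le> norm (H w (q t)) + norm (H v (q t) - H v (p t))"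
            using norm_triangle_ineq[of "H w (q t)" "H v (q t) - H v (p t)"] Hv'[OF q[OF t]]
            by (simp add: algebra_simps)
          also have "\<dots> \<le> M * norm w + M * norm (q t - p t) * norm v"
            by (intro add_mono M1 M2 p q t)
          also have "M * norm (q t - p t) * norm v = (M * norm v) * norm (q t - p t)" by simp
          also have "(M * norm v) * norm (q t - p t) \<le> 1/2 * (norm w + norm (d t))"
            using v1 qp_norm[OF t] \<open>M > 0\<close> by (intro mult_mono) auto
          also have "M * norm w + 1/2 * (norm w + norm (d t)) \<le> (M + 1) * norm w + 1/2 * norm (d t)"
            by (simp add: algebra_simps)
          finally show "norm (H v' (q t) - H v (p t)) \<le> (M + 1) * norm w + 1/2 * norm (d t)" by simp
        qed auto
        then show ?thesis unfolding n_def by (simp only: mult.assoc)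
      qed
      have qp_le: "norm (q t - p t) \<le> (n + 1) * norm w" if "t \<in> {0..1}" for t
        using qp_norm[OF that] d_le[OF that] by (simp add: algebra_simps)
      let ?e' = "\<lambda>t. H v' (q t) - H v (p t) - (H w (p t) + t *\<^sub>R H' w (p t) (v, H v (p t)))"
      have e': "(e has_vector_derivative ?e' t) (at t within {0..1})" if t: "t \<in> {0..1}" for t
      proof -
        have "(p has_derivative (\<lambda>s. s *\<^sub>R (v, H v (p t)))) (at t within {0..1})"
        proof -
          have "(p has_derivative (\<lambda>s. (s *\<^sub>R v, s *\<^sub>R H v (p t)))) (at t within {0..1})"
            unfolding p_def using Y(3)[OF v t]
            by (intro has_derivative_Pair) (auto simp: has_vector_derivative_def intro!: derivative_eq_intros)
          then show ?thesis by simp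
        qed
        from has_derivative_compose[OF this H'[OF p[OF t]], of w]
        have "((\<lambda>t. H w (p t)) has_vector_derivative H' w (p t) (v, H v (p t))) (at t within {0..1})"
          unfolding has_vector_derivative_def
          using linear_scale[OF has_derivative_linear[OF H'[OF p[OF t], of w]]] by (simp del: scaleR_Pair)
        from has_vector_derivative_scaleR[OF _ this, of "\<lambda>t. t" 1]
        have "((\<lambda>t. t *\<^sub>R H w (p t)) has_vector_derivative (t *\<^sub>R H' w (p t) (v, H v (p t)) + 1 *\<^sub>R H w (p t))) (at t within {0..1})"
          by simp
        from has_vector_derivative_diff[OF d'[OF t] this]
        show ?thesis unfolding e_def by (simp add: add.commute)
      qed
      have "norm (e 1) \<le> 2 * ((M * (n + 1) + (n + 1)\<^sup>2) * (norm w)\<^sup>2)"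
      proof (rule gronwall_half[OF _ e'])
        show "e 0 = 0" using Y(1) v v' by (simp add: e_def d_def)
        fix t :: real assume t: "t \<in> {0..1}"
        \<comment> \<open>Integrability exchanges the ray direction \<open>v\<close> with the
          perturbation \<open>w\<close>. After scaling by \<open>t\<close>, the term is the
          derivative of \<open>H v\<close> along \<open>q t - p t\<close> up to a contribution of
          \<open>e t\<close>. Hence only a Lipschitz term, a Taylor remainder and a term linear in
          the error survive.\<close>
        have "H' w (p t) (v, H v (p t)) = H' v (p t) (w, H w (p t))"
          using integrable[of "fst (p t)" "snd (p t)" w v] p[OF t] KW
          unfolding H'_def H_def[abs_def] by (auto simp: p_def)
        moreover have "t *\<^sub>R H' v (p t) (w, H w (p t)) = H' v (p t) (t *\<^sub>R w, t *\<^sub>R H w (p t))"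
          using linear_scale[OF has_derivative_linear[OF H'[OF p[OF t], of v]], of t "(w, H w (p t))"] by simp
        moreover have "H' v (p t) (q t - p t) = H' v (p t) (t *\<^sub>R w, t *\<^sub>R H w (p t)) + H' v (p t) (0, e t)"
          using linear_add[OF has_derivative_linear[OF H'[OF p[OF t], of v]], of "(t *\<^sub>R w, t *\<^sub>R H w (p t))" "(0, e t)"]
          unfolding qp by (simp add: e_def)
        ultimately have "?e' t = (H w (q t) - H w (p t)) + (H v (q t) - H v (p t) - H' v (p t) (q t - p t))
            + H' v (p t) (0, e t)"
          using Hv'[OF q[OF t]] by simp
        then have "norm (?e' t) \<le> norm (H w (q t) - H w (p t)) + norm (H v (q t) - H v (p t) - H' v (p t) (q t - p t))
            + norm (H' v (p t) (0, e t))"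
          by (simp only:) (rule norm_triangle_le[OF add_right_mono[OF norm_triangle_ineq]])
        also have "\<dots> \<le> M * norm (q t - p t) * norm w + M * (norm (q t - p t))\<^sup>2 * norm v + M * norm (0::'k, e t) * norm v"
          by (intro add_mono M2 M3 M4 p q t)
        also have "\<dots> = M * norm (q t - p t) * norm w + (M * norm v) * (norm (q t - p t))\<^sup>2 + (M * norm v) * norm (e t)"
          by (simp add: norm_Pair)
        also have "\<dots> \<le> M * ((n + 1) * norm w) * norm w + 1 * ((n + 1) * norm w)\<^sup>2 + 1/2 * norm (e t)"
          using v1 qp_le[OF t] \<open>M > 0\<close> \<open>n > 0\<close> by (intro add_mono mult_mono power_mono) auto
        also have "\<dots> = (M * (n + 1) + (n + 1)\<^sup>2) * (norm w)\<^sup>2 + 1/2 * norm (e t)"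
          by (simp add: power2_eq_square algebra_simps)
        finally show "norm (?e' t) \<le> (M * (n + 1) + (n + 1)\<^sup>2) * (norm w)\<^sup>2 + 1/2 * norm (e t)" .
      qed auto
      then show ?thesis
        unfolding mult.assoc by (simp add: e_def d_def f_def p_def w_def H_def del: distrib_left_numeral)
    qed
    moreover have "linear (F v (f v))" using lin f_in[OF v] KW by blast
    ultimately show ?thesis
      using has_derivative_of_quadratic_bound[OF _ open_ball v] by blast
  qed
  with f0 f_in KW \<open>r > 0\<close> show ?thesis by (intro exI[of _ r] conjI exI[of _ f]) auto
qed

section \<open>Algebra of the Weyl curvature\<close>

lemma kdelta_simps [simp]:
  "kdelta i i = 1"
  "(\<Sum>a\<in>UNIV. kdelta (a::'n::finite) i * f a) = f i"
  "(\<Sum>a\<in>UNIV. kdelta i a * f a) = f i"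
  "(\<Sum>a\<in>UNIV. f a * kdelta a i) = f i"
  "(\<Sum>a\<in>UNIV. f a * kdelta i a) = f i"
  by (simp_all add: kdelta_def if_distrib[where f="\<lambda>x. x * _"] if_distrib[where f="\<lambda>x. _ * x"] cong: if_cong)

lemma kdelta_traces:
  fixes P \<beta> :: "'n::finite \<Rightarrow> 'n \<Rightarrow> real"
  defines "D \<equiv> \<lambda>a b i d. kdelta a i * P b d - kdelta b i * P a d + \<beta> a b * kdelta i d"
  shows "(\<Sum>a\<in>UNIV. D a b a d) = (real CARD('n) - 1) * P b d + \<beta> d b"
    and "(\<Sum>b\<in>UNIV. D a b b d) = - (real CARD('n) - 1) * P a d + \<beta> a d"
    and "(\<Sum>d\<in>UNIV. D a b d d) = P b a - P a b + real CARD('n) * \<beta> a b"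
  by (simp_all add: D_def sum.distrib sum_subtractf algebra_simps flip: sum_distrib_left sum_distrib_right)

text \<open>The first two traces make \<open>P\<close> skew and \<beta> a multiple of it. The third
  then reads (n (n - 1) - 2) P = 0, where n (n - 1) - 2 = (n - 2) (n + 1) is positive for n \<ge>
  3.\<close>

lemma trace_free_imp_zero:
  fixes P \<beta> :: "'n::finite \<Rightarrow> 'n \<Rightarrow> real"
  assumes "CARD('n) \<ge> 3"
    and "totally_trace_free (\<lambda>a b i d. kdelta a i * P b d - kdelta b i * P a d + \<beta> a b * kdelta i d)"
  shows "P a b = 0" "\<beta> a b = 0"
proof -
  let ?n = "real CARD('n)"
  have n: "?n \<ge> 3" using assms(1) by simp
  note t = assms(2)[unfolded totally_trace_free_def kdelta_traces]
  have 1: "(?n - 1) * P b d + \<beta> d b = 0" and 2: "\<beta> a d = (?n - 1) * P a d"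
    and 3: "P b a - P a b + ?n * \<beta> a b = 0" for a b d
    using t by (auto simp: algebra_simps)
  have "(?n - 1) * (P a b + P b a) = 0" using 1[of a b] 2[of b a] by (simp add: algebra_simps)
  then have "P b a = - P a b" using n by simp
  then have "(?n * (?n - 1) - 2) * P a b = 0" using 3[where a=a and b=b] unfolding 2 by (simp add: algebra_simps)
  moreover have "?n * (?n - 1) \<ge> 3 * 2" using n by (intro mult_mono) auto
  ultimately show "P a b = 0" by simp
  then show "\<beta> a b = 0" using 2 by simp
qed

text \<open>\<open>P\<close> and \<beta> solve the trace equations. The symmetric part of
  \<open>P\<close> comes from that of the Ricci trace. The skew part \<open>Q\<close> of
  \<open>P\<close> satisfies (n - 1) Q - \<beta> = K, with \<open>K\<close> the skew part of the
  Ricci trace, and - 2 Q + n \<beta> = T; the determinant of this system is \<open>c\<close>.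
  Skewness in the first two indices makes the second trace follow from the first.\<close>

lemma trace_free_decomposition_exists:
  fixes R :: "'n::finite \<Rightarrow> 'n \<Rightarrow> 'n \<Rightarrow> 'n \<Rightarrow> real"
  assumes "CARD('n) \<ge> 3" and anti: "\<And>a b i d. R a b i d = - R b a i d"
  shows "\<exists>W P \<beta>. totally_trace_free W \<and>
    (\<forall>a b i d. R a b i d = W a b i d + kdelta a i * P b d - kdelta b i * P a d + \<beta> a b * kdelta i d)"
proof -
  let ?n = "real CARD('n)"
  have n: "?n \<ge> 3" using assms(1) by simp
  have nn: "?n * (?n - 1) \<ge> 3 * 2" using n by (intro mult_mono) auto
  define c where "c = ?n * (?n - 1) - 2"
  have c: "c \<noteq> 0" using nn by (simp add: c_def)
  define Ric where "Ric b d = (\<Sum>a\<in>UNIV. R a b a d)" for b d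
  define T where "T a b = (\<Sum>d\<in>UNIV. R a b d d)" for a b
  define K where "K b d = (Ric b d - Ric d b) / 2" for b d
  define Q where "Q a b = (T a b + ?n * K a b) / c" for a b
  define \<beta> where "\<beta> a b = (?n - 1) * Q a b - K a b" for a b
  define P where "P a b = (Ric a b + Ric b a) / (2 * (?n - 1)) + Q a b" for a b
  have T: "T b a = - T a b" for a b
    unfolding T_def by (subst anti) (simp add: sum_negf)
  have K: "K b a = - K a b" for a b by (simp add: K_def field_simps)
  have Q: "Q b a = - Q a b" for a b by (simp add: Q_def T[of a b] K[of a b] divide_simps)
  have nP: "(?n - 1) * P a b = (Ric a b + Ric b a) / 2 + (?n - 1) * Q a b" for a b
    using n by (simp add: P_def field_simps)
  have Ric2: "(\<Sum>b\<in>UNIV. R a b b d) = - Ric a d" for a d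
    unfolding Ric_def by (subst anti) (simp add: sum_negf)
  define D where "D a b i d = kdelta a i * P b d - kdelta b i * P a d + \<beta> a b * kdelta i d" for a b i d
  note traces = kdelta_traces[where P=P and \<beta>=\<beta>, folded D_def]
  have t1: "(\<Sum>a\<in>UNIV. D a b a d) = Ric b d" for b d
    unfolding traces nP \<beta>_def Q[of b d] K[of b d] by (simp add: K_def) (simp add: field_simps)
  have t2: "(\<Sum>b\<in>UNIV. D a b b d) = - Ric a d" for a d
    unfolding traces using nP[of a d] by (simp add: \<beta>_def K_def field_simps)
  have t3: "(\<Sum>d\<in>UNIV. D a b d d) = T a b" for a b
  proof -
    have "P b a - P a b = - 2 * Q a b" by (simp add: P_def Q[of a b] add.commute)
    then have "P b a - P a b + ?n * \<beta> a b = c * Q a b - ?n * K a b"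
      by (simp add: \<beta>_def c_def algebra_simps)
    also have "c * Q a b = T a b + ?n * K a b" using c by (simp add: Q_def)
    finally show ?thesis unfolding traces by simp
  qed
  have "totally_trace_free (\<lambda>a b i d. R a b i d - D a b i d)"
    unfolding totally_trace_free_def sum_subtractf t1 t2 t3 Ric2 by (simp add: Ric_def T_def)
  moreover have "R a b i d = (R a b i d - D a b i d) + kdelta a i * P b d - kdelta b i * P a d + \<beta> a b * kdelta i d" for a b i d
    by (simp add: D_def)
  ultimately show ?thesis by blast
qed

text \<open>\<open>weyl_curvature\<close> is a definite description, so it has content only once
  existence and uniqueness of the decomposition are established. Zero is totally trace-free, and
  uniqueness makes it the Weyl part of any pure trace.\<close>

lemma weyl_curvature_zero_iff:
  fixes nabla :: "('p, real^'n) connection"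
  assumes "CARD('n) \<ge> 3"
    and anti: "\<And>a b i d. curvature_comp A nabla c p a b i d = - curvature_comp A nabla c p b a i d"
  shows "(\<forall>a b i d. weyl_curvature A nabla c p a b i d = 0) \<longleftrightarrow>
    (\<exists>P \<beta>. \<forall>a b i d. curvature_comp A nabla c p a b i d =
      kdelta a i * P b d - kdelta b i * P a d + \<beta> a b * kdelta i d)"
proof -
  let ?R = "curvature_comp A nabla c p"
  let ?dec = "\<lambda>W P \<beta>. \<forall>a b i d. ?R a b i d = W a b i d + kdelta a i * P b d - kdelta b i * P a d + \<beta> a b * kdelta i d"
  have uniq: "W = W'" if W: "totally_trace_free W" "?dec W P \<beta>" "totally_trace_free W'" "?dec W' P' \<beta>'" for W W' P P' \<beta> \<beta>'
  proof -
    let ?P = "\<lambda>a b. P' a b - P a b" and ?\<beta> = "\<lambda>a b. \<beta>' a b - \<beta> a b"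
    have eq: "W a b i d - W' a b i d = kdelta a i * ?P b d - kdelta b i * ?P a d + ?\<beta> a b * kdelta i d" for a b i d
      using W(2,4)[rule_format, of a b i d] by (simp add: algebra_simps)
    have "totally_trace_free (\<lambda>a b i d. W a b i d - W' a b i d)"
      using W(1,3) by (simp add: totally_trace_free_def sum_subtractf)
    then have "totally_trace_free (\<lambda>a b i d. kdelta a i * ?P b d - kdelta b i * ?P a d + ?\<beta> a b * kdelta i d)"
      unfolding eq .
    from trace_free_imp_zero[OF assms(1) this]
    have "W a b i d - W' a b i d = 0" for a b i d unfolding eq by simp
    then show ?thesis by (intro ext) simp
  qed
  obtain W P \<beta> where W: "totally_trace_free W" "?dec W P \<beta>"
    using trace_free_decomposition_exists[of ?R, OF assms(1) anti] by blast
  have eq: "weyl_curvature A nabla c p = W"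
    unfolding weyl_curvature_def by (rule the_equality) (use W uniq in blast)+
  show ?thesis
  proof
    assume "\<forall>a b i d. weyl_curvature A nabla c p a b i d = 0"
    then show "\<exists>P \<beta>. \<forall>a b i d. ?R a b i d = kdelta a i * P b d - kdelta b i * P a d + \<beta> a b * kdelta i d"
      using W(2) unfolding eq by (metis add_0)
  next
    assume "\<exists>P \<beta>. \<forall>a b i d. ?R a b i d = kdelta a i * P b d - kdelta b i * P a d + \<beta> a b * kdelta i d"
    then obtain P' \<beta>' where "?dec (\<lambda>_ _ _ _. 0) P' \<beta>'" by auto
    moreover have "totally_trace_free (\<lambda>_ _ _ _. 0)" by (simp add: totally_trace_free_def)
    ultimately have "W = (\<lambda>_ _ _ _. 0)" using uniq W by blast
    then show "\<forall>a b i d. weyl_curvature A nabla c p a b i d = 0" unfolding eq by simp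
  qed
qed

section \<open>Pure traces and the contact condition\<close>

lemma axis_sum: "(\<Sum>i\<in>UNIV. x $ i *\<^sub>R axis i 1) = (x :: real^'n)"
  using basis_expansion[of x] by (simp add: scalar_mult_eq_scaleR)

lemma linear_axis_expansion:
  assumes "linear f"
  shows "(\<Sum>i\<in>UNIV. x $ i *\<^sub>R f (axis i (1::real))) = f x"
  using linear_sum[OF assms, of "\<lambda>i. x $ i *\<^sub>R axis i 1" UNIV] linear_scale[OF assms]
  by (simp add: axis_sum)

text \<open>A pure trace \<open>T a b e\<close> is a combination of \<open>a\<close>,
  \<open>b\<close> and \<open>e\<close>, all annihilated by \<omega>. Conversely, tests with basis
  covectors and with sums and differences of two of them show that components with an upper index
  unlike all lower ones vanish and that contracted pairs have the same value at every admissible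
  index; these common values are \<beta> and - P.\<close>

lemma pure_trace_iff_contact_flat:
  fixes T :: "real^'n \<Rightarrow> real^'n \<Rightarrow> real^'n \<Rightarrow> real^'n"
  assumes card: "CARD('n) \<ge> 3"
    and lin: "\<And>b e. linear (\<lambda>a. T a b e)" "\<And>a e. linear (\<lambda>b. T a b e)" "\<And>a b. linear (\<lambda>e. T a b e)"
    and anti: "\<And>a b e. T a b e = - T b a e"
  shows "(\<exists>P \<beta>. \<forall>a b i d. T (axis a 1) (axis b 1) (axis d 1) $ i =
      kdelta a i * P b d - kdelta b i * P a d + \<beta> a b * kdelta i d) \<longleftrightarrow>
    (\<forall>\<omega> a b e. \<omega> \<bullet> a = 0 \<and> \<omega> \<bullet> b = 0 \<and> \<omega> \<bullet> e = 0 \<longrightarrow> \<omega> \<bullet> T a b e = 0)"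
    (is "?pure \<longleftrightarrow> ?flat")
proof
  assume ?pure
  then obtain P \<beta> where R: "\<And>a b i d. T (axis a 1) (axis b 1) (axis d 1) $ i =
      kdelta a i * P b d - kdelta b i * P a d + \<beta> a b * kdelta i d" by blast
  have T0: "T (axis j 1) (axis k 1) (axis l 1) =
      P k l *\<^sub>R axis j 1 - P j l *\<^sub>R axis k 1 + \<beta> j k *\<^sub>R axis l 1" for j k l
    by (simp add: vec_eq_iff R) (simp add: axis_def kdelta_def)
  define p where "p k e = (\<Sum>l\<in>UNIV. e $ l * P k l)" for k and e :: "real^'n"
  have T1: "T (axis j 1) (axis k 1) e = p k e *\<^sub>R axis j 1 - p j e *\<^sub>R axis k 1 + \<beta> j k *\<^sub>R e" for j k e
  proof -
    have "T (axis j 1) (axis k 1) e = (\<Sum>l\<in>UNIV. (e $ l * P k l) *\<^sub>R axis j 1 - (e $ l * P j l) *\<^sub>R axis k 1 + \<beta> j k *\<^sub>R (e $ l *\<^sub>R axis l 1))"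
      unfolding linear_axis_expansion[OF lin(3), symmetric, of _ _ e] T0 by (simp add: scaleR_add_right scaleR_diff_right mult.commute)
    also have "\<dots> = p k e *\<^sub>R axis j 1 - p j e *\<^sub>R axis k 1 + \<beta> j k *\<^sub>R (\<Sum>l\<in>UNIV. e $ l *\<^sub>R axis l 1)"
      by (simp only: p_def sum.distrib sum_subtractf scaleR_sum_left scaleR_sum_right)
    finally show ?thesis unfolding axis_sum .
  qed
  have T2: "\<omega> \<bullet> T (axis j 1) b e = (\<Sum>k\<in>UNIV. b $ k * p k e) * (\<omega> $ j)" if "\<omega> \<bullet> b = 0" "\<omega> \<bullet> e = 0" for \<omega> j b e
  proof -
    have "T (axis j 1) b e = (\<Sum>k\<in>UNIV. (b $ k * p k e) *\<^sub>R axis j 1 - p j e *\<^sub>R (b $ k *\<^sub>R axis k 1) + (b $ k * \<beta> j k) *\<^sub>R e)"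
      unfolding linear_axis_expansion[OF lin(2), symmetric, of _ b] T1 by (simp add: scaleR_add_right scaleR_diff_right mult.commute)
    also have "\<dots> = (\<Sum>k\<in>UNIV. b $ k * p k e) *\<^sub>R axis j 1 - p j e *\<^sub>R (\<Sum>k\<in>UNIV. b $ k *\<^sub>R axis k 1) + (\<Sum>k\<in>UNIV. b $ k * \<beta> j k) *\<^sub>R e"
      by (simp only: sum.distrib sum_subtractf scaleR_sum_left scaleR_sum_right)
    finally show ?thesis unfolding axis_sum using that
      by (simp add: inner_add_right inner_diff_right inner_axis)
  qed
  show ?flat
  proof (intro allI impI, elim conjE)
    fix \<omega> a b e :: "real^'n" assume 0: "\<omega> \<bullet> a = 0" "\<omega> \<bullet> b = 0" "\<omega> \<bullet> e = 0"
    have "\<omega> \<bullet> T a b e = (\<Sum>j\<in>UNIV. a $ j * (\<omega> \<bullet> T (axis j 1) b e))"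
      by (subst linear_axis_expansion[OF lin(1), symmetric]) (simp add: inner_sum_right)
    also have "\<dots> = (\<Sum>k\<in>UNIV. b $ k * p k e) * (\<Sum>j\<in>UNIV. \<omega> $ j * a $ j)"
      unfolding T2[OF 0(2,3)] by (subst sum_distrib_left) (simp add: mult_ac)
    also have "(\<Sum>j\<in>UNIV. \<omega> $ j * a $ j) = 0" using 0(1) by (simp add: inner_vec_def)
    finally show "\<omega> \<bullet> T a b e = 0" by simp
  qed
next
  assume flat: ?flat
  define R where "R a b i d = T (axis a 1) (axis b 1) (axis d 1) $ i" for a b i d
  have anti_R: "R a b i d = - R b a i d" for a b i d
    unfolding R_def by (subst anti) simp
  have R_inner: "axis i 1 \<bullet> T (axis a 1) (axis b 1) (axis d 1) = R a b i d" for a b i d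
    by (simp add: R_def inner_axis')
  note expand = linear_diff[OF lin(1)] linear_diff[OF lin(2)] linear_diff[OF lin(3)]
    linear_add[OF lin(1)] linear_add[OF lin(2)] linear_add[OF lin(3)]
    inner_add_left inner_diff_left inner_add_right inner_diff_right R_inner
  have F0: "R a b i d = 0" if "i \<noteq> a" "i \<noteq> b" "i \<noteq> d" for a b i d
    using flat[rule_format, of "axis i 1" "axis a 1" "axis b 1" "axis d 1"] that
    by (simp add: R_inner inner_axis_axis)
  have F1: "R a b i i = R a b j j" if "i \<noteq> j" "a \<noteq> i" "a \<noteq> j" "b \<noteq> i" "b \<noteq> j" for a b i j
    using flat[rule_format, of "axis i 1 + axis j 1" "axis a 1" "axis b 1" "axis i 1 - axis j 1"] that
      F0[of i a b j] F0[of j a b i]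
    by (simp add: expand inner_axis_axis)
  have F2: "R a i i d = R a j j d" if "i \<noteq> j" "a \<noteq> i" "a \<noteq> j" "d \<noteq> i" "d \<noteq> j" for a d i j
    using flat[rule_format, of "axis i 1 + axis j 1" "axis a 1" "axis i 1 - axis j 1" "axis d 1"] that
      F0[of i a j d] F0[of j a i d]
    by (simp add: expand inner_axis_axis)
  \<comment> \<open>The two tests differ by the sign of \<open>axis j 1\<close>; in their sum the
    components with an odd number of indices \<open>j\<close> cancel.\<close>
  have F3: "R a i i i = R a i j j + R a j j i" if "i \<noteq> j" "a \<noteq> i" "a \<noteq> j" for a i j
    using flat[rule_format, of "axis i 1 + axis j 1" "axis a 1" "axis i 1 - axis j 1" "axis i 1 - axis j 1"]
      flat[rule_format, of "axis i 1 - axis j 1" "axis a 1" "axis i 1 + axis j 1" "axis i 1 + axis j 1"] that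
      F0[of i a j j] F0[of j a i i]
    by (simp add: expand inner_axis_axis)
  have "\<exists>k. k \<noteq> i \<and> k \<noteq> j" for i j :: 'n
  proof (rule ccontr)
    assume "\<nexists>k. k \<noteq> i \<and> k \<noteq> j"
    then have "UNIV \<subseteq> {i, j}" by auto
    then have "CARD('n) \<le> card {i, j}" by (intro card_mono) auto
    also have "\<dots> \<le> 2" by (simp add: card_insert_if)
    finally show False using card by simp
  qed
  \<comment> \<open>A third index, available because n \<ge> 3, at which the components that define
    \<beta> and \<open>P\<close> are read off.\<close>
  then obtain s where s: "s i j \<noteq> i" "s i j \<noteq> j" for i j :: 'n by metis
  \<comment> \<open>The default 0 on the diagonal agrees with the components there, which vanish by
    antisymmetry.\<close>
  define \<beta> where "\<beta> a b = (if a = b then 0 else R a b (s a b) (s a b))" for a b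
  define P where "P a d = - R a (s a d) (s a d) d" for a d
  have \<beta>: "\<beta> a b = R a b j j" if "a \<noteq> b" "j \<noteq> a" "j \<noteq> b" for a b j
    using F1[of j "s a b" a b] s[of a b] that by (cases "j = s a b") (auto simp: \<beta>_def)
  have P: "P a d = - R a j j d" if "j \<noteq> a" "j \<noteq> d" for a d j
    using F2[of j "s a d" a d] s[of a d] that by (cases "j = s a d") (auto simp: P_def)
  have Rb: "R a b b d = - P a d + \<beta> a b * kdelta b d" if "a \<noteq> b" for a b d
  proof (cases "d = b")
    case True
    then show ?thesis
      using F3[of b "s a b" a] s[of a b] P[of "s a b" a b] \<beta>[of a b "s a b"] that by auto
  next
    case False
    then show ?thesis using P[of b a d] that by (auto simp: kdelta_def)
  qed
  have anti_\<beta>: "\<beta> b a = - \<beta> a b" for a b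
  proof (cases "a = b")
    case False
    then show ?thesis
      using \<beta>[of a b "s a b"] \<beta>[of b a "s a b"] s[of a b] anti_R[of a b] by auto
  qed (simp add: \<beta>_def)
  have "R a b i d = kdelta a i * P b d - kdelta b i * P a d + \<beta> a b * kdelta i d" for a b i d
  proof (cases "a = b")
    case True
    then show ?thesis using anti_R[of a a i d] by (simp add: \<beta>_def)
  next
    case ab: False
    consider "i = a" | "i = b" | "i \<noteq> a" "i \<noteq> b" by blast
    then show ?thesis
    proof cases
      case 1
      then show ?thesis using Rb[of b a d] anti_R[of a b a d] anti_\<beta>[of a b] ab by (simp add: kdelta_def)
    next
      case 2
      then show ?thesis using Rb[of a b d] ab by (simp add: kdelta_def)
    next
      case 3
      then show ?thesis using \<beta>[of a b i] F0[of i a b d] ab by (auto simp: kdelta_def)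
    qed
  qed
  then show ?pure unfolding R_def by blast
qed

section \<open>Charts, tangent vectors and covectors\<close>

text \<open>The linear map and its argument both vary with \<open>x\<close>, while smoothness of
  \<open>L\<close> is known for fixed vectors; the basis expansion separates the two.\<close>

lemma smooth_on_linear_apply:
  fixes L :: "'a::real_normed_vector \<Rightarrow> 'e::euclidean_space \<Rightarrow> 'z::real_normed_vector"
  assumes "open S" "\<And>x. x \<in> S \<Longrightarrow> linear (L x)" "\<And>b. smooth_on (\<lambda>x. L x b) S" "smooth_on \<xi> S"
  shows "smooth_on (\<lambda>x. L x (\<xi> x)) S"
proof -
  have "smooth_on (\<lambda>x. \<Sum>b\<in>Basis. (\<xi> x \<bullet> b) *\<^sub>R L x b) S"
    by (rule smooth_on_sum[OF assms(1)], rule smooth_on_scaleR[OF assms(1)],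
      rule smooth_on_inner_left[OF assms(1,4)], rule assms(3))
  moreover have "(\<Sum>b\<in>Basis. (\<xi> x \<bullet> b) *\<^sub>R L x b) = L x (\<xi> x)" if "x \<in> S" for x
    using linear_sum[OF assms(2)[OF that], of "\<lambda>b. (\<xi> x \<bullet> b) *\<^sub>R b" Basis]
    by (simp add: linear_scale[OF assms(2)[OF that]] euclidean_representation)
  ultimately show ?thesis by (rule smooth_on_cong[OF assms(1), THEN iffD1, rotated])
qed

text \<open>The conditions on charts and transition maps, separated from the topology so that the
  atlas of the projectivized cotangent bundle becomes another instance by inspection of its
  transition maps.\<close>

locale smooth_atlas =
  fixes A :: "('p, 'e::euclidean_space) chart set"
  assumes inj_chart: "c \<in> A \<Longrightarrow> inj_on (snd c) (fst c)"
    and open_chart: "c \<in> A \<Longrightarrow> open (snd c ` fst c)"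
    and open_overlap: "c \<in> A \<Longrightarrow> d \<in> A \<Longrightarrow> open (snd c ` (fst c \<inter> fst d))"
    and smooth_transition: "c \<in> A \<Longrightarrow> d \<in> A \<Longrightarrow>
      smooth_on (snd d \<circ> chart_inv c) (snd c ` (fst c \<inter> fst d))"

lemma smooth_manifold_imp_atlas: "smooth_manifold M A \<Longrightarrow> smooth_atlas A"
  by unfold_locales (simp_all add: smooth_manifold_def)

context smooth_atlas
begin

lemma chart_inv_left [simp]: "c \<in> A \<Longrightarrow> p \<in> fst c \<Longrightarrow> chart_inv c (snd c p) = p"
  by (simp add: chart_inv_def inj_chart)

lemma chart_inv_mem: "x \<in> snd c ` U \<Longrightarrow> U \<subseteq> fst c \<Longrightarrow> c \<in> A \<Longrightarrow> chart_inv c x \<in> U"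
  using chart_inv_left by fastforce

lemma chart_inv_right: "x \<in> snd c ` fst c \<Longrightarrow> snd c (chart_inv c x) = x"
  by (simp add: chart_inv_def f_inv_into_f)

lemma chart_image_Int:
  "c \<in> A \<Longrightarrow> U \<subseteq> fst c \<Longrightarrow> V \<subseteq> fst c \<Longrightarrow> snd c ` (U \<inter> V) = snd c ` U \<inter> snd c ` V"
  by (rule inj_on_image_Int[OF inj_chart])

text \<open>The definition through \<open>topology\<close> has content only if the family of sets is
  a topology; closure under intersection rests on the injectivity of the charts.\<close>

lemma openin_atlas_topology:
  "openin (atlas_topology M A) U \<longleftrightarrow> U \<subseteq> M \<and> (\<forall>c\<in>A. open (snd c ` (U \<inter> fst c)))"
proof -
  have "istopology (\<lambda>U. U \<subseteq> M \<and> (\<forall>c\<in>A. open (snd c ` (U \<inter> fst c))))"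
    unfolding istopology_def
  proof (intro conjI allI impI ballI)
    fix S T c assume ST: "S \<subseteq> M \<and> (\<forall>c\<in>A. open (snd c ` (S \<inter> fst c)))"
      "T \<subseteq> M \<and> (\<forall>c\<in>A. open (snd c ` (T \<inter> fst c)))"
    then show "S \<inter> T \<subseteq> M" by blast
    assume c: "c \<in> A"
    have "S \<inter> T \<inter> fst c = (S \<inter> fst c) \<inter> (T \<inter> fst c)" by blast
    then show "open (snd c ` (S \<inter> T \<inter> fst c))"
      using ST c chart_image_Int[of c "S \<inter> fst c" "T \<inter> fst c"] by (simp add: open_Int)
  next
    fix K c assume K: "\<forall>S\<in>K. S \<subseteq> M \<and> (\<forall>c\<in>A. open (snd c ` (S \<inter> fst c)))"
    then show "\<Union> K \<subseteq> M" by blast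
    assume "c \<in> A"
    moreover have "snd c ` (\<Union> K \<inter> fst c) = (\<Union>S\<in>K. snd c ` (S \<inter> fst c))" by blast
    ultimately show "open (snd c ` (\<Union> K \<inter> fst c))" using K by auto
  qed
  then show ?thesis unfolding atlas_topology_def by (simp add: topology_inverse')
qed

lemma open_chart_image:
  "openin (atlas_topology M A) U \<Longrightarrow> c \<in> A \<Longrightarrow> open (snd c ` (U \<inter> fst c))"
  by (simp add: openin_atlas_topology)

lemma openin_chart_preimage:
  assumes "c \<in> A" "fst c \<subseteq> M" "open V"
  shows "openin (atlas_topology M A) {p \<in> fst c. snd c p \<in> V}"
  unfolding openin_atlas_topology
proof (intro conjI ballI)
  fix d assume d: "d \<in> A"
  have "snd d ` ({p \<in> fst c. snd c p \<in> V} \<inter> fst d) =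
      snd d ` (fst d \<inter> fst c) \<inter> (snd c \<circ> chart_inv d) -` V"
    using d by (auto intro!: image_eqI)
  moreover have "open \<dots>"
    using continuous_open_preimage[OF smooth_on_continuous[OF smooth_transition[OF d assms(1)]]
        open_overlap[OF d assms(1)] assms(3)] .
  ultimately show "open (snd d ` ({p \<in> fst c. snd c p \<in> V} \<inter> fst d))" by simp
qed (use assms in auto)

lemma openin_chart_domain: "c \<in> A \<Longrightarrow> fst c \<subseteq> M \<Longrightarrow> openin (atlas_topology M A) (fst c)"
  using openin_chart_preimage[of c M UNIV] by simp

section \<open>Chart transitions and their derivatives\<close>

lemma transition_has_derivative:
  assumes "c \<in> A" "d \<in> A" "p \<in> fst c" "p \<in> fst d"
  shows "(snd d \<circ> chart_inv c has_derivative transition_deriv c d p) (at (snd c p))"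
  unfolding transition_deriv_def
  using assms by (intro smooth_on_has_derivative[OF smooth_transition]) auto

lemma linear_transition_deriv:
  "c \<in> A \<Longrightarrow> d \<in> A \<Longrightarrow> p \<in> fst c \<Longrightarrow> p \<in> fst d \<Longrightarrow> linear (transition_deriv c d p)"
  using transition_has_derivative has_derivative_linear by blast

text \<open>Chain rule through the overlap: outside it the composite with \<open>chart_inv\<close>
  carries no meaning, so the functions are compared on that open set alone.\<close>

lemma has_derivative_chart_change:
  assumes "c \<in> A" "d \<in> A" "p \<in> fst c" "p \<in> fst d"
    and "(g \<circ> chart_inv d has_derivative g') (at (snd d p))"
  shows "(g \<circ> chart_inv c has_derivative (\<lambda>v. g' (transition_deriv c d p v))) (at (snd c p))"
proof -
  have "(g \<circ> chart_inv d has_derivative g') (at ((snd d \<circ> chart_inv c) (snd c p)))"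
    using assms by simp
  from has_derivative_compose[OF transition_has_derivative[OF assms(1-4)] this]
  show ?thesis
    by (rule has_derivative_transform_within_open[OF _ open_overlap[OF assms(1,2)]])
      (use assms in auto)
qed

lemma transition_compose:
  assumes "c \<in> A" "d \<in> A" "e \<in> A" "p \<in> fst c" "p \<in> fst d" "p \<in> fst e"
  shows "transition_deriv d e p (transition_deriv c d p v) = transition_deriv c e p v"
  using frechet_derivative_eq[OF has_derivative_chart_change[OF assms(1,2,4,5)
      transition_has_derivative[OF assms(2,3,5,6)]]]
  by (simp add: transition_deriv_def fun_eq_iff)

lemma transition_self:
  assumes "c \<in> A" "p \<in> fst c"
  shows "transition_deriv c c p v = v"
proof -
  have "((\<lambda>x. x) has_derivative (\<lambda>v. v)) (at (snd c p))" by (rule has_derivative_ident)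
  then have "(snd c \<circ> chart_inv c has_derivative (\<lambda>v. v)) (at (snd c p))"
    by (rule has_derivative_transform_within_open[OF _ open_chart[OF assms(1)]])
      (use assms in auto)
  then show ?thesis unfolding transition_deriv_def by (simp add: frechet_derivative_eq)
qed

lemma transition_inverse:
  assumes "c \<in> A" "d \<in> A" "p \<in> fst c" "p \<in> fst d"
  shows "transition_deriv d c p (transition_deriv c d p v) = v"
  using assms by (simp add: transition_compose transition_self)

lemma smooth_on_transition_deriv:
  assumes "c \<in> A" "d \<in> A"
  shows "smooth_on (\<lambda>x. transition_deriv c d (chart_inv c x) e) (snd c ` (fst c \<inter> fst d))"
proof -
  have "smooth_on (\<lambda>x. frechet_derivative (snd d \<circ> chart_inv c) (at x) e) (snd c ` (fst c \<inter> fst d))"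
    by (rule smooth_on_frechet_derivative[OF smooth_transition[OF assms]])
  then show ?thesis
    by (rule smooth_on_cong[THEN iffD1, OF open_overlap[OF assms], rotated])
      (use assms in \<open>auto simp: transition_deriv_def\<close>)
qed

lemma smooth_on_chart_change:
  assumes "c \<in> A" "d \<in> A" "open (snd c ` U)" "open (snd d ` (U \<inter> fst d))" "U \<subseteq> fst c"
    and "smooth_on (g \<circ> chart_inv c) (snd c ` U)"
  shows "smooth_on (g \<circ> chart_inv d) (snd d ` (U \<inter> fst d))"
proof -
  have sub: "snd d ` (U \<inter> fst d) \<subseteq> snd d ` (fst d \<inter> fst c)" using assms by blast
  have "smooth_on (\<lambda>x. (g \<circ> chart_inv c) ((snd c \<circ> chart_inv d) x)) (snd d ` (U \<inter> fst d))"
    by (rule smooth_on_compose[OF assms(4,3,6) smooth_on_subset[OF smooth_transition[OF assms(2,1)] sub]])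
      (use assms in auto)
  then show ?thesis
    by (rule smooth_on_cong[THEN iffD1, OF assms(4), rotated]) (use assms in auto)
qed

lemma chart_at_mem: "c \<in> A \<Longrightarrow> p \<in> fst c \<Longrightarrow> chart_at A p \<in> A \<and> p \<in> fst (chart_at A p)"
  unfolding chart_at_def by (rule someI_ex) blast

section \<open>Tangent vectors and vector fields\<close>

lemma tangent_space_transition:
  "v \<in> tangent_space A p \<Longrightarrow> c \<in> A \<Longrightarrow> d \<in> A \<Longrightarrow> p \<in> fst c \<Longrightarrow> p \<in> fst d \<Longrightarrow>
    v d = transition_deriv c d p (v c)"
  unfolding tangent_space_def by blast

lemma tangent_space_zero: "v \<in> tangent_space A p \<Longrightarrow> \<not> (c \<in> A \<and> p \<in> fst c) \<Longrightarrow> v c = 0"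
  unfolding tangent_space_def by blast

lemma coord_tvec_mem: "c \<in> A \<Longrightarrow> p \<in> fst c \<Longrightarrow> coord_tvec A c p e \<in> tangent_space A p"
  by (auto simp: tangent_space_def coord_tvec_def transition_compose)

lemma coord_tvec_self [simp]: "c \<in> A \<Longrightarrow> p \<in> fst c \<Longrightarrow> coord_tvec A c p e c = e"
  by (simp add: coord_tvec_def transition_self)

lemma tangent_eq_coord_tvec:
  assumes "v \<in> tangent_space A p" "c \<in> A" "p \<in> fst c"
  shows "v = coord_tvec A c p (v c)"
proof
  fix d show "v d = coord_tvec A c p (v c) d"
    using tangent_space_transition[OF assms(1,2) _ assms(3), of d] tangent_space_zero[OF assms(1), of d]
    by (auto simp: coord_tvec_def)
qed

lemma coord_tvec_add:
  "c \<in> A \<Longrightarrow> p \<in> fst c \<Longrightarrow>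
    coord_tvec A c p (a + b) = (\<lambda>d. coord_tvec A c p a d + coord_tvec A c p b d)"
  by (auto simp: coord_tvec_def linear_add[OF linear_transition_deriv])

lemma coord_tvec_scale:
  "c \<in> A \<Longrightarrow> p \<in> fst c \<Longrightarrow> coord_tvec A c p (r *\<^sub>R a) = (\<lambda>d. r *\<^sub>R coord_tvec A c p a d)"
  by (auto simp: coord_tvec_def linear_scale[OF linear_transition_deriv])

text \<open>\<open>dir_deriv\<close> uses the arbitrary chart \<open>chart_at A p\<close>. The
  components of the vector change by the derivative of the transition map, the chain rule
  compensates for this in the function, and the choice drops out.\<close>

lemma dir_deriv_chart:
  assumes "c \<in> A" "p \<in> fst c" "X p \<in> tangent_space A p"
    and "(f \<circ> chart_inv c has_derivative f') (at (snd c p))"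
  shows "dir_deriv A X f p = f' (X p c)"
proof -
  let ?d = "chart_at A p"
  have d: "?d \<in> A" "p \<in> fst ?d" using chart_at_mem assms by auto
  show ?thesis
    unfolding dir_deriv_def Let_def
      frechet_derivative_eq[OF has_derivative_chart_change[OF d(1) assms(1) d(2) assms(2,4)]]
    using tangent_space_transition[OF assms(3) d(1) assms(1) d(2) assms(2)] by simp
qed

lemma tangent_map_chart:
  fixes B :: "('q, 'f::euclidean_space) chart set"
  assumes "c \<in> A" "p \<in> fst c" "v \<in> tangent_space A p" "d \<in> B" "f p \<in> fst d"
    and "(snd d \<circ> f \<circ> chart_inv c has_derivative f') (at (snd c p))"
  shows "tangent_map A B f p v d = f' (v c)"
proof -
  let ?d = "chart_at A p"
  have d: "?d \<in> A" "p \<in> fst ?d" using chart_at_mem assms by auto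
  have "tangent_map A B f p v d = frechet_derivative (snd d \<circ> f \<circ> chart_inv ?d) (at (snd ?d p)) (v ?d)"
    unfolding tangent_map_def Let_def using assms(4,5) by simp
  also have "\<dots> = f' (transition_deriv ?d c p (v ?d))"
    using frechet_derivative_eq[OF has_derivative_chart_change[OF d(1) assms(1) d(2) assms(2,6)]] by simp
  finally show ?thesis
    using tangent_space_transition[OF assms(3) d(1) assms(1) d(2) assms(2)] by simp
qed

text \<open>\<open>vector_fields\<close> tests every chart \<open>d\<close>, not only the given one.
  The components there are the transition derivative applied to \<xi>, both depending on the point,
  whence \<open>smooth_on_linear_apply\<close>.\<close>

lemma smooth_vector_field:
  assumes "c \<in> A" "openin (atlas_topology M A) U" "U \<subseteq> fst c" "smooth_on \<xi> (snd c ` U)"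
  shows "restrict_field U (\<lambda>p. coord_tvec A c p (\<xi> (snd c p))) \<in> vector_fields A U"
  unfolding vector_fields_def
proof (intro CollectI conjI ballI allI impI)
  show "restrict_field U (\<lambda>p. coord_tvec A c p (\<xi> (snd c p))) p \<in> tangent_space A p" if "p \<in> U" for p
    using that assms(1,3) by (auto simp: restrict_field_def intro!: coord_tvec_mem)
  show "restrict_field U (\<lambda>p. coord_tvec A c p (\<xi> (snd c p))) p = (\<lambda>_. 0)" if "p \<notin> U" for p
    using that by (simp add: restrict_field_def)
  fix d assume d: "d \<in> A"
  note open_d = open_chart_image[OF assms(2) d]
  have open_c: "open (snd c ` U)"
    using open_chart_image[OF assms(2,1)] assms(3) by (simp add: Int_absorb2)
  have sub: "snd d ` (U \<inter> fst d) \<subseteq> snd d ` (fst d \<inter> fst c)" using assms by blast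
  let ?\<tau> = "\<lambda>x. snd c (chart_inv d x)"
  have \<tau>: "smooth_on ?\<tau> (snd d ` (U \<inter> fst d))"
    using smooth_on_subset[OF smooth_transition[OF d assms(1)] sub] by (simp add: comp_def)
  have "smooth_on (\<lambda>x. transition_deriv c d (chart_inv d x) (\<xi> (?\<tau> x))) (snd d ` (U \<inter> fst d))"
  proof (rule smooth_on_linear_apply[where L="\<lambda>x. transition_deriv c d (chart_inv d x)" and \<xi>="\<lambda>x. \<xi> (?\<tau> x)", OF open_d])
    show "linear (transition_deriv c d (chart_inv d x))" if "x \<in> snd d ` (U \<inter> fst d)" for x
      using that assms d by (auto intro!: linear_transition_deriv)
    show "smooth_on (\<lambda>x. transition_deriv c d (chart_inv d x) e) (snd d ` (U \<inter> fst d))" for e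
    proof (rule smooth_on_cong[THEN iffD1, OF open_d, rotated])
      show "smooth_on (\<lambda>x. (\<lambda>x. transition_deriv c d (chart_inv c x) e) (?\<tau> x)) (snd d ` (U \<inter> fst d))"
        using assms d
        by (intro smooth_on_compose[OF open_d open_overlap[OF assms(1) d] smooth_on_transition_deriv[OF assms(1) d] \<tau>])
          auto
    qed (use assms d in auto)
    show "smooth_on (\<lambda>x. \<xi> (?\<tau> x)) (snd d ` (U \<inter> fst d))"
      using assms(3) d by (intro smooth_on_compose[OF open_d open_c assms(4) \<tau>]) auto
  qed
  then show "smooth_on (\<lambda>x. restrict_field U (\<lambda>p. coord_tvec A c p (\<xi> (snd c p))) (chart_inv d x) d) (snd d ` (U \<inter> fst d))"
    by (rule smooth_on_cong[THEN iffD1, OF open_d, rotated])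
      (use assms d in \<open>auto simp: restrict_field_def coord_tvec_def\<close>)
qed

lemma vector_fields_tangent: "X \<in> vector_fields A U \<Longrightarrow> p \<in> U \<Longrightarrow> X p \<in> tangent_space A p"
  by (simp add: vector_fields_def)

lemma vector_fields_zero: "X \<in> vector_fields A U \<Longrightarrow> p \<notin> U \<Longrightarrow> X p = (\<lambda>_. 0)"
  by (simp add: vector_fields_def)

lemma vector_fields_smooth:
  "X \<in> vector_fields A U \<Longrightarrow> c \<in> A \<Longrightarrow> smooth_on (\<lambda>x. X (chart_inv c x) c) (snd c ` (U \<inter> fst c))"
  by (simp add: vector_fields_def)

lemma restrict_vector_field:
  assumes "X \<in> vector_fields A U" "openin (atlas_topology M A) V" "V \<subseteq> U"
  shows "restrict_field V X \<in> vector_fields A V"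
  unfolding vector_fields_def
proof (intro CollectI conjI ballI allI impI)
  fix d assume d: "d \<in> A"
  have "smooth_on (\<lambda>x. X (chart_inv d x) d) (snd d ` (V \<inter> fst d))"
    by (rule smooth_on_subset[OF vector_fields_smooth[OF assms(1) d]]) (use assms(3) in blast)
  then show "smooth_on (\<lambda>x. restrict_field V X (chart_inv d x) d) (snd d ` (V \<inter> fst d))"
    by (rule smooth_on_cong[THEN iffD1, OF open_chart_image[OF assms(2) d], rotated])
      (use d in \<open>auto simp: restrict_field_def\<close>)
qed (use assms in \<open>auto simp: restrict_field_def vector_fields_def\<close>)

section \<open>Covectors and one-forms\<close>

lemma coord_covec_coord_tvec [simp]:
  "c \<in> A \<Longrightarrow> p \<in> fst c \<Longrightarrow> coord_covec A c p \<omega> (coord_tvec A c p e) = \<omega> \<bullet> e"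
  by (simp add: coord_covec_def coord_tvec_mem)

lemma tangent_space_add:
  assumes "v \<in> tangent_space A p" "w \<in> tangent_space A p"
  shows "(\<lambda>c. v c + w c) \<in> tangent_space A p"
  unfolding tangent_space_def
proof (intro CollectI conjI ballI allI impI; (elim conjE)?)
  fix c d assume "c \<in> A" "d \<in> A" "p \<in> fst c" "p \<in> fst d"
  then show "v d + w d = transition_deriv c d p (v c + w c)"
    using assms[THEN tangent_space_transition, of c d] by (simp add: linear_add[OF linear_transition_deriv])
qed (use assms[THEN tangent_space_zero] in auto)

lemma tangent_space_scale:
  assumes "v \<in> tangent_space A p"
  shows "(\<lambda>c. r *\<^sub>R v c) \<in> tangent_space A p"
  unfolding tangent_space_def
proof (intro CollectI conjI ballI allI impI; (elim conjE)?)
  fix c d assume "c \<in> A" "d \<in> A" "p \<in> fst c" "p \<in> fst d"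
  then show "r *\<^sub>R v d = transition_deriv c d p (r *\<^sub>R v c)"
    using assms[THEN tangent_space_transition, of c d] by (simp add: linear_scale[OF linear_transition_deriv])
qed (use assms[THEN tangent_space_zero] in auto)

lemma coord_covec_mem: "coord_covec A c p \<omega> \<in> cotangent_space A p"
  by (auto simp: cotangent_space_def coord_covec_def tangent_space_add tangent_space_scale inner_add_right)

text \<open>Evaluation on coordinate vectors recovers the components by linearity; off the tangent
  space both sides are zero by convention.\<close>

lemma cotangent_eq_coord_covec:
  assumes "\<alpha> \<in> cotangent_space A p" "c \<in> A" "p \<in> fst c"
  shows "\<alpha> = coord_covec A c p (\<Sum>b\<in>Basis. \<alpha> (coord_tvec A c p b) *\<^sub>R b)"
proof
  fix v
  show "\<alpha> v = coord_covec A c p (\<Sum>b\<in>Basis. \<alpha> (coord_tvec A c p b) *\<^sub>R b) v"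
  proof (cases "v \<in> tangent_space A p")
    case True
    have lin: "linear (\<lambda>e. \<alpha> (coord_tvec A c p e))"
    proof (rule linearI)
      show "\<alpha> (coord_tvec A c p (a + b)) = \<alpha> (coord_tvec A c p a) + \<alpha> (coord_tvec A c p b)" for a b
        using assms(1) coord_tvec_mem[OF assms(2,3)] unfolding coord_tvec_add[OF assms(2,3)] cotangent_space_def
        by blast
      show "\<alpha> (coord_tvec A c p (r *\<^sub>R a)) = r *\<^sub>R \<alpha> (coord_tvec A c p a)" for r a
        using assms(1) coord_tvec_mem[OF assms(2,3)] unfolding coord_tvec_scale[OF assms(2,3)] cotangent_space_def
        by simp
    qed
    have "\<alpha> v = \<alpha> (coord_tvec A c p (v c))"
      using tangent_eq_coord_tvec[OF True assms(2,3)] by simp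
    also have "\<dots> = \<alpha> (coord_tvec A c p (\<Sum>b\<in>Basis. (v c \<bullet> b) *\<^sub>R b))"
      by (simp add: euclidean_representation)
    also have "\<dots> = (\<Sum>b\<in>Basis. (v c \<bullet> b) * \<alpha> (coord_tvec A c p b))"
      using linear_sum[OF lin, of "\<lambda>b. (v c \<bullet> b) *\<^sub>R b" Basis] linear_scale[OF lin] by simp
    also have "\<dots> = (\<Sum>b\<in>Basis. \<alpha> (coord_tvec A c p b) *\<^sub>R b) \<bullet> v c"
      unfolding inner_sum_left inner_scaleR_left by (simp add: inner_commute mult.commute)
    finally show ?thesis using True by (simp add: coord_covec_def)
  next
    case False
    then show ?thesis using assms(1) by (simp add: cotangent_space_def coord_covec_def)
  qed
qed

lemma coord_covec_inject:
  assumes "c \<in> A" "p \<in> fst c"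
  shows "coord_covec A c p \<omega> = coord_covec A c p \<omega>' \<longleftrightarrow> \<omega> = \<omega>'"
proof
  assume eq: "coord_covec A c p \<omega> = coord_covec A c p \<omega>'"
  have "\<omega> \<bullet> e = \<omega>' \<bullet> e" for e
    using coord_covec_coord_tvec[OF assms, of \<omega> e] coord_covec_coord_tvec[OF assms, of \<omega>' e]
    unfolding eq by simp
  then show "\<omega> = \<omega>'" using euclidean_eqI[of \<omega> \<omega>'] by blast
qed simp

text \<open>Covectors transform by the transpose of the derivative in the opposite direction,
  written out in an orthonormal basis.\<close>

lemma coord_covec_change:
  assumes "c \<in> A" "p \<in> fst c" "d \<in> A" "p \<in> fst d"
  shows "coord_covec A c p \<omega> = coord_covec A d p (\<Sum>b\<in>Basis. (\<omega> \<bullet> transition_deriv d c p b) *\<^sub>R b)"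
proof -
  have "coord_covec A c p \<omega> (coord_tvec A d p b) = \<omega> \<bullet> transition_deriv d c p b" for b
    using assms by (simp add: coord_covec_def coord_tvec_mem) (simp add: coord_tvec_def)
  then show ?thesis
    using cotangent_eq_coord_covec[OF coord_covec_mem assms(3,4), of c \<omega>] by simp
qed

lemma coord_covec_scale: "(\<lambda>v. t * coord_covec A c p \<omega> v) = coord_covec A c p (t *\<^sub>R \<omega>)"
  by (auto simp: coord_covec_def)

text \<open>Each generator lies on the line of the other, and \<open>\<omega> \<noteq> 0\<close>
  keeps the factor away from zero. The components of a covector thus serve as homogeneous
  coordinates of its line.\<close>

lemma covec_line_eq_iff:
  assumes "c \<in> A" "p \<in> fst c" "\<omega> \<noteq> 0"
  shows "covec_line (coord_covec A c p \<omega>) = covec_line (coord_covec A c p \<omega>') \<longleftrightarrow> (\<exists>t. t \<noteq> 0 \<and> \<omega>' = t *\<^sub>R \<omega>)"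
proof -
  have line: "covec_line (coord_covec A c p \<omega>) = {coord_covec A c p (t *\<^sub>R \<omega>) | t. True}" for \<omega>
    unfolding covec_line_def coord_covec_scale ..
  show ?thesis
  proof
    assume eq: "covec_line (coord_covec A c p \<omega>) = covec_line (coord_covec A c p \<omega>')"
    have mem: "coord_covec A c p (1 *\<^sub>R \<omega>) \<in> covec_line (coord_covec A c p \<omega>)" for \<omega> unfolding line by blast
    obtain t where t: "\<omega>' = t *\<^sub>R \<omega>"
      using mem[of \<omega>', folded eq, unfolded line] coord_covec_inject[OF assms(1,2)] by auto
    obtain s where "\<omega> = s *\<^sub>R \<omega>'"
      using mem[of \<omega>, unfolded eq, unfolded line] coord_covec_inject[OF assms(1,2)] by auto
    then have "t \<noteq> 0" using t assms(3) by auto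
    with t show "\<exists>t. t \<noteq> 0 \<and> \<omega>' = t *\<^sub>R \<omega>" by blast
  next
    assume "\<exists>t. t \<noteq> 0 \<and> \<omega>' = t *\<^sub>R \<omega>"
    then obtain t where t: "t \<noteq> 0" "\<omega>' = t *\<^sub>R \<omega>" by blast
    have "\<exists>s'. s *\<^sub>R \<omega> = s' *\<^sub>R \<omega>'" for s
      using t by (intro exI[of _ "s / t"]) simp
    moreover have "\<exists>s'. s *\<^sub>R \<omega>' = s' *\<^sub>R \<omega>" for s
      using t by (intro exI[of _ "s * t"]) simp
    ultimately show "covec_line (coord_covec A c p \<omega>) = covec_line (coord_covec A c p \<omega>')"
      unfolding line by (safe; metis)
  qed
qed

lemma smooth_one_form:
  assumes "c \<in> A" "openin (atlas_topology M A) U" "U \<subseteq> fst c" "smooth_on \<omega> (snd c ` U)"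
  shows "restrict_field U (\<lambda>p. coord_covec A c p (\<omega> (snd c p))) \<in> one_forms A U"
  unfolding one_forms_def
proof (intro CollectI conjI ballI allI impI)
  show "restrict_field U (\<lambda>p. coord_covec A c p (\<omega> (snd c p))) p \<in> cotangent_space A p" if "p \<in> U" for p
    using that by (simp add: restrict_field_def coord_covec_mem)
  show "restrict_field U (\<lambda>p. coord_covec A c p (\<omega> (snd c p))) p = (\<lambda>_. 0)" if "p \<notin> U" for p
    using that by (simp add: restrict_field_def)
  fix d e assume d: "d \<in> A"
  note open_d = open_chart_image[OF assms(2) d]
  have open_c: "open (snd c ` U)"
    using open_chart_image[OF assms(2,1)] assms(3) by (simp add: Int_absorb2)
  have sub: "snd d ` (U \<inter> fst d) \<subseteq> snd d ` (fst d \<inter> fst c)" using assms by blast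
  let ?\<tau> = "\<lambda>x. snd c (chart_inv d x)"
  have \<tau>: "smooth_on ?\<tau> (snd d ` (U \<inter> fst d))"
    using smooth_on_subset[OF smooth_transition[OF d assms(1)] sub] by (simp add: comp_def)
  have "smooth_on (\<lambda>x. \<omega> (?\<tau> x) \<bullet> transition_deriv d c (chart_inv d x) e) (snd d ` (U \<inter> fst d))"
  proof (rule smooth_on_inner[OF open_d])
    show "smooth_on (\<lambda>x. \<omega> (?\<tau> x)) (snd d ` (U \<inter> fst d))"
      using assms(3) d by (intro smooth_on_compose[OF open_d open_c assms(4) \<tau>]) auto
    show "smooth_on (\<lambda>x. transition_deriv d c (chart_inv d x) e) (snd d ` (U \<inter> fst d))"
      by (rule smooth_on_subset[OF smooth_on_transition_deriv[OF d assms(1)] sub])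
  qed
  then show "smooth_on (\<lambda>x. restrict_field U (\<lambda>p. coord_covec A c p (\<omega> (snd c p))) (chart_inv d x)
      (coord_tvec A d (chart_inv d x) e)) (snd d ` (U \<inter> fst d))"
    by (rule smooth_on_cong[THEN iffD1, OF open_d, rotated])
      (use assms d in \<open>auto simp: restrict_field_def coord_covec_def coord_tvec_mem\<close>,
       use assms d in \<open>auto simp: coord_tvec_def\<close>)
qed

lemma one_form_components:
  assumes "\<alpha> \<in> one_forms A U" "openin (atlas_topology M A) U" "c \<in> A"
  shows "\<exists>\<omega>. smooth_on \<omega> (snd c ` (U \<inter> fst c)) \<and> (\<forall>p\<in>U \<inter> fst c. \<alpha> p = coord_covec A c p (\<omega> (snd c p)))"
proof (intro exI conjI ballI)
  let ?\<omega> = "\<lambda>x. \<Sum>b\<in>Basis. \<alpha> (chart_inv c x) (coord_tvec A c (chart_inv c x) b) *\<^sub>R b"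
  note open_c = open_chart_image[OF assms(2,3)]
  show "smooth_on ?\<omega> (snd c ` (U \<inter> fst c))"
    using assms(1,3) open_c unfolding one_forms_def
    by (intro smooth_on_sum smooth_on_scaleR smooth_on_const) auto
  show "\<alpha> p = coord_covec A c p (?\<omega> (snd c p))" if "p \<in> U \<inter> fst c" for p
    using cotangent_eq_coord_covec[of "\<alpha> p" p c] assms that by (simp add: one_forms_def)
qed

end

section \<open>Connections in coordinates\<close>

context smooth_atlas
begin

lemma vector_field_zero: "openin (atlas_topology M A) U \<Longrightarrow> (\<lambda>p d. 0) \<in> vector_fields A U"
  by (auto simp: vector_fields_def tangent_space_def linear_0[OF linear_transition_deriv]
      intro!: smooth_on_const open_chart_image)

lemma vector_field_add:
  assumes "X \<in> vector_fields A U" "Y \<in> vector_fields A U" "openin (atlas_topology M A) U"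
  shows "field_add X Y \<in> vector_fields A U"
  unfolding vector_fields_def field_add_def
proof (intro CollectI conjI ballI allI impI)
  fix c assume c: "c \<in> A"
  show "smooth_on (\<lambda>x. X (chart_inv c x) c + Y (chart_inv c x) c) (snd c ` (U \<inter> fst c))"
    by (rule smooth_on_add[OF open_chart_image[OF assms(3) c] vector_fields_smooth[OF assms(1) c]
          vector_fields_smooth[OF assms(2) c]])
qed (use vector_fields_tangent[OF assms(1)] vector_fields_tangent[OF assms(2)] vector_fields_zero[OF assms(1)]
    vector_fields_zero[OF assms(2)] in \<open>auto intro!: tangent_space_add\<close>)

lemma vector_field_scale:
  assumes "X \<in> vector_fields A U" "smooth_fun_on A U f" "openin (atlas_topology M A) U"
  shows "field_scale f X \<in> vector_fields A U"
  unfolding vector_fields_def field_scale_def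
proof (intro CollectI conjI ballI allI impI)
  fix c assume c: "c \<in> A"
  show "smooth_on (\<lambda>x. f (chart_inv c x) *\<^sub>R X (chart_inv c x) c) (snd c ` (U \<inter> fst c))"
    by (rule smooth_on_scaleR[OF open_chart_image[OF assms(3) c] _ vector_fields_smooth[OF assms(1) c]])
      (use assms(2) c in \<open>simp add: smooth_fun_on_def comp_def\<close>)
qed (use vector_fields_tangent[OF assms(1)] vector_fields_zero[OF assms(1)] in \<open>auto intro!: tangent_space_scale\<close>)

lemma vector_field_sum:
  assumes "finite I" "\<And>i. i \<in> I \<Longrightarrow> X i \<in> vector_fields A U" "openin (atlas_topology M A) U"
  shows "(\<lambda>p d. \<Sum>i\<in>I. X i p d) \<in> vector_fields A U"
  using assms(1,2)
proof (induction I)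
  case empty
  then show ?case using vector_field_zero[OF assms(3)] by simp
next
  case (insert i I)
  have "field_add (X i) (\<lambda>p d. \<Sum>i\<in>I. X i p d) \<in> vector_fields A U"
    using insert by (intro vector_field_add[OF _ _ assms(3)]) auto
  then show ?case using insert(1,2) by (simp add: field_add_def)
qed

end

text \<open>Extended from coordinate fields to a bilinear map, since the lifts below evaluate it at
  vectors that vary with the point.\<close>

definition christoffel ::
  "('p, real^'n::finite) chart set \<Rightarrow> ('p, real^'n) connection \<Rightarrow> ('p, real^'n) chart \<Rightarrow>
   real^'n \<Rightarrow> real^'n \<Rightarrow> real^'n \<Rightarrow> real^'n" where
  "christoffel A nabla c x a e = (\<Sum>i\<in>UNIV. \<Sum>j\<in>UNIV.
     (a $ i * e $ j) *\<^sub>R nabla (fst c) (coord_field A c i) (coord_field A c j) (chart_inv c x) c)"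

definition riemann ::
  "('p, real^'n::finite) chart set \<Rightarrow> ('p, real^'n) connection \<Rightarrow> ('p, real^'n) chart \<Rightarrow>
   real^'n \<Rightarrow> real^'n \<Rightarrow> real^'n \<Rightarrow> real^'n \<Rightarrow> real^'n" where
  "riemann A nabla c x a b e =
     frechet_derivative (\<lambda>x. christoffel A nabla c x b e) (at x) a
     - frechet_derivative (\<lambda>x. christoffel A nabla c x a e) (at x) b
     + christoffel A nabla c x a (christoffel A nabla c x b e)
     - christoffel A nabla c x b (christoffel A nabla c x a e)"

lemma linear_christoffel:
  "linear (christoffel A nabla c x a)" "linear (\<lambda>a. christoffel A nabla c x a e)"
  by (simp_all add: linear_iff christoffel_def algebra_simps scaleR_add_left sum.distrib scaleR_sum_right)

lemmas christoffel_linear_simps =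
  linear_add[OF linear_christoffel(1)] linear_add[OF linear_christoffel(2)]
  linear_diff[OF linear_christoffel(1)] linear_diff[OF linear_christoffel(2)]
  linear_scale[OF linear_christoffel(1)] linear_scale[OF linear_christoffel(2)]

lemma christoffel_axis:
  "christoffel A nabla c x (axis i 1) (axis j 1) =
    nabla (fst c) (coord_field A c i) (coord_field A c j) (chart_inv c x) c"
  by (simp add: christoffel_def axis_def if_distrib[where f="\<lambda>x. x * _"] if_distrib[where f="\<lambda>x. _ * x"]
      if_distrib[where f="\<lambda>x. x *\<^sub>R _"] cong: if_cong)

lemma riemann_antisym: "riemann A nabla c x a b e = - riemann A nabla c x b a e"
  by (simp add: riemann_def)

text \<open>The name refers to the linear connection \<open>nabla\<close>, not to connectedness of
  \<open>N\<close>.\<close>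

locale connected_atlas = smooth_atlas A for A :: "('p, real^'n::finite) chart set" +
  fixes N :: "'p set" and nabla :: "('p, real^'n) connection"
  assumes domain: "c \<in> A \<Longrightarrow> fst c \<subseteq> N"
    and connection: "linear_connection N A nabla"
    and torsion: "torsion_free N A nabla"
begin

abbreviation opn :: "'p set \<Rightarrow> bool" where "opn U \<equiv> openin (atlas_topology N A) U"

lemma opn_chart: "c \<in> A \<Longrightarrow> opn (fst c)"
  using openin_chart_domain domain by blast

section \<open>Rules for the covariant derivative\<close>

lemma nabla_field:
  "opn U \<Longrightarrow> X \<in> vector_fields A U \<Longrightarrow> Y \<in> vector_fields A U \<Longrightarrow> nabla U X Y \<in> vector_fields A U"
  using connection unfolding linear_connection_def by blast

lemma nabla_add_left:
  "opn U \<Longrightarrow> X \<in> vector_fields A U \<Longrightarrow> Y \<in> vector_fields A U \<Longrightarrow> Z \<in> vector_fields A U \<Longrightarrow>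
    nabla U (field_add X Z) Y = field_add (nabla U X Y) (nabla U Z Y)"
  using connection unfolding linear_connection_def by blast

lemma nabla_add_right:
  "opn U \<Longrightarrow> X \<in> vector_fields A U \<Longrightarrow> Y \<in> vector_fields A U \<Longrightarrow> Z \<in> vector_fields A U \<Longrightarrow>
    nabla U X (field_add Y Z) = field_add (nabla U X Y) (nabla U X Z)"
  using connection unfolding linear_connection_def by blast

lemma nabla_scale_left:
  "opn U \<Longrightarrow> X \<in> vector_fields A U \<Longrightarrow> Y \<in> vector_fields A U \<Longrightarrow> smooth_fun_on A U f \<Longrightarrow>
    nabla U (field_scale f X) Y = field_scale f (nabla U X Y)"
  using connection unfolding linear_connection_def by blast

lemma nabla_scale_right:
  "opn U \<Longrightarrow> X \<in> vector_fields A U \<Longrightarrow> Y \<in> vector_fields A U \<Longrightarrow> smooth_fun_on A U f \<Longrightarrow>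
    nabla U X (field_scale f Y) = field_add (field_scale (dir_deriv A X f) Y) (field_scale f (nabla U X Y))"
  using connection unfolding linear_connection_def by blast

lemma nabla_restrict:
  "opn U \<Longrightarrow> X \<in> vector_fields A U \<Longrightarrow> Y \<in> vector_fields A U \<Longrightarrow> opn V \<Longrightarrow> V \<subseteq> U \<Longrightarrow>
    nabla V (restrict_field V X) (restrict_field V Y) = restrict_field V (nabla U X Y)"
  using connection unfolding linear_connection_def by blast

lemma smooth_fun_on_const: "opn U \<Longrightarrow> smooth_fun_on A U (\<lambda>_. r)"
  unfolding smooth_fun_on_def comp_def by (blast intro: smooth_on_const open_chart_image)

lemma nabla_zero_left:
  assumes "opn U" "Y \<in> vector_fields A U"
  shows "nabla U (\<lambda>p d. 0) Y = (\<lambda>p d. 0)"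
  using nabla_scale_left[OF assms(1) vector_field_zero[OF assms(1)] assms(2) smooth_fun_on_const[OF assms(1), of 0]]
  by (simp add: field_scale_def)

lemma nabla_zero_right:
  assumes "opn U" "X \<in> vector_fields A U"
  shows "nabla U X (\<lambda>p d. 0) = (\<lambda>p d. 0)"
proof -
  have "field_add (nabla U X (\<lambda>p d. 0)) (nabla U X (\<lambda>p d. 0)) = nabla U X (\<lambda>p d. 0)"
    using nabla_add_right[OF assms vector_field_zero[OF assms(1)] vector_field_zero[OF assms(1)]]
    by (simp add: field_add_def)
  then show ?thesis by (simp add: field_add_def fun_eq_iff)
qed

lemma nabla_sum_left:
  assumes "opn U" "finite I" "\<And>i. i \<in> I \<Longrightarrow> X i \<in> vector_fields A U" "Y \<in> vector_fields A U"
  shows "nabla U (\<lambda>p d. \<Sum>i\<in>I. X i p d) Y = (\<lambda>p d. \<Sum>i\<in>I. nabla U (X i) Y p d)"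
  using assms(2,3)
proof (induction I)
  case empty
  then show ?case using nabla_zero_left[OF assms(1,4)] by simp
next
  case (insert i I)
  have eq: "(\<lambda>p d. \<Sum>i\<in>insert i I. X i p d) = field_add (X i) (\<lambda>p d. \<Sum>i\<in>I. X i p d)"
    using insert(1,2) by (simp add: field_add_def)
  have "nabla U (field_add (X i) (\<lambda>p d. \<Sum>i\<in>I. X i p d)) Y =
      field_add (nabla U (X i) Y) (nabla U (\<lambda>p d. \<Sum>i\<in>I. X i p d) Y)"
    by (rule nabla_add_left[OF assms(1) _ assms(4) vector_field_sum[OF _ _ assms(1)]]) (use insert in auto)
  then show ?case unfolding eq using insert by (simp add: field_add_def)
qed

lemma nabla_sum_right:
  assumes "opn U" "finite I" "\<And>i. i \<in> I \<Longrightarrow> Y i \<in> vector_fields A U" "X \<in> vector_fields A U"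
  shows "nabla U X (\<lambda>p d. \<Sum>i\<in>I. Y i p d) = (\<lambda>p d. \<Sum>i\<in>I. nabla U X (Y i) p d)"
  using assms(2,3)
proof (induction I)
  case empty
  then show ?case using nabla_zero_right[OF assms(1,4)] by simp
next
  case (insert i I)
  have eq: "(\<lambda>p d. \<Sum>i\<in>insert i I. Y i p d) = field_add (Y i) (\<lambda>p d. \<Sum>i\<in>I. Y i p d)"
    using insert(1,2) by (simp add: field_add_def)
  have "nabla U X (field_add (Y i) (\<lambda>p d. \<Sum>i\<in>I. Y i p d)) =
      field_add (nabla U X (Y i)) (nabla U X (\<lambda>p d. \<Sum>i\<in>I. Y i p d))"
    by (rule nabla_add_right[OF assms(1,4) _ vector_field_sum[OF _ _ assms(1)]]) (use insert in auto)
  then show ?case unfolding eq using insert by (simp add: field_add_def)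
qed

lemma coord_field_mem: "c \<in> A \<Longrightarrow> coord_field A c i \<in> vector_fields A (fst c)"
  unfolding coord_field_def
  by (rule smooth_vector_field[where \<xi>="\<lambda>_. axis i 1", OF _ opn_chart subset_refl smooth_on_const[OF open_chart]])

lemma restrict_coord_field:
  assumes "c \<in> A" "opn V" "V \<subseteq> fst c"
  shows "restrict_field V (coord_field A c i) \<in> vector_fields A V"
  by (rule restrict_vector_field[OF coord_field_mem[OF assms(1)] assms(2,3)])

lemma coord_field_self: "c \<in> A \<Longrightarrow> p \<in> fst c \<Longrightarrow> coord_field A c i p c = axis i 1"
  by (simp add: coord_field_def restrict_field_def)

lemma vector_field_expansion:
  assumes "c \<in> A" "V \<subseteq> fst c" "X \<in> vector_fields A V"
  shows "X = (\<lambda>p d. \<Sum>i\<in>UNIV. field_scale (\<lambda>p. X p c $ i) (restrict_field V (coord_field A c i)) p d)"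
proof (intro ext)
  fix p d
  show "X p d = (\<Sum>i\<in>UNIV. field_scale (\<lambda>p. X p c $ i) (restrict_field V (coord_field A c i)) p d)"
  proof (cases "p \<in> V")
    case True
    then have p: "p \<in> fst c" using assms(2) by blast
    have "X p d = coord_tvec A c p (X p c) d"
      using tangent_eq_coord_tvec[OF vector_fields_tangent[OF assms(3) True] assms(1) p] by simp
    also have "\<dots> = (\<Sum>i\<in>UNIV. X p c $ i *\<^sub>R coord_tvec A c p (axis i 1) d)"
    proof (rule linear_axis_expansion[symmetric])
      show "linear (\<lambda>e. coord_tvec A c p e d)"
        using coord_tvec_add[OF assms(1) p] coord_tvec_scale[OF assms(1) p] by (simp add: linear_iff)
    qed
    finally show ?thesis using True p by (simp add: field_scale_def restrict_field_def coord_field_def)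
  next
    case False
    then show ?thesis
      using vector_fields_zero[OF assms(3)] by (simp add: field_scale_def restrict_field_def)
  qed
qed

lemma smooth_component:
  assumes "c \<in> A" "opn V" "V \<subseteq> fst c" "X \<in> vector_fields A V"
  shows "smooth_fun_on A V (\<lambda>p. X p c $ i)"
  unfolding smooth_fun_on_def
proof
  fix d assume d: "d \<in> A"
  have V: "V \<inter> fst c = V" using assms(3) by blast
  have open_c: "open (snd c ` V)" using open_chart_image[OF assms(2,1)] V by simp
  have "smooth_on (\<lambda>x. X (chart_inv c x) c $ i) (snd c ` V)"
    using smooth_on_vec_nth[OF open_c] vector_fields_smooth[OF assms(4,1)] V by simp
  then show "smooth_on ((\<lambda>p. X p c $ i) \<circ> chart_inv d) (snd d ` (V \<inter> fst d))"
    using smooth_on_chart_change[OF assms(1) d open_c open_chart_image[OF assms(2) d] assms(3), of "\<lambda>p. X p c $ i"]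
    by (simp add: comp_def)
qed

text \<open>Both fields are expanded over the coordinate fields and the Leibniz rule is applied. The
  Christoffel symbols belong to the whole chart domain, whereas the formula is used on smaller open
  sets; \<open>nabla_restrict\<close> links the two.\<close>

lemma nabla_coordinates:
  assumes "c \<in> A" "opn V" "V \<subseteq> fst c" "X \<in> vector_fields A V" "Y \<in> vector_fields A V" "p \<in> V"
  shows "nabla V X Y p c = frechet_derivative (\<lambda>x. Y (chart_inv c x) c) (at (snd c p)) (X p c)
    + christoffel A nabla c (snd c p) (X p c) (Y p c)"
proof -
  let ?E = "\<lambda>i. restrict_field V (coord_field A c i)"
  let ?D = "frechet_derivative (\<lambda>x. Y (chart_inv c x) c) (at (snd c p))"
  have p: "p \<in> fst c" using assms by blast
  note E = restrict_coord_field[OF assms(1-3)]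
  have V: "V \<inter> fst c = V" using assms(3) by blast
  have D: "((\<lambda>x. Y (chart_inv c x) c) has_derivative ?D) (at (snd c p))"
    using smooth_on_has_derivative[OF vector_fields_smooth[OF assms(5,1)]] V assms(6) by blast
  note linD = has_derivative_linear[OF D]
  have E_self: "?E i p c = axis i 1" for i
    using assms(6) p coord_field_self[OF assms(1)] by (simp add: restrict_field_def)
  have nE: "nabla V (?E i) Y p c =
      ?D (axis i 1) + christoffel A nabla c (snd c p) (axis i 1) (Y p c)" for i
  proof -
    have dd: "dir_deriv A (?E i) (\<lambda>p. Y p c $ j) p = ?D (axis i 1) $ j" for j
    proof -
      have "((\<lambda>p. Y p c $ j) \<circ> chart_inv c has_derivative (\<lambda>v. ?D v $ j)) (at (snd c p))"
        using bounded_linear.has_derivative[OF bounded_linear_vec_nth D] by (simp add: comp_def)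
      from dir_deriv_chart[where X="?E i", OF assms(1) p vector_fields_tangent[OF E assms(6)] this]
      show ?thesis by (simp add: E_self)
    qed
    have nn: "nabla V (?E i) (?E j) p c = christoffel A nabla c (snd c p) (axis i 1) (axis j 1)" for j
      using nabla_restrict[OF opn_chart[OF assms(1)] coord_field_mem[OF assms(1)] coord_field_mem[OF assms(1)] assms(2,3)]
        assms(1,6) p by (simp add: christoffel_axis restrict_field_def)
    have "nabla V (?E i) Y = nabla V (?E i) (\<lambda>p d. \<Sum>j\<in>UNIV. field_scale (\<lambda>p. Y p c $ j) (?E j) p d)"
      by (rule arg_cong[where f="nabla V (?E i)", OF vector_field_expansion[OF assms(1,3,5)]])
    also have "\<dots> = (\<lambda>p d. \<Sum>j\<in>UNIV. nabla V (?E i) (field_scale (\<lambda>p. Y p c $ j) (?E j)) p d)"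
      by (rule nabla_sum_right[OF assms(2) finite_class.finite_UNIV
            vector_field_scale[OF E smooth_component[OF assms(1-3,5)] assms(2)] E])
    finally have "nabla V (?E i) Y p c = (\<Sum>j\<in>UNIV. nabla V (?E i) (field_scale (\<lambda>p. Y p c $ j) (?E j)) p c)"
      by simp
    also have "\<dots> = (\<Sum>j\<in>UNIV. dir_deriv A (?E i) (\<lambda>p. Y p c $ j) p *\<^sub>R axis j 1
        + Y p c $ j *\<^sub>R nabla V (?E i) (?E j) p c)"
      unfolding nabla_scale_right[OF assms(2) E E smooth_component[OF assms(1-3,5)]]
      unfolding field_add_def field_scale_def E_self ..
    also have "\<dots> = (\<Sum>j\<in>UNIV. ?D (axis i 1) $ j *\<^sub>R axis j 1
        + Y p c $ j *\<^sub>R christoffel A nabla c (snd c p) (axis i 1) (axis j 1))"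
      unfolding dd nn ..
    also have "\<dots> = ?D (axis i 1) + christoffel A nabla c (snd c p) (axis i 1) (Y p c)"
      unfolding sum.distrib axis_sum linear_axis_expansion[OF linear_christoffel(1)] ..
    finally show ?thesis .
  qed
  have "nabla V X Y = nabla V (\<lambda>p d. \<Sum>i\<in>UNIV. field_scale (\<lambda>p. X p c $ i) (?E i) p d) Y"
    by (rule arg_cong[where f="\<lambda>X. nabla V X Y", OF vector_field_expansion[OF assms(1,3,4)]])
  also have "\<dots> = (\<lambda>p d. \<Sum>i\<in>UNIV. nabla V (field_scale (\<lambda>p. X p c $ i) (?E i)) Y p d)"
    by (rule nabla_sum_left[OF assms(2) finite_class.finite_UNIV
          vector_field_scale[OF E smooth_component[OF assms(1-4)] assms(2)] assms(5)])
  finally have "nabla V X Y p c = (\<Sum>i\<in>UNIV. nabla V (field_scale (\<lambda>p. X p c $ i) (?E i)) Y p c)"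
    by simp
  also have "\<dots> = (\<Sum>i\<in>UNIV. X p c $ i *\<^sub>R (?D (axis i 1) + christoffel A nabla c (snd c p) (axis i 1) (Y p c)))"
    unfolding nabla_scale_left[OF assms(2) E assms(5) smooth_component[OF assms(1-4)]]
    unfolding field_scale_def nE ..
  also have "\<dots> = ?D (X p c) + christoffel A nabla c (snd c p) (X p c) (Y p c)"
    unfolding scaleR_add_right sum.distrib linear_axis_expansion[OF linD]
      linear_axis_expansion[OF linear_christoffel(2)] ..
  finally show ?thesis .
qed

section \<open>Torsion and curvature in coordinates\<close>

lemma smooth_christoffel:
  assumes "c \<in> A"
  shows "smooth_on (\<lambda>x. christoffel A nabla c x a e) (snd c ` fst c)"
  unfolding christoffel_def
proof (intro smooth_on_sum smooth_on_scaleR smooth_on_const open_chart assms)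
  fix i j
  show "smooth_on (\<lambda>x. nabla (fst c) (coord_field A c i) (coord_field A c j) (chart_inv c x) c) (snd c ` fst c)"
    using vector_fields_smooth[OF nabla_field[OF opn_chart coord_field_mem coord_field_mem] assms,
        OF assms assms assms, of i j] by simp
qed

text \<open>In the chart \<open>c\<close> the components are constant, but equality of fields is
  tested in all charts \<open>d\<close>. There the components are first derivatives of the
  transition map \<tau>, and the bracket is the difference of its mixed second derivatives.\<close>

lemma coord_field_bracket:
  assumes "c \<in> A"
  shows "lie_bracket A (fst c) (coord_field A c i) (coord_field A c j) = (\<lambda>p d. 0)"
proof (intro ext)
  fix p d
  show "lie_bracket A (fst c) (coord_field A c i) (coord_field A c j) p d = 0"
  proof (cases "p \<in> fst c \<and> d \<in> A \<and> p \<in> fst d")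
    case True
    then have d: "d \<in> A" "p \<in> fst d" and p: "p \<in> fst c" by auto
    let ?x = "snd d p"
    let ?S = "snd d ` (fst d \<inter> fst c)"
    define \<sigma> where "\<sigma> = snd c \<circ> chart_inv d"
    define \<tau> where "\<tau> = snd d \<circ> chart_inv c"
    have \<sigma>x: "\<sigma> ?x = snd c p" using d by (simp add: \<sigma>_def)
    have S: "open ?S" "?x \<in> ?S" using open_overlap[OF d(1) assms] d p by auto
    have S': "open (snd c ` (fst c \<inter> fst d))" "snd c p \<in> snd c ` (fst c \<inter> fst d)"
      using open_overlap[OF assms d(1)] d p by auto
    have \<tau>: "smooth_on \<tau> (snd c ` (fst c \<inter> fst d))" unfolding \<tau>_def by (rule smooth_transition[OF assms d(1)])
    let ?\<tau>'' = "\<lambda>i. frechet_derivative (\<lambda>x. frechet_derivative \<tau> (at x) (axis i 1)) (at (snd c p))"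
    have eq: "coord_field A c i (chart_inv d x) d = frechet_derivative \<tau> (at (\<sigma> x)) (axis i 1)" if "x \<in> ?S" for x i
      using that d(1) assms
      by (auto simp: coord_field_def restrict_field_def coord_tvec_def \<tau>_def \<sigma>_def transition_deriv_def)
    have Dcoord: "frechet_derivative (\<lambda>x. coord_field A c i (chart_inv d x) d) (at ?x) v =
        ?\<tau>'' i (transition_deriv d c p v)" for i v
    proof -
      have \<sigma>': "(\<sigma> has_derivative transition_deriv d c p) (at ?x)"
        unfolding \<sigma>_def by (rule transition_has_derivative[OF d(1) assms d(2) p])
      have "((\<lambda>x. frechet_derivative \<tau> (at x) (axis i 1)) has_derivative ?\<tau>'' i) (at (\<sigma> ?x))"
        unfolding \<sigma>x by (rule smooth_on_has_derivative[OF smooth_on_frechet_derivative[OF \<tau>] S'(2)])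
      from has_derivative_compose[OF \<sigma>' this]
      have "((\<lambda>x. coord_field A c i (chart_inv d x) d) has_derivative (\<lambda>v. ?\<tau>'' i (transition_deriv d c p v))) (at ?x)"
        by (rule has_derivative_transform_within_open[OF _ S]) (simp add: eq)
      then show ?thesis by (simp add: frechet_derivative_eq)
    qed
    have coord: "coord_field A c i p d = transition_deriv c d p (axis i 1)" for i
      using d p by (simp add: coord_field_def restrict_field_def coord_tvec_def)
    have "lie_bracket A (fst c) (coord_field A c i) (coord_field A c j) p d =
        ?\<tau>'' j (axis i 1) - ?\<tau>'' i (axis j 1)"
      using True unfolding lie_bracket_def Dcoord coord by (simp add: transition_inverse assms)
    also have "\<dots> = 0"
      using second_derivative_symmetric[OF S'(1) \<tau> S'(2)] by simp
    finally show ?thesis .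
  qed (auto simp: lie_bracket_def)
qed

lemma christoffel_symmetric:
  assumes "c \<in> A" "x \<in> snd c ` fst c"
  shows "christoffel A nabla c x a e = christoffel A nabla c x e a"
proof -
  have diff: "field_diff (nabla (fst c) (coord_field A c i) (coord_field A c j))
      (nabla (fst c) (coord_field A c j) (coord_field A c i)) = (\<lambda>p d. 0)" for i j
    using torsion coord_field_bracket[OF assms(1)] opn_chart[OF assms(1)] coord_field_mem[OF assms(1)]
    unfolding torsion_free_def by metis
  have sym: "nabla (fst c) (coord_field A c i) (coord_field A c j) p d =
      nabla (fst c) (coord_field A c j) (coord_field A c i) p d" for i j p d
    using fun_cong[OF fun_cong[OF diff[of i j], of p], of d] by (simp add: field_diff_def)
  show ?thesis unfolding christoffel_def
    by (subst sum.swap, subst sym) (simp add: mult.commute)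
qed

text \<open>\<open>nabla_coordinates\<close> is applied to a field that is itself a covariant
  derivative of coordinate fields, with components given by \<open>christoffel\<close>; the bracket
  term of the curvature is zero for coordinate fields.\<close>

lemma curvature_comp_riemann:
  assumes "c \<in> A" "p \<in> fst c"
  shows "curvature_comp A nabla c p a b i d = riemann A nabla c (snd c p) (axis a 1) (axis b 1) (axis d 1) $ i"
proof -
  let ?U = "fst c" and ?E = "coord_field A c"
  note E = coord_field_mem[OF assms(1)] and U = opn_chart[OF assms(1)]
  have 1: "nabla ?U (?E a) (nabla ?U (?E b) (?E d)) p c =
      frechet_derivative (\<lambda>x. christoffel A nabla c x (axis b 1) (axis d 1)) (at (snd c p)) (axis a 1)
      + christoffel A nabla c (snd c p) (axis a 1) (christoffel A nabla c (snd c p) (axis b 1) (axis d 1))" for a b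
    using nabla_coordinates[OF assms(1) U subset_refl E nabla_field[OF U E E] assms(2), of a b d] assms
    by (simp add: coord_field_self christoffel_axis)
  have 2: "nabla ?U (lie_bracket A ?U (?E a) (?E b)) (?E d) = (\<lambda>p d. 0)"
    unfolding coord_field_bracket[OF assms(1)] by (rule nabla_zero_left[OF U E])
  show ?thesis
    unfolding curvature_comp_def curvature_def field_diff_def 1 2 riemann_def by simp
qed

lemma linear_riemann:
  assumes "c \<in> A" "x \<in> snd c ` fst c"
  shows "linear (\<lambda>a. riemann A nabla c x a b e)" "linear (\<lambda>b. riemann A nabla c x a b e)"
    "linear (\<lambda>e. riemann A nabla c x a b e)"
proof -
  let ?G = "christoffel A nabla c"
  have D: "((\<lambda>x. ?G x b e) has_derivative frechet_derivative (\<lambda>x. ?G x b e) (at x)) (at x)" for b e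
    using smooth_on_has_derivative[OF smooth_christoffel[OF assms(1)] assms(2)] .
  have lin1: "linear (frechet_derivative (\<lambda>x. ?G x b e) (at x))" for b e
    using has_derivative_linear[OF D] .
  note simps = christoffel_linear_simps frechet_derivative_eq[OF has_derivative_add[OF D D]]
    frechet_derivative_eq[OF has_derivative_scaleR_right[OF D]] linear_add[OF lin1] linear_scale[OF lin1]
  show "linear (\<lambda>a. riemann A nabla c x a b e)"
    by (rule linearI) (simp_all add: riemann_def simps algebra_simps)
  show "linear (\<lambda>b. riemann A nabla c x a b e)"
    by (rule linearI) (simp_all add: riemann_def simps algebra_simps)
  show "linear (\<lambda>e. riemann A nabla c x a b e)"
    by (rule linearI) (simp_all add: riemann_def simps algebra_simps)
qed

end


text \<open>\<open>u\<close> holds the components of \<Upsilon> at the point. The change formula is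
  read on coordinate fields and spread to all vectors by bilinearity.\<close>

lemma christoffel_projective_change:
  fixes A :: "('p, real^'n::finite) chart set"
  assumes "connected_atlas A N nabla" "projectively_equivalent N A nabla nabla'"
    and "c \<in> A" "x \<in> snd c ` fst c"
  shows "\<exists>u. \<forall>a e. christoffel A nabla' c x a e = christoffel A nabla c x a e + (u \<bullet> a) *\<^sub>R e + (u \<bullet> e) *\<^sub>R a"
proof -
  interpret connected_atlas A N nabla by fact
  from assms(2)[unfolded projectively_equivalent_def] obtain \<Upsilon> where "\<Upsilon> \<in> one_forms A N"
    and eq: "\<forall>U. opn U \<longrightarrow> (\<forall>X\<in>vector_fields A U. \<forall>Y\<in>vector_fields A U.
      nabla' U X Y = field_add (nabla U X Y)
        (field_add (field_scale (\<lambda>p. \<Upsilon> p (X p)) Y) (field_scale (\<lambda>p. \<Upsilon> p (Y p)) X)))"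
    by (rule bexE)
  define p where "p = chart_inv c x"
  have p: "p \<in> fst c" "snd c p = x"
    using assms(3,4) by (auto simp: p_def)
  then have "p \<in> N" using domain[OF assms(3)] by blast
  then have "\<Upsilon> p \<in> cotangent_space A p" using \<open>\<Upsilon> \<in> one_forms A N\<close> by (simp add: one_forms_def)
  then obtain u where u: "\<Upsilon> p = coord_covec A c p u"
    using cotangent_eq_coord_covec[OF _ assms(3) p(1)] by blast
  let ?G' = "christoffel A nabla' c x" and ?G = "christoffel A nabla c x"
  have axis: "?G' (axis i 1) (axis j 1) =
      ?G (axis i 1) (axis j 1) + (u \<bullet> axis i 1) *\<^sub>R axis j 1 + (u \<bullet> axis j 1) *\<^sub>R axis i 1" for i j
    using eq[rule_format, OF opn_chart[OF assms(3)] coord_field_mem[OF assms(3), of i] coord_field_mem[OF assms(3), of j]] assms(3) p(1)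
    by (simp add: christoffel_axis field_add_def field_scale_def coord_field_self flip: p_def)
      (simp add: coord_field_def restrict_field_def u)
  have lin: "linear (\<lambda>e. ?G a e + (u \<bullet> a) *\<^sub>R e + (u \<bullet> e) *\<^sub>R a)" "linear (\<lambda>a. ?G a e + (u \<bullet> a) *\<^sub>R e + (u \<bullet> e) *\<^sub>R a)" for a e
    by (rule linearI; simp add: christoffel_linear_simps algebra_simps inner_add_right scaleR_add_left)+
  have 1: "?G' (axis i 1) e = ?G (axis i 1) e + (u \<bullet> axis i 1) *\<^sub>R e + (u \<bullet> e) *\<^sub>R axis i 1" for i e
    using linear_axis_expansion[OF linear_christoffel(1), of e A nabla' c x "axis i 1"]
      linear_axis_expansion[OF lin(1), of e "axis i 1"] unfolding axis by simp
  have "?G' a e = ?G a e + (u \<bullet> a) *\<^sub>R e + (u \<bullet> e) *\<^sub>R a" for a e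
    using linear_axis_expansion[OF linear_christoffel(2), of a A nabla' c x e]
      linear_axis_expansion[OF lin(2), of a e] unfolding 1 by simp
  then show ?thesis by blast
qed

section \<open>Charts of the projectivized cotangent bundle\<close>

text \<open>By the dimension count, \<open>(s, y) \<mapsto> s *\<^sub>R w + L y\<close> is a linear
  isomorphism; \<nu> and \<open>K\<close> are the components of its inverse.\<close>

lemma hyperplane_coordinates:
  fixes L :: "'f::euclidean_space \<Rightarrow> 'e::euclidean_space"
  assumes "DIM('e) = DIM('f) + 1" "linear L" "inj L" "w \<notin> range L"
  shows "\<exists>K \<nu>. linear K \<and> linear \<nu> \<and> (\<forall>\<sigma>. \<sigma> = \<nu> \<sigma> *\<^sub>R w + L (K \<sigma>)) \<and>
    (\<forall>s y. \<nu> (s *\<^sub>R w + L y) = s \<and> K (s *\<^sub>R w + L y) = y)"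
proof -
  define T where "T p = fst p *\<^sub>R w + L (snd p)" for p :: "real \<times> 'f"
  have linT: "linear T"
    by (rule linearI) (simp_all add: T_def linear_add[OF assms(2)] linear_scale[OF assms(2)] algebra_simps)
  have injT: "inj T"
    unfolding linear_injective_0[OF linT]
  proof (intro allI impI)
    fix p assume "T p = 0"
    then have eq: "fst p *\<^sub>R w = - L (snd p)" by (simp add: T_def eq_neg_iff_add_eq_0)
    have "fst p = 0"
    proof (rule ccontr)
      assume "fst p \<noteq> 0"
      then have "w = (1 / fst p) *\<^sub>R (fst p *\<^sub>R w)" by simp
      also have "\<dots> = L ((- 1 / fst p) *\<^sub>R snd p)" unfolding eq by (simp add: linear_scale[OF assms(2)] linear_neg[OF assms(2)])
      finally show False using assms(4) by blast
    qed
    moreover from this have "L (snd p) = L 0" using eq linear_0[OF assms(2)] by simp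
    then have "snd p = 0" using assms(3) by (simp only: inj_eq)
    ultimately show "p = 0" by (simp add: prod_eq_iff)
  qed
  have "dim (range T) = DIM(real \<times> 'f)"
    using dim_image_eq[OF linT, of UNIV] injT by simp
  then have "range T = UNIV"
    using assms(1) linT by (intro subspace_dim_equal) (auto intro: linear_subspace_image)
  then have surjT: "T (inv T \<sigma>) = \<sigma>" for \<sigma> by (simp add: f_inv_into_f)
  have invT: "inv T (T p) = p" for p using injT by simp
  have lin_inv: "linear (inv T)"
  proof (rule linearI)
    show "inv T (a + b) = inv T a + inv T b" for a b
      using invT[of "inv T a + inv T b"] by (simp add: linear_add[OF linT] surjT)
    show "inv T (r *\<^sub>R a) = r *\<^sub>R inv T a" for r a
      using invT[of "r *\<^sub>R inv T a"] by (simp add: linear_scale[OF linT] surjT)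
  qed
  have "linear (\<lambda>\<sigma>. snd (inv T \<sigma>))" "linear (\<lambda>\<sigma>. fst (inv T \<sigma>))"
    using linear_compose[OF lin_inv linear_snd] linear_compose[OF lin_inv linear_fst] by (simp_all add: comp_def)
  moreover have "\<sigma> = fst (inv T \<sigma>) *\<^sub>R w + L (snd (inv T \<sigma>))" for \<sigma>
    using surjT[of \<sigma>] by (simp add: T_def)
  moreover have "inv T (s *\<^sub>R w + L y) = (s, y)" for s y
    using invT[of "(s, y)"] by (simp add: T_def)
  ultimately show ?thesis
    by (intro exI[of _ "\<lambda>\<sigma>. snd (inv T \<sigma>)"] exI[of _ "\<lambda>\<sigma>. fst (inv T \<sigma>)"]) simp
qed

definition proj_chart ::
  "('p, 'e::euclidean_space) chart set \<Rightarrow> ('p, 'e) chart \<Rightarrow> 'e \<Rightarrow> ('f::euclidean_space \<Rightarrow> 'e) \<Rightarrow>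
   ('p \<times> ('p, 'e) covec set, 'e \<times> 'f) chart" where
  "proj_chart A c w L = (proj_cotangent_param A c w L ` (snd c ` fst c \<times> UNIV),
     inv_into (snd c ` fst c \<times> UNIV) (proj_cotangent_param A c w L))"

locale cotangent_atlas = smooth_atlas A
  for A :: "('p, 'e::euclidean_space) chart set" +
  fixes B :: "('p \<times> ('p, 'e) covec set, 'e \<times> 'f::euclidean_space) chart set"
  assumes B: "B = proj_cotangent_atlas A" and dim: "DIM('e) = DIM('f) + 1"
begin

lemma B_charts:
  "d \<in> B \<longleftrightarrow> (\<exists>c w L. d = proj_chart A c w L \<and> c \<in> A \<and> linear L \<and> inj L \<and> w \<notin> range L)"
  unfolding B proj_cotangent_atlas_def proj_chart_def by simp

text \<open>The transformation of covectors needs the derivative from \<open>d\<close> to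
  \<open>c\<close> at a point given by its \<open>c\<close> coordinates.\<close>

lemma smooth_on_transition_deriv_swap:
  assumes "c \<in> A" "d \<in> A"
  shows "smooth_on (\<lambda>x. transition_deriv d c (chart_inv c x) e) (snd c ` (fst c \<inter> fst d))"
proof -
  have "smooth_on (\<lambda>x. (\<lambda>y. transition_deriv d c (chart_inv d y) e) ((snd d \<circ> chart_inv c) x)) (snd c ` (fst c \<inter> fst d))"
    by (rule smooth_on_compose[OF open_overlap[OF assms] open_overlap[OF assms(2,1)]
          smooth_on_transition_deriv[OF assms(2,1)] smooth_transition[OF assms]]) (use assms in auto)
  then show ?thesis
    by (rule smooth_on_cong[THEN iffD1, OF open_overlap[OF assms], rotated]) (use assms in auto)
qed

end

text \<open>Homogeneous coordinates for an affine chart: \<nu> is nonzero on the covectors whose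
  lines belong to it, and the affine coordinate of the line of \<sigma> is K \<sigma> divided by
  \<nu> \<sigma>.\<close>

locale proj_frame = cotangent_atlas A B
  for A :: "('p, 'e::euclidean_space) chart set"
    and B :: "('p \<times> ('p, 'e) covec set, 'e \<times> 'f::euclidean_space) chart set" +
  fixes c :: "('p, 'e) chart" and w :: 'e and L :: "'f \<Rightarrow> 'e" and K :: "'e \<Rightarrow> 'f" and \<nu> :: "'e \<Rightarrow> real"
  assumes c: "c \<in> A" and L: "linear L" "inj L" "w \<notin> range L"
    and K: "linear K" and \<nu>: "linear \<nu>"
    and split: "\<And>\<sigma>. \<sigma> = \<nu> \<sigma> *\<^sub>R w + L (K \<sigma>)"
    and \<nu>_coord: "\<And>s y. \<nu> (s *\<^sub>R w + L y) = s" and K_coord: "\<And>s y. K (s *\<^sub>R w + L y) = y"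

lemma (in cotangent_atlas) proj_frame_exists:
  assumes "c \<in> A" "linear L" "inj L" "w \<notin> range L"
  shows "\<exists>K \<nu>. proj_frame A B c w L K \<nu>"
proof -
  obtain K \<nu> where "linear K" "linear \<nu>" "\<forall>\<sigma>. \<sigma> = \<nu> \<sigma> *\<^sub>R w + L (K \<sigma>)"
    "\<forall>s y. \<nu> (s *\<^sub>R w + L y) = s \<and> K (s *\<^sub>R w + L y) = y"
    using hyperplane_coordinates[OF dim assms(2-4)] by blast
  with assms have "proj_frame A B c w L K \<nu>"
    by (intro proj_frame.intro cotangent_atlas_axioms proj_frame_axioms.intro) blast+
  then show ?thesis by blast
qed

context proj_frame
begin

abbreviation param where "param \<equiv> proj_cotangent_param A c w L"
abbreviation chart where "chart \<equiv> proj_chart A c w L"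

lemma frame_simps [simp]: "\<nu> (w + L y) = 1" "K (w + L y) = y"
  using \<nu>_coord[of 1 y] K_coord[of 1 y] by simp_all

lemma frame_nonzero: "w + L y \<noteq> 0"
proof
  assume "w + L y = 0"
  then have "\<nu> (w + L y) = \<nu> 0" by simp
  then show False using linear_0[OF \<nu>] by simp
qed

lemma param_eq: "param (x, y) = (chart_inv c x, covec_line (coord_covec A c (chart_inv c x) (w + L y)))"
  by (simp add: proj_cotangent_param_def)

text \<open>\<nu> takes the value 1 on every covector \<open>w + L y\<close>, so proportional ones
  coincide.\<close>

lemma inj_param: "inj_on param (snd c ` fst c \<times> UNIV)"
proof (rule inj_onI)
  fix z z' assume z: "z \<in> snd c ` fst c \<times> UNIV" "z' \<in> snd c ` fst c \<times> UNIV" "param z = param z'"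
  obtain x y x' y' where [simp]: "z = (x, y)" "z' = (x', y')" by fastforce
  have x: "x \<in> snd c ` fst c" "x' \<in> snd c ` fst c" using z by auto
  have inv: "chart_inv c x = chart_inv c x'" using z(3) by (simp add: param_eq)
  then have xx: "x = x'" using chart_inv_right[OF x(1)] chart_inv_right[OF x(2)] by metis
  have p: "chart_inv c x \<in> fst c" using x(1) c by (rule_tac chart_inv_mem) auto
  have "covec_line (coord_covec A c (chart_inv c x) (w + L y)) = covec_line (coord_covec A c (chart_inv c x) (w + L y'))"
    using z(3) xx by (simp add: param_eq)
  then obtain t where t: "w + L y' = t *\<^sub>R (w + L y)"
    using covec_line_eq_iff[OF c p frame_nonzero] by blast
  then have "\<nu> (w + L y') = t * \<nu> (w + L y)" by (simp add: linear_scale[OF \<nu>] del: frame_simps)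
  then have "t = 1" by simp
  then have "K (w + L y') = K (w + L y)" using t by (simp del: frame_simps)
  then show "z = z'" using xx by simp
qed

lemma mem_chart: "q \<in> fst chart \<longleftrightarrow> fst q \<in> fst c \<and> (\<exists>y. snd q = covec_line (coord_covec A c (fst q) (w + L y)))"
proof
  assume "q \<in> fst chart"
  then obtain x y where "x \<in> snd c ` fst c" "q = param (x, y)" by (auto simp: proj_chart_def)
  then show "fst q \<in> fst c \<and> (\<exists>y. snd q = covec_line (coord_covec A c (fst q) (w + L y)))"
    using chart_inv_mem[of x c "fst c"] c by (auto simp: param_eq)
next
  assume *: "fst q \<in> fst c \<and> (\<exists>y. snd q = covec_line (coord_covec A c (fst q) (w + L y)))"
  then obtain y where "q = param (snd c (fst q), y)" using c by (auto simp: param_eq prod_eq_iff)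
  then show "q \<in> fst chart" using * unfolding proj_chart_def fst_conv by (metis SigmaI UNIV_I imageI)
qed

lemma chart_param: "x \<in> snd c ` fst c \<Longrightarrow> snd chart (param (x, y)) = (x, y)"
  unfolding proj_chart_def snd_conv by (rule inv_into_f_f[OF inj_param]) simp

lemma param_mem: "x \<in> snd c ` fst c \<Longrightarrow> param (x, y) \<in> fst chart"
  unfolding proj_chart_def fst_conv by (rule imageI) simp

lemma chart_image: "snd chart ` fst chart = snd c ` fst c \<times> UNIV"
  unfolding proj_chart_def using inj_param by (simp add: inv_into_image_cancel image_inv_into_cancel)

lemma inj_on_chart: "inj_on (snd chart) (fst chart)"
  unfolding proj_chart_def fst_conv snd_conv by (rule inj_on_inv_into) simp

lemma chart_inv_param: "x \<in> snd c ` fst c \<Longrightarrow> chart_inv chart (x, y) = param (x, y)"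
  unfolding chart_inv_def using inv_into_f_f[OF inj_on_chart param_mem, of x y] chart_param[of x y] by simp

lemma line_mem_chart:
  assumes "p \<in> fst c" "\<sigma> \<noteq> 0"
  shows "(p, covec_line (coord_covec A c p \<sigma>)) \<in> fst chart \<longleftrightarrow> \<nu> \<sigma> \<noteq> 0"
    and "\<nu> \<sigma> \<noteq> 0 \<Longrightarrow> snd chart (p, covec_line (coord_covec A c p \<sigma>)) = (snd c p, inverse (\<nu> \<sigma>) *\<^sub>R K \<sigma>)"
proof -
  have eq: "(p, covec_line (coord_covec A c p \<sigma>)) = param (snd c p, inverse (\<nu> \<sigma>) *\<^sub>R K \<sigma>)" if "\<nu> \<sigma> \<noteq> 0"
  proof -
    have "w + L (inverse (\<nu> \<sigma>) *\<^sub>R K \<sigma>) = inverse (\<nu> \<sigma>) *\<^sub>R (\<nu> \<sigma> *\<^sub>R w + L (K \<sigma>))"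
      using that by (simp add: linear_scale[OF L(1)] scaleR_add_right)
    then have "w + L (inverse (\<nu> \<sigma>) *\<^sub>R K \<sigma>) = inverse (\<nu> \<sigma>) *\<^sub>R \<sigma>" using split[of \<sigma>] by simp
    then have "covec_line (coord_covec A c p \<sigma>) = covec_line (coord_covec A c p (w + L (inverse (\<nu> \<sigma>) *\<^sub>R K \<sigma>)))"
      using that by (subst covec_line_eq_iff[OF c assms]) (intro exI[of _ "inverse (\<nu> \<sigma>)"], simp)
    then show ?thesis using assms(1) c by (simp add: param_eq)
  qed
  show "snd chart (p, covec_line (coord_covec A c p \<sigma>)) = (snd c p, inverse (\<nu> \<sigma>) *\<^sub>R K \<sigma>)" if "\<nu> \<sigma> \<noteq> 0"
    unfolding eq[OF that] using assms(1) by (intro chart_param) simp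
  show "(p, covec_line (coord_covec A c p \<sigma>)) \<in> fst chart \<longleftrightarrow> \<nu> \<sigma> \<noteq> 0"
  proof
    assume "(p, covec_line (coord_covec A c p \<sigma>)) \<in> fst chart"
    then obtain y where "covec_line (coord_covec A c p \<sigma>) = covec_line (coord_covec A c p (w + L y))"
      unfolding mem_chart by auto
    then obtain t where "w + L y = t *\<^sub>R \<sigma>" using covec_line_eq_iff[OF c assms] by blast
    then have "1 = t * \<nu> \<sigma>" using frame_simps(1)[of y] by (simp add: linear_scale[OF \<nu>])
    then show "\<nu> \<sigma> \<noteq> 0" by auto
  next
    assume "\<nu> \<sigma> \<noteq> 0"
    then show "(p, covec_line (coord_covec A c p \<sigma>)) \<in> fst chart"
      unfolding eq[OF \<open>\<nu> \<sigma> \<noteq> 0\<close>] using assms(1) by (intro param_mem) simp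
  qed
qed

lemma chart_coords:
  assumes "q \<in> fst chart"
  shows "fst q \<in> fst c" "fst (snd chart q) = snd c (fst q)"
    "snd q = covec_line (coord_covec A c (fst q) (w + L (snd (snd chart q))))"
    "q = param (snd chart q)" "fst (snd chart q) \<in> snd c ` fst c"
proof -
  obtain y where p: "fst q \<in> fst c" and y: "snd q = covec_line (coord_covec A c (fst q) (w + L y))"
    using assms unfolding mem_chart by blast
  have "q = param (snd c (fst q), y)" using p y c by (simp add: param_eq prod_eq_iff)
  moreover from this have "snd chart q = (snd c (fst q), y)" using chart_param p by (metis imageI)
  ultimately show "fst q \<in> fst c" "fst (snd chart q) = snd c (fst q)"
    "snd q = covec_line (coord_covec A c (fst q) (w + L (snd (snd chart q))))"
    "q = param (snd chart q)" "fst (snd chart q) \<in> snd c ` fst c" using p y by auto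
qed

end

section \<open>Transition maps between bundle charts\<close>

locale two_frames = f1: proj_frame A B c w L K \<nu> + f2: proj_frame A B c' w' L' K' \<nu>'
  for A :: "('p, 'e::euclidean_space) chart set"
    and B :: "('p \<times> ('p, 'e) covec set, 'e \<times> 'f::euclidean_space) chart set"
    and c w L K \<nu> c' w' L' K' \<nu>'
begin

text \<open>The components in \<open>c'\<close> of the covector whose components in \<open>c\<close>
  are \<open>w + L (snd z)\<close>, before normalization by \<nu>'.\<close>

definition covec_change :: "'e \<times> 'f \<Rightarrow> 'e" where
  "covec_change z = (\<Sum>b\<in>Basis. ((w + L (snd z)) \<bullet> transition_deriv c' c (chart_inv c (fst z)) b) *\<^sub>R b)"

abbreviation overlap where "overlap \<equiv> snd c ` (fst c \<inter> fst c') \<times> (UNIV :: 'f set)"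

lemma open_overlap2: "open overlap"
  using f1.open_overlap[OF f1.c f2.c] by (intro open_Times) auto

lemma smooth_covec_change: "smooth_on covec_change overlap"
  unfolding covec_change_def
proof (rule smooth_on_sum[OF open_overlap2], rule smooth_on_scaleR[OF open_overlap2 _ smooth_on_const[OF open_overlap2]],
    rule smooth_on_inner[OF open_overlap2])
  fix b :: 'e
  show "smooth_on (\<lambda>z. w + L (snd z)) overlap"
    by (rule smooth_on_add[OF open_overlap2 smooth_on_const[OF open_overlap2]
      smooth_on_linear[OF f1.L(1) open_overlap2 smooth_on_snd[OF open_overlap2 smooth_on_ident[OF open_overlap2]]]])
  have "smooth_on (\<lambda>z. (\<lambda>x. transition_deriv c' c (chart_inv c x) b) (fst z)) overlap"
    by (rule smooth_on_compose[OF open_overlap2 f1.open_overlap[OF f1.c f2.c]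
        f1.smooth_on_transition_deriv_swap[OF f1.c f2.c] smooth_on_fst[OF open_overlap2 smooth_on_ident[OF open_overlap2]]]) auto
  then show "smooth_on (\<lambda>z. transition_deriv c' c (chart_inv c (fst z)) b) overlap" .
qed

lemma param_covec_change:
  assumes "z \<in> overlap"
  shows "f1.param z = (chart_inv c (fst z), covec_line (coord_covec A c' (chart_inv c (fst z)) (covec_change z)))"
    and "covec_change z \<noteq> 0"
proof -
  obtain x y where z: "z = (x, y)" by fastforce
  define p where "p = chart_inv c x"
  have p: "p \<in> fst c" "p \<in> fst c'"
    using assms f1.c f1.chart_inv_mem[of x c "fst c \<inter> fst c'"] by (auto simp: z p_def)
  have eq: "coord_covec A c p (w + L y) = coord_covec A c' p (covec_change z)"
    using f1.coord_covec_change[OF f1.c p(1) f2.c p(2)] by (simp add: covec_change_def z p_def)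
  then show "f1.param z = (chart_inv c (fst z), covec_line (coord_covec A c' (chart_inv c (fst z)) (covec_change z)))"
    by (simp add: z f1.param_eq flip: p_def)
  show "covec_change z \<noteq> 0"
  proof
    assume "covec_change z = 0"
    then have "coord_covec A c p (w + L y) = coord_covec A c p 0"
      unfolding eq by (simp add: coord_covec_def cong: if_cong)
    then show False using f1.coord_covec_inject[OF f1.c p(1)] f1.frame_nonzero by blast
  qed
qed

lemma overlap_image: "snd f1.chart ` (fst f1.chart \<inter> fst f2.chart) = {z \<in> overlap. \<nu>' (covec_change z) \<noteq> 0}"
proof (intro equalityI subsetI)
  fix z assume "z \<in> snd f1.chart ` (fst f1.chart \<inter> fst f2.chart)"
  then obtain q where q: "q \<in> fst f1.chart" "q \<in> fst f2.chart" "z = snd f1.chart q" by blast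
  have "fst z \<in> snd c ` (fst c \<inter> fst c')"
    using f1.chart_coords(1,2)[OF q(1)] f2.chart_coords(1)[OF q(2)] q(3) by auto
  then have z: "z \<in> overlap" by (simp add: mem_Times_iff)
  have p: "chart_inv c (fst z) \<in> fst c'"
    using z f1.c f1.chart_inv_mem[of "fst z" c "fst c \<inter> fst c'"] by auto
  have "q = f1.param z" using f1.chart_coords(4)[OF q(1)] q(3) by simp
  then show "z \<in> {z \<in> overlap. \<nu>' (covec_change z) \<noteq> 0}"
    using q(2) z unfolding param_covec_change(1)[OF z] f2.line_mem_chart(1)[OF p param_covec_change(2)[OF z]]
    by (simp add: f2.line_mem_chart(1)[OF p param_covec_change(2)[OF z]])
next
  fix z assume "z \<in> {z \<in> overlap. \<nu>' (covec_change z) \<noteq> 0}"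
  then have z: "z \<in> overlap" "\<nu>' (covec_change z) \<noteq> 0" by auto
  have p: "chart_inv c (fst z) \<in> fst c'"
    using z f1.c f1.chart_inv_mem[of "fst z" c "fst c \<inter> fst c'"] by auto
  have x: "fst z \<in> snd c ` fst c" using z(1) by auto
  have "f1.param z \<in> fst f1.chart" using f1.param_mem[OF x, of "snd z"] by simp
  moreover have "f1.param z \<in> fst f2.chart"
    unfolding param_covec_change(1)[OF z(1)] f2.line_mem_chart(1)[OF p param_covec_change(2)[OF z(1)]] by (rule z(2))
  moreover have "snd f1.chart (f1.param z) = z" using f1.chart_param[OF x, of "snd z"] by simp
  ultimately show "z \<in> snd f1.chart ` (fst f1.chart \<inter> fst f2.chart)" by (metis IntI imageI)
qed

lemma transition_eq:
  assumes "z \<in> overlap" "\<nu>' (covec_change z) \<noteq> 0"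
  shows "snd f2.chart (chart_inv f1.chart z) =
    (snd c' (chart_inv c (fst z)), inverse (\<nu>' (covec_change z)) *\<^sub>R K' (covec_change z))"
proof -
  have p: "chart_inv c (fst z) \<in> fst c'"
    using assms(1) f1.c f1.chart_inv_mem[of "fst z" c "fst c \<inter> fst c'"] by auto
  have "fst z \<in> snd c ` fst c" using assms(1) by auto
  from f1.chart_inv_param[OF this, of "snd z"] have "chart_inv f1.chart z = f1.param z" by simp
  then show ?thesis
    unfolding param_covec_change(1)[OF assms(1)]
    using f2.line_mem_chart(2)[OF p param_covec_change(2)[OF assms(1)] assms(2)] by simp
qed

lemma open_overlap_image: "open (snd f1.chart ` (fst f1.chart \<inter> fst f2.chart))"
proof -
  have "continuous_on overlap (\<lambda>z. \<nu>' (covec_change z))"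
    by (rule smooth_on_continuous[OF smooth_on_linear[OF f2.\<nu> open_overlap2 smooth_covec_change]])
  from continuous_open_preimage[OF this open_overlap2 open_Compl[OF closed_singleton[of 0]]]
  have "open (overlap \<inter> (\<lambda>z. \<nu>' (covec_change z)) -` (- {0}))" .
  moreover have "overlap \<inter> (\<lambda>z. \<nu>' (covec_change z)) -` (- {0}) = {z \<in> overlap. \<nu>' (covec_change z) \<noteq> 0}" by auto
  ultimately show ?thesis unfolding overlap_image by simp
qed

text \<open>The base transition is paired with a quotient: K' over \<nu>' at the transformed
  covector, smooth on the open set where the denominator is nonzero.\<close>

lemma smooth_transition_image:
  "smooth_on (snd f2.chart \<circ> chart_inv f1.chart) (snd f1.chart ` (fst f1.chart \<inter> fst f2.chart))"
proof -
  let ?S = "{z \<in> overlap. \<nu>' (covec_change z) \<noteq> 0}"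
  have S: "open ?S" using open_overlap_image unfolding overlap_image .
  have sub: "?S \<subseteq> overlap" by blast
  have cc: "smooth_on covec_change ?S" by (rule smooth_on_subset[OF smooth_covec_change sub])
  have 1: "smooth_on (\<lambda>z. (snd c' \<circ> chart_inv c) (fst z)) ?S"
    by (rule smooth_on_compose[OF S f1.open_overlap[OF f1.c f2.c] f1.smooth_transition[OF f1.c f2.c]
      smooth_on_fst[OF S smooth_on_ident[OF S]]]) auto
  have 2: "smooth_on (\<lambda>z. inverse (\<nu>' (covec_change z)) *\<^sub>R K' (covec_change z)) ?S"
    by (rule smooth_on_scaleR[OF S smooth_on_inverse[OF S _ smooth_on_linear[OF f2.\<nu> S cc]] smooth_on_linear[OF f2.K S cc]]) auto
  have "smooth_on (snd f2.chart \<circ> chart_inv f1.chart) ?S"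
  proof (rule smooth_on_cong[THEN iffD1, OF S _ smooth_on_Pair[OF S 1 2]])
    fix z assume "z \<in> ?S"
    then show "((snd c' \<circ> chart_inv c) (fst z), inverse (\<nu>' (covec_change z)) *\<^sub>R K' (covec_change z)) =
        (snd f2.chart \<circ> chart_inv f1.chart) z"
      using transition_eq[of z] by simp
  qed
  then show ?thesis unfolding overlap_image .
qed

end

sublocale cotangent_atlas \<subseteq> B: smooth_atlas B
proof
  fix d assume "d \<in> B"
  then obtain c w L where d: "d = proj_chart A c w L" "c \<in> A" "linear L" "inj L" "w \<notin> range L"
    unfolding B_charts by blast
  then obtain K \<nu> where "proj_frame A B c w L K \<nu>" using proj_frame_exists by blast
  then interpret f1: proj_frame A B c w L K \<nu> .
  show "inj_on (snd d) (fst d)" unfolding d(1) by (rule f1.inj_on_chart)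
  show "open (snd d ` fst d)"
    unfolding d(1) f1.chart_image using open_chart[OF d(2)] by (intro open_Times) auto
  fix d' assume "d' \<in> B"
  then obtain c' w' L' where d': "d' = proj_chart A c' w' L'" "c' \<in> A" "linear L'" "inj L'" "w' \<notin> range L'"
    unfolding B_charts by blast
  then obtain K' \<nu>' where "proj_frame A B c' w' L' K' \<nu>'" using proj_frame_exists by blast
  then interpret f2: proj_frame A B c' w' L' K' \<nu>' .
  interpret two_frames A B c w L K \<nu> c' w' L' K' \<nu>' ..
  show "open (snd d ` (fst d \<inter> fst d'))" unfolding d(1) d'(1) by (rule open_overlap_image)
  show "smooth_on (snd d' \<circ> chart_inv d) (snd d ` (fst d \<inter> fst d'))"
    unfolding d(1) d'(1) by (rule smooth_transition_image)
qed

section \<open>The partial connection in coordinates\<close>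

lemma (in smooth_atlas) tangent_map_eq_coord_tvec:
  fixes B :: "('q, 'f::euclidean_space) chart set"
  assumes "smooth_atlas B" "c \<in> A" "p \<in> fst c" "v \<in> tangent_space A p" "d \<in> B" "f p \<in> fst d"
    and S: "open S" "snd c p \<in> S" "\<And>x. x \<in> S \<Longrightarrow> f (chart_inv c x) \<in> fst d"
    and f': "(snd d \<circ> f \<circ> chart_inv c has_derivative f') (at (snd c p))"
  shows "tangent_map A B f p v = coord_tvec B d (f p) (f' (v c))"
proof
  interpret B: smooth_atlas B by fact
  fix d'
  show "tangent_map A B f p v d' = coord_tvec B d (f p) (f' (v c)) d'"
  proof (cases "d' \<in> B \<and> f p \<in> fst d'")
    case True
    have "(snd d' \<circ> chart_inv d has_derivative transition_deriv d d' (f p)) (at ((snd d \<circ> f \<circ> chart_inv c) (snd c p)))"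
      using B.transition_has_derivative[OF assms(5) _ assms(6), of d'] True assms(2,3) by simp
    from has_derivative_compose[OF f' this]
    have "(snd d' \<circ> f \<circ> chart_inv c has_derivative (\<lambda>v. transition_deriv d d' (f p) (f' v))) (at (snd c p))"
      by (rule has_derivative_transform_within_open[OF _ S(1,2)]) (use S(3) assms(5) in simp)
    from tangent_map_chart[OF assms(2-4) _ _ this]
    show ?thesis using True by (simp add: coord_tvec_def)
  next
    case False
    then show ?thesis by (auto simp: tangent_map_def coord_tvec_def)
  qed
qed

text \<open>The derivatives of \<open>Y\<close> coming from the Leibniz rule and from
  \<open>nabla\<close> cancel, so the outcome depends on the value of \<open>Y\<close> at
  \<open>p\<close> alone.\<close>

lemma (in connected_atlas) dual_nabla_coordinates:
  assumes "c \<in> A" "opn V" "V \<subseteq> fst c" "X \<in> vector_fields A V" "Y \<in> vector_fields A V" "p \<in> V"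
    and \<sigma>: "\<And>p. p \<in> V \<Longrightarrow> \<sigma> p = coord_covec A c p (\<omega> (snd c p))"
    and \<omega>': "(\<omega> has_derivative \<omega>') (at (snd c p))"
  shows "dual_nabla A nabla V X \<sigma> Y p =
    \<omega>' (X p c) \<bullet> Y p c - \<omega> (snd c p) \<bullet> christoffel A nabla c (snd c p) (X p c) (Y p c)"
proof -
  let ?D = "frechet_derivative (\<lambda>x. Y (chart_inv c x) c) (at (snd c p))"
  have p: "p \<in> fst c" using assms by blast
  have V: "V \<inter> fst c = V" using assms(3) by blast
  have open_c: "open (snd c ` V)" using open_chart_image[OF assms(2,1)] V by simp
  have D: "((\<lambda>x. Y (chart_inv c x) c) has_derivative ?D) (at (snd c p))"
    using smooth_on_has_derivative[OF vector_fields_smooth[OF assms(5,1)]] V assms(6) by blast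
  have "((\<lambda>x. \<omega> x \<bullet> Y (chart_inv c x) c) has_derivative
      (\<lambda>v. \<omega> (snd c p) \<bullet> ?D v + \<omega>' v \<bullet> Y (chart_inv c (snd c p)) c)) (at (snd c p))"
    by (rule has_derivative_inner[OF \<omega>' D])
  then have "((\<lambda>p'. \<sigma> p' (Y p')) \<circ> chart_inv c has_derivative
      (\<lambda>v. \<omega> (snd c p) \<bullet> ?D v + \<omega>' v \<bullet> Y (chart_inv c (snd c p)) c)) (at (snd c p))"
  proof (rule has_derivative_transform_within_open[OF _ open_c])
    fix x assume "x \<in> snd c ` V"
    then obtain p' where p': "p' \<in> V" "x = snd c p'" by blast
    then have "p' \<in> fst c" using assms(3) by blast
    then show "\<omega> x \<bullet> Y (chart_inv c x) c = ((\<lambda>p'. \<sigma> p' (Y p')) \<circ> chart_inv c) x"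
      using p' assms(1) \<sigma>[OF p'(1)] vector_fields_tangent[OF assms(5) p'(1)] by (simp add: coord_covec_def)
  qed (use assms(6) in blast)
  from dir_deriv_chart[where X=X, OF assms(1) p vector_fields_tangent[OF assms(4,6)] this]
  have "dir_deriv A X (\<lambda>p'. \<sigma> p' (Y p')) p = \<omega> (snd c p) \<bullet> ?D (X p c) + \<omega>' (X p c) \<bullet> Y p c"
    using assms(1) p by simp
  moreover have "\<sigma> p (nabla V X Y p) = \<omega> (snd c p) \<bullet> nabla V X Y p c"
    using \<sigma>[OF assms(6)] vector_fields_tangent[OF nabla_field[OF assms(2,4,5)] assms(6)]
    by (simp add: coord_covec_def)
  ultimately show ?thesis
    unfolding dual_nabla_def nabla_coordinates[OF assms(1-6)] by (simp add: inner_add_right)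
qed

context proj_frame
begin

lemma chart_mem_B: "chart \<in> B"
  using c L unfolding B_charts by blast

lemma tangent_map_fst:
  assumes "q \<in> fst chart" "\<xi> \<in> tangent_space B q"
  shows "tangent_map B A fst q \<xi> = coord_tvec A c (fst q) (fst (\<xi> chart))"
proof (rule B.tangent_map_eq_coord_tvec[OF smooth_atlas_axioms chart_mem_B assms c])
  let ?S = "snd chart ` fst chart"
  show "fst q \<in> fst c" by (rule chart_coords(1)[OF assms(1)])
  show S: "open ?S" "snd chart q \<in> ?S" using B.open_chart[OF chart_mem_B] assms(1) by auto
  have eq: "fst (chart_inv chart x) \<in> fst c \<and> snd c (fst (chart_inv chart x)) = fst x" if x: "x \<in> ?S" for x
  proof -
    obtain q' where q': "q' \<in> fst chart" "x = snd chart q'" using x by blast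
    then show ?thesis
      using chart_coords(1,2)[OF q'(1)] B.chart_inv_left[OF chart_mem_B q'(1)] by simp
  qed
  then show "fst (chart_inv chart x) \<in> fst c" if "x \<in> ?S" for x using that by blast
  have "(fst has_derivative fst) (at (snd chart q))"
    by (rule bounded_linear_imp_has_derivative[OF bounded_linear_fst])
  then show "(snd c \<circ> fst \<circ> chart_inv chart has_derivative fst) (at (snd chart q))"
    by (rule has_derivative_transform_within_open[OF _ S]) (simp add: eq)
qed

lemma contact_iff:
  assumes "q \<in> fst chart" "\<xi> \<in> tangent_space B q"
  shows "\<xi> \<in> contact_distribution A B q \<longleftrightarrow> (w + L (snd (snd chart q))) \<bullet> fst (\<xi> chart) = 0"
proof -
  note q = chart_coords[OF assms(1)]
  have "(\<forall>\<alpha>\<in>snd q. \<alpha> (coord_tvec A c (fst q) (fst (\<xi> chart))) = 0) \<longleftrightarrow>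
      (\<forall>t. t * coord_covec A c (fst q) (w + L (snd (snd chart q))) (coord_tvec A c (fst q) (fst (\<xi> chart))) = 0)"
    by (subst q(3)) (auto simp: covec_line_def)
  also have "\<dots> \<longleftrightarrow> (w + L (snd (snd chart q))) \<bullet> fst (\<xi> chart) = 0"
    unfolding coord_covec_coord_tvec[OF c q(1)] by (metis mult_1 mult_zero_right)
  finally show ?thesis
    unfolding contact_distribution_def tangent_map_fst[OF assms] using assms(2)
      tangent_map_fst[OF assms] by simp
qed

text \<open>Quotient rule for the affine coordinate of the line of \<omega>. The section may leave
  the bundle chart inside \<open>V\<close>, hence the restriction to the open set where \<nu> is
  nonzero on it.\<close>

lemma section_derivative:
  assumes V: "open (snd c ` V)" "V \<subseteq> fst c" "p \<in> V"
    and s: "\<And>p. p \<in> V \<Longrightarrow> s p = (p, covec_line (coord_covec A c p (\<omega> (snd c p))))"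
    and \<omega>: "continuous_on (snd c ` V) \<omega>" "(\<omega> has_derivative \<omega>') (at (snd c p))" "\<nu> (\<omega> (snd c p)) \<noteq> 0"
    and X: "X \<in> tangent_space A p"
  shows "tangent_map A B s p X = coord_tvec B chart (s p)
    (X c, inverse (\<nu> (\<omega> (snd c p))) *\<^sub>R K (\<omega>' (X c))
      + (- (inverse (\<nu> (\<omega> (snd c p))) * \<nu> (\<omega>' (X c)) * inverse (\<nu> (\<omega> (snd c p))))) *\<^sub>R K (\<omega> (snd c p)))"
proof -
  let ?x = "snd c p"
  let ?S = "snd c ` V \<inter> (\<lambda>x. \<nu> (\<omega> x)) -` (- {0})"
  have p: "p \<in> fst c" using V by blast
  have "continuous_on (snd c ` V) (\<lambda>x. \<nu> (\<omega> x))"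
    by (rule continuous_on_compose2[OF linear_continuous_on[OF linear_conv_bounded_linear[THEN iffD1, OF \<nu>]] \<omega>(1) subset_UNIV])
  from continuous_open_preimage[OF this V(1) open_Compl[OF closed_singleton[of 0]]]
  have S: "open ?S" "?x \<in> ?S" using V(3) \<omega>(3) by auto
  have eq: "s (chart_inv c x) \<in> fst chart \<and> snd chart (s (chart_inv c x)) = (x, inverse (\<nu> (\<omega> x)) *\<^sub>R K (\<omega> x))"
    if x: "x \<in> ?S" for x
  proof -
    obtain p' where p': "p' \<in> V" "x = snd c p'" using x by blast
    then have "p' \<in> fst c" using V by blast
    have "\<nu> (\<omega> x) \<noteq> 0" using x by simp
    moreover from this have "\<omega> x \<noteq> 0" using linear_0[OF \<nu>] by metis
    ultimately show ?thesis
      using line_mem_chart[OF \<open>p' \<in> fst c\<close>, of "\<omega> x"] s[OF p'(1)] p' c \<open>p' \<in> fst c\<close> by simp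
  qed
  have K': "((\<lambda>x. K (\<omega> x)) has_derivative (\<lambda>v. K (\<omega>' v))) (at ?x)"
    by (rule bounded_linear.has_derivative[OF linear_conv_bounded_linear[THEN iffD1, OF K] \<omega>(2)])
  have \<nu>': "((\<lambda>x. \<nu> (\<omega> x)) has_derivative (\<lambda>v. \<nu> (\<omega>' v))) (at ?x)"
    by (rule bounded_linear.has_derivative[OF linear_conv_bounded_linear[THEN iffD1, OF \<nu>] \<omega>(2)])
  let ?f' = "\<lambda>v. (v, inverse (\<nu> (\<omega> ?x)) *\<^sub>R K (\<omega>' v)
      + (- (inverse (\<nu> (\<omega> ?x)) * \<nu> (\<omega>' v) * inverse (\<nu> (\<omega> ?x)))) *\<^sub>R K (\<omega> ?x))"
  have "((\<lambda>x. (x, inverse (\<nu> (\<omega> x)) *\<^sub>R K (\<omega> x))) has_derivative ?f') (at ?x)"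
    by (rule has_derivative_Pair[OF has_derivative_ident has_derivative_scaleR[OF Deriv.has_derivative_inverse[OF \<omega>(3) \<nu>'] K']])
  then have f': "(snd chart \<circ> s \<circ> chart_inv c has_derivative ?f') (at ?x)"
    by (rule has_derivative_transform_within_open[OF _ S]) (simp only: eq comp_apply)
  show ?thesis
    by (rule tangent_map_eq_coord_tvec[OF B.smooth_atlas_axioms c p X chart_mem_B _ S _ f'])
      (use eq[OF S(2)] eq c p in auto)
qed

end

section \<open>Orthonormal frames and the equation of the partial connection\<close>

locale frame_connection = connected_atlas A N nabla + proj_frame A B c w L K \<nu>
  for A :: "('p, real^'n::finite) chart set" and N nabla
    and B :: "('p \<times> ('p, real^'n) covec set, (real^'n) \<times> 'f::euclidean_space) chart set"
    and c w L K \<nu> +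
  assumes norm_w: "w \<bullet> w = 1" and w_L: "w \<bullet> L y = 0" and L_L: "L y \<bullet> L z = y \<bullet> z"
begin

abbreviation G where "G \<equiv> christoffel A nabla c"

text \<open>Parametrizes the kernel of \<open>w + L y\<close> by the model space of the fibre; the
  correction along \<open>w\<close> cancels the pairing of \<open>L y\<close> with
  \<open>L g\<close>.\<close>

definition tangent_frame :: "'f \<Rightarrow> 'f \<Rightarrow> real^'n" where
  "tangent_frame y g = L g - (y \<bullet> g) *\<^sub>R w"

lemma \<nu>_eq: "\<nu> \<sigma> = \<sigma> \<bullet> w"
proof -
  have "\<sigma> \<bullet> w = (\<nu> \<sigma> *\<^sub>R w + L (K \<sigma>)) \<bullet> w" using split[of \<sigma>] by simp
  then show ?thesis by (simp add: inner_add_left norm_w w_L inner_commute[of "L _"])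
qed

lemma K_eq: "K \<sigma> \<bullet> g = \<sigma> \<bullet> L g"
proof -
  have "\<sigma> \<bullet> L g = (\<nu> \<sigma> *\<^sub>R w + L (K \<sigma>)) \<bullet> L g" using split[of \<sigma>] by simp
  then show ?thesis by (simp add: inner_add_left w_L L_L)
qed

lemma frame_tangent: "(w + L y) \<bullet> tangent_frame y g = 0"
  by (simp add: tangent_frame_def inner_add_left inner_diff_right norm_w w_L L_L inner_commute[of "L _" w])

text \<open>The derivative of a parallel covector scales with \<open>t\<close>, so the factor
  cancels and the lift depends on the line alone. The two terms of the quotient rule combine into
  the pairing with \<open>tangent_frame y g\<close>.\<close>

lemma horizontal_lift_coordinates:
  assumes t: "t \<noteq> 0" and \<omega>': "\<And>e. \<omega>' \<bullet> e = t * ((w + L y) \<bullet> G x a e)"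
  shows "(inverse (\<nu> (t *\<^sub>R (w + L y))) *\<^sub>R K \<omega>' + (- (inverse (\<nu> (t *\<^sub>R (w + L y))) * \<nu> \<omega>' *
      inverse (\<nu> (t *\<^sub>R (w + L y))))) *\<^sub>R K (t *\<^sub>R (w + L y))) \<bullet> g
    = (w + L y) \<bullet> G x a (tangent_frame y g)"
proof -
  define u where "u = w + L y"
  have u: "\<nu> (t *\<^sub>R u) = t" "K (t *\<^sub>R u) = t *\<^sub>R y"
    by (simp_all only: u_def linear_scale[OF \<nu>] linear_scale[OF K] frame_simps) simp
  have "(inverse t *\<^sub>R K \<omega>' + (- (inverse t * \<nu> \<omega>' * inverse t)) *\<^sub>R t *\<^sub>R y) \<bullet> g
      = inverse t * (t * (u \<bullet> G x a (L g))) - inverse t * (t * (u \<bullet> G x a w)) * inverse t * t * (y \<bullet> g)"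
    by (simp add: inner_add_left inner_diff_left K_eq \<nu>_eq \<omega>' u_def[symmetric])
  also have "\<dots> = u \<bullet> G x a (L g) - (y \<bullet> g) * (u \<bullet> G x a w)" using t by (simp add: field_simps)
  also have "\<dots> = u \<bullet> G x a (tangent_frame y g)"
    by (simp add: tangent_frame_def christoffel_linear_simps inner_diff_right)
  finally show ?thesis unfolding u_def[symmetric] u .
qed

text \<open>\<open>horizontal_distribution\<close> quantifies over local sections that are parallel
  at the point. Testing with constant coordinate fields determines the derivative of any such
  section along the vector, and an affine section realizes each vector permitted by the
  equation.\<close>

lemma HL_iff:
  assumes q: "q \<in> fst chart" and y: "y = snd (snd chart q)" and x: "x = fst (snd chart q)"
  shows "\<xi> \<in> HL N A B nabla q \<longleftrightarrow> \<xi> \<in> tangent_space B q \<and> (w + L y) \<bullet> fst (\<xi> chart) = 0 \<and>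
    (\<forall>g. snd (\<xi> chart) \<bullet> g = (w + L y) \<bullet> G x (fst (\<xi> chart)) (tangent_frame y g))"
    (is "_ \<longleftrightarrow> ?R")
proof
  define p where "p = fst q"
  have p: "p \<in> fst c" "x = snd c p" "snd q = covec_line (coord_covec A c p (w + L y))"
    using chart_coords[OF q] unfolding p_def x y by auto
  {
    assume \<xi>: "\<xi> \<in> HL N A B nabla q"
    then have hor: "\<xi> \<in> horizontal_distribution N A B nabla q" and con: "\<xi> \<in> contact_distribution A B q"
      by (auto simp: HL_def)
    have T: "\<xi> \<in> tangent_space B q" using con by (simp add: contact_distribution_def)
    from hor[unfolded horizontal_distribution_def Let_def p_def[symmetric] mem_Collect_eq]
    obtain U \<sigma> X where U: "opn U" "p \<in> U"
      and \<sigma>: "\<sigma> \<in> one_forms A U" "covec_line (\<sigma> p) = snd q" and X: "X \<in> vector_fields A U"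
      and par: "\<forall>V. opn V \<and> p \<in> V \<and> V \<subseteq> U \<longrightarrow> (\<forall>Y\<in>vector_fields A V.
              dual_nabla A nabla V (restrict_field V X) (restrict_field V \<sigma>) Y p = 0)"
      and \<xi>_eq: "\<xi> = tangent_map A B (\<lambda>p'. (p', covec_line (\<sigma> p'))) p (X p)"
      by (elim exE conjE) (rule that; assumption)
    \<comment> \<open>The section lives on an arbitrary \<open>U\<close>; the parallel condition is
      posed on all smaller neighbourhoods, so it can be used inside the chart.\<close>
    define V where "V = U \<inter> fst c"
    have V: "opn V" "V \<subseteq> fst c" "V \<subseteq> U" "p \<in> V"
      using openin_Int[OF U(1) opn_chart[OF c]] U(2) p(1) by (auto simp: V_def)
    obtain \<omega> where \<omega>: "smooth_on \<omega> (snd c ` V)" "\<forall>p\<in>V. \<sigma> p = coord_covec A c p (\<omega> (snd c p))"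
      using one_form_components[OF \<sigma>(1) U(1) c] unfolding V_def by blast
    have open_V: "open (snd c ` V)" using open_chart_image[OF V(1) c] V(2) by (simp add: Int_absorb2)
    let ?\<omega>' = "frechet_derivative \<omega> (at (snd c p))"
    have \<omega>': "(\<omega> has_derivative ?\<omega>') (at (snd c p))"
      by (rule smooth_on_has_derivative[OF \<omega>(1)]) (use V(4) in blast)
    have "covec_line (coord_covec A c p (w + L y)) = covec_line (coord_covec A c p (\<omega> x))"
      using \<sigma>(2) \<omega>(2) V(4) p by simp
    then obtain t where t: "t \<noteq> 0" "\<omega> x = t *\<^sub>R (w + L y)"
      using covec_line_eq_iff[OF c p(1) frame_nonzero] by blast
    let ?a = "X p c"
    have Xp: "X p \<in> tangent_space A p" by (rule vector_fields_tangent[OF X U(2)])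
    have dual: "?\<omega>' ?a \<bullet> e = t * ((w + L y) \<bullet> G x ?a e)" for e
    proof -
      let ?Y = "restrict_field V (\<lambda>p. coord_tvec A c p e)"
      have Y: "?Y \<in> vector_fields A V"
        by (rule smooth_vector_field[where \<xi>="\<lambda>_. e", OF c V(1,2) smooth_on_const[OF open_V]])
      have "dual_nabla A nabla V (restrict_field V X) (restrict_field V \<sigma>) ?Y p =
          ?\<omega>' (restrict_field V X p c) \<bullet> ?Y p c - \<omega> (snd c p) \<bullet> G (snd c p) (restrict_field V X p c) (?Y p c)"
        by (rule dual_nabla_coordinates[OF c V(1,2) restrict_vector_field[OF X V(1,3)] Y V(4) _ \<omega>'])
          (use \<omega>(2) in \<open>simp add: restrict_field_def\<close>)
      moreover have "dual_nabla A nabla V (restrict_field V X) (restrict_field V \<sigma>) ?Y p = 0"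
        using par V Y by blast
      ultimately show ?thesis
        using V(4) p c t(2) by (simp add: restrict_field_def)
    qed
    have \<xi>_coord: "\<xi> = coord_tvec B chart (p, covec_line (\<sigma> p))
      (X p c, inverse (\<nu> (\<omega> (snd c p))) *\<^sub>R K (?\<omega>' (X p c))
      + (- (inverse (\<nu> (\<omega> (snd c p))) * \<nu> (?\<omega>' (X p c)) * inverse (\<nu> (\<omega> (snd c p))))) *\<^sub>R K (\<omega> (snd c p)))"
      unfolding \<xi>_eq
    proof (rule section_derivative[OF open_V V(2,4) _ smooth_on_continuous[OF \<omega>(1)] \<omega>' _ Xp])
      show "(p', covec_line (\<sigma> p')) = (p', covec_line (coord_covec A c p' (\<omega> (snd c p'))))" if "p' \<in> V" for p'
        using \<omega>(2) that by simp
      show "\<nu> (\<omega> (snd c p)) \<noteq> 0" using t p(2) by (simp only: linear_scale[OF \<nu>] frame_simps) simp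
    qed
    have "(p, covec_line (\<sigma> p)) = q" using \<sigma>(2) by (simp add: p_def)
    then have "\<xi> chart = (X p c, inverse (\<nu> (\<omega> x)) *\<^sub>R K (?\<omega>' ?a)
      + (- (inverse (\<nu> (\<omega> x)) * \<nu> (?\<omega>' ?a) * inverse (\<nu> (\<omega> x)))) *\<^sub>R K (\<omega> x))"
      using B.coord_tvec_self[OF chart_mem_B q] unfolding \<xi>_coord p(2) by simp
    then have "snd (\<xi> chart) \<bullet> g = (w + L y) \<bullet> G x (fst (\<xi> chart)) (tangent_frame y g)" for g
      unfolding t(2) using horizontal_lift_coordinates[OF t(1) dual] by simp
    then show ?R using T con contact_iff[OF q T] unfolding y by blast
  }
  {
    assume R: ?R
    then have T: "\<xi> \<in> tangent_space B q" by blast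
    define a where "a = fst (\<xi> chart)"
    \<comment> \<open>The derivative that the parallel condition prescribes at \<open>x\<close>,
      turned into a vector by its pairings with the basis; \<omega> is the affine map with this
      derivative and the value \<open>w + L y\<close> at \<open>x\<close>.\<close>
    let ?\<omega>' = "\<lambda>v. \<Sum>b\<in>Basis. ((w + L y) \<bullet> G x v b) *\<^sub>R b"
    define \<omega> where "\<omega> x' = (w + L y) + ?\<omega>' (x' - x)" for x'
    have \<omega>'_inner: "?\<omega>' v \<bullet> e = (w + L y) \<bullet> G x v e" for v e
    proof -
      have "?\<omega>' v \<bullet> e = (\<Sum>b\<in>Basis. (e \<bullet> b) * ((w + L y) \<bullet> G x v b))"
        unfolding inner_sum_left inner_scaleR_left by (simp add: inner_commute mult.commute)
      also have "\<dots> = (w + L y) \<bullet> (\<Sum>b\<in>Basis. (e \<bullet> b) *\<^sub>R G x v b)"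
        unfolding inner_sum_right inner_scaleR_right ..
      also have "(\<Sum>b\<in>Basis. (e \<bullet> b) *\<^sub>R G x v b) = G x v e"
        using linear_sum[OF linear_christoffel(1), of A nabla c x v "\<lambda>b. (e \<bullet> b) *\<^sub>R b" Basis]
        by (simp add: christoffel_linear_simps euclidean_representation)
      finally show ?thesis .
    qed
    have lin: "linear ?\<omega>'"
      by (rule linearI) (simp_all add: christoffel_linear_simps inner_add_right scaleR_add_left sum.distrib scaleR_sum_right)
    have smooth: "smooth_on \<omega> UNIV"
      unfolding \<omega>_def using smooth_on_linear[OF lin open_UNIV smooth_on_diff[OF open_UNIV smooth_on_ident smooth_on_const]]
      by (intro smooth_on_add smooth_on_const) auto
    have \<omega>x: "\<omega> x = w + L y" using linear_0[OF lin] by (simp add: \<omega>_def)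
    have \<omega>': "(\<omega> has_derivative ?\<omega>') (at x)"
    proof -
      have "((\<lambda>x'. ?\<omega>' (x' - x)) has_derivative ?\<omega>') (at x)"
        by (rule bounded_linear.has_derivative[OF linear_conv_bounded_linear[THEN iffD1, OF lin]])
          (auto intro!: derivative_eq_intros)
      from has_derivative_add[OF has_derivative_const[of "w + L y"] this]
      show ?thesis unfolding \<omega>_def by simp
    qed
    \<comment> \<open>A nowhere vanishing section is demanded, so the zeros of the affine map are
      cut out.\<close>
    define U where "U = {p' \<in> fst c. snd c p' \<in> - (\<omega> -` {0})}"
    have "open (- (\<omega> -` {0}))"
      using smooth_on_continuous[OF smooth] by (intro open_Compl continuous_closed_vimage) (auto simp: continuous_on_eq_continuous_at)
    from openin_chart_preimage[OF c domain[OF c] this] have U: "opn U" unfolding U_def .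
    have U: "opn U" "U \<subseteq> fst c" "p \<in> U"
      using U p(1) \<omega>x[unfolded p(2)] frame_nonzero by (auto simp: U_def)
    have open_U: "open (snd c ` U)" using open_chart_image[OF U(1) c] U(2) by (simp add: Int_absorb2)
    define \<sigma> where "\<sigma> = restrict_field U (\<lambda>p. coord_covec A c p (\<omega> (snd c p)))"
    define X where "X = restrict_field U (\<lambda>p. coord_tvec A c p a)"
    have \<sigma>: "\<sigma> \<in> one_forms A U"
      unfolding \<sigma>_def by (rule smooth_one_form[OF c U(1,2) smooth_on_subset[OF smooth subset_UNIV]])
    have X: "X \<in> vector_fields A U"
      unfolding X_def by (rule smooth_vector_field[where \<xi>="\<lambda>_. a", OF c U(1,2) smooth_on_const[OF open_U]])
    have \<sigma>_eq: "\<sigma> p' = coord_covec A c p' (\<omega> (snd c p'))" if "p' \<in> U" for p'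
      using that by (simp add: \<sigma>_def restrict_field_def)
    have X_eq: "X p c = a" using U p c by (simp add: X_def restrict_field_def)
    have \<sigma>_nonzero: "\<sigma> p' \<noteq> (\<lambda>_. 0)" if "p' \<in> U" for p'
    proof
      assume "\<sigma> p' = (\<lambda>_. 0)"
      then have "coord_covec A c p' (\<omega> (snd c p')) = coord_covec A c p' 0"
        unfolding \<sigma>_eq[OF that] by (simp add: coord_covec_def cong: if_cong)
      then show False using coord_covec_inject[OF c] that U(2) by (auto simp: U_def)
    qed
    have par: "dual_nabla A nabla V (restrict_field V X) (restrict_field V \<sigma>) Y p = 0"
      if V: "opn V" "p \<in> V" "V \<subseteq> U" and Y: "Y \<in> vector_fields A V" for V Y
    proof -
      have \<omega>'p: "(\<omega> has_derivative ?\<omega>') (at (snd c p))" unfolding p(2)[symmetric] by (rule \<omega>')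
      have "V \<subseteq> fst c" using V(3) U(2) by blast
      then have "dual_nabla A nabla V (restrict_field V X) (restrict_field V \<sigma>) Y p =
          ?\<omega>' (restrict_field V X p c) \<bullet> Y p c - \<omega> (snd c p) \<bullet> G (snd c p) (restrict_field V X p c) (Y p c)"
        by (rule dual_nabla_coordinates[OF c V(1) _ restrict_vector_field[OF X V(1,3)] Y V(2) _ \<omega>'p])
          (use \<sigma>_eq V(3) in \<open>auto simp: restrict_field_def\<close>)
      then show ?thesis unfolding \<omega>'_inner p(2)[symmetric] \<omega>x by simp
    qed
    have \<sigma>p: "covec_line (\<sigma> p) = snd q" using \<sigma>_eq[OF U(3)] p \<omega>x by simp
    then have pq: "(p, covec_line (\<sigma> p)) = q" by (simp add: p_def)
    have Xp: "X p \<in> tangent_space A p" by (rule vector_fields_tangent[OF X U(3)])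
    have "tangent_map A B (\<lambda>p'. (p', covec_line (\<sigma> p'))) p (X p) = coord_tvec B chart (p, covec_line (\<sigma> p))
      (X p c, inverse (\<nu> (\<omega> (snd c p))) *\<^sub>R K (?\<omega>' (X p c))
      + (- (inverse (\<nu> (\<omega> (snd c p))) * \<nu> (?\<omega>' (X p c)) * inverse (\<nu> (\<omega> (snd c p))))) *\<^sub>R K (\<omega> (snd c p)))"
    proof (rule section_derivative[OF open_U U(2,3) _ continuous_on_subset[OF smooth_on_continuous[OF smooth] subset_UNIV] _ _ Xp])
      show "(p', covec_line (\<sigma> p')) = (p', covec_line (coord_covec A c p' (\<omega> (snd c p'))))" if "p' \<in> U" for p'
        using \<sigma>_eq that by simp
      show "(\<omega> has_derivative ?\<omega>') (at (snd c p))" unfolding p(2)[symmetric] by (rule \<omega>')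
      show "\<nu> (\<omega> (snd c p)) \<noteq> 0" using \<omega>x p(2) by simp
    qed
    also have "\<dots> = coord_tvec B chart q (a, snd (\<xi> chart))"
    proof -
      have "inverse (\<nu> (\<omega> x)) *\<^sub>R K (?\<omega>' a) + (- (inverse (\<nu> (\<omega> x)) * \<nu> (?\<omega>' a) * inverse (\<nu> (\<omega> x)))) *\<^sub>R K (\<omega> x) = snd (\<xi> chart)"
        (is "?l = _")
      proof -
        have "?l \<bullet> g = snd (\<xi> chart) \<bullet> g" for g
          using horizontal_lift_coordinates[of 1 "?\<omega>' a" y x a g] R
          unfolding \<omega>x a_def[symmetric] by (simp only: \<omega>'_inner scaleR_one mult_1)
        then show ?thesis by (rule vector_eq_rdot[THEN iffD1, OF allI])
      qed
      then show ?thesis unfolding pq X_eq p(2)[symmetric] by simp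
    qed
    also have "(a, snd (\<xi> chart)) = \<xi> chart" by (simp add: a_def)
    also have "coord_tvec B chart q (\<xi> chart) = \<xi>"
      using B.tangent_eq_coord_tvec[OF T chart_mem_B q] by simp
    finally have \<xi>_eq: "\<xi> = tangent_map A B (\<lambda>p'. (p', covec_line (\<sigma> p'))) p (X p)" ..
    have "\<xi> \<in> horizontal_distribution N A B nabla q"
      unfolding horizontal_distribution_def Let_def p_def[symmetric] mem_Collect_eq
      by (intro exI[of _ U] exI[of _ \<sigma>] exI[of _ X] conjI allI impI ballI; (elim conjE)?;
          (rule \<xi>_eq U(1) U(3) \<sigma> X \<sigma>p \<sigma>_nonzero par; assumption))
    moreover have "\<xi> \<in> contact_distribution A B q" using contact_iff[OF q T] R unfolding y by blast
    ultimately show "\<xi> \<in> HL N A B nabla q" by (simp add: HL_def)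
  }
qed

end

section \<open>Integral manifolds\<close>

lemma (in smooth_atlas) param_tangent_map_eq_coord_tvec:
  assumes "d \<in> A" "open S" "u \<in> S" "\<And>u. u \<in> S \<Longrightarrow> \<phi> u \<in> fst d"
    and f': "(snd d \<circ> \<phi> has_derivative f') (at u)"
  shows "param_tangent_map A \<phi> u h = coord_tvec A d (\<phi> u) (f' h)"
proof
  fix d'
  show "param_tangent_map A \<phi> u h d' = coord_tvec A d (\<phi> u) (f' h) d'"
  proof (cases "d' \<in> A \<and> \<phi> u \<in> fst d'")
    case True
    have "(snd d' \<circ> chart_inv d has_derivative transition_deriv d d' (\<phi> u)) (at ((snd d \<circ> \<phi>) u))"
      using transition_has_derivative[OF assms(1) _ assms(4)[OF assms(3)], of d'] True by simp
    from has_derivative_compose[OF f' this]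
    have "(snd d' \<circ> \<phi> has_derivative (\<lambda>h. transition_deriv d d' (\<phi> u) (f' h))) (at u)"
      by (rule has_derivative_transform_within_open[OF _ assms(2,3)]) (use assms(1,4) in simp)
    then show ?thesis
      using True by (simp add: param_tangent_map_def coord_tvec_def frechet_derivative_eq)
  next
    case False
    then show ?thesis by (auto simp: param_tangent_map_def coord_tvec_def)
  qed
qed

context connected_atlas
begin

abbreviation dG where
  "dG c x v a e \<equiv> frechet_derivative (\<lambda>x. christoffel A nabla c x a e) (at x) v"

lemma christoffel_expansion:
  "christoffel A nabla c x a e = (\<Sum>i\<in>UNIV. \<Sum>j\<in>UNIV.
     (a $ i * e $ j) *\<^sub>R christoffel A nabla c x (axis i 1) (axis j 1))"
  unfolding christoffel_axis unfolding christoffel_def ..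

text \<open>Product rule for a bilinear map whose coefficients depend on the point. It goes through
  components because \<open>dG\<close> differentiates with both vectors held fixed.\<close>

lemma christoffel_has_derivative:
  assumes c: "c \<in> A" and x: "X u \<in> snd c ` fst c"
    and X: "(X has_derivative X') (at u)" and a: "(a has_derivative a') (at u)" and e: "(e has_derivative e') (at u)"
  shows "((\<lambda>u. christoffel A nabla c (X u) (a u) (e u)) has_derivative
    (\<lambda>v. dG c (X u) (X' v) (a u) (e u) + christoffel A nabla c (X u) (a' v) (e u)
      + christoffel A nabla c (X u) (a u) (e' v))) (at u)"
proof -
  let ?\<Gamma> = "\<lambda>i j x. christoffel A nabla c x (axis i 1) (axis j 1)"
  let ?D = "\<lambda>i j. frechet_derivative (?\<Gamma> i j) (at (X u))"
  have D: "(?\<Gamma> i j has_derivative ?D i j) (at (X u))" for i j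
    by (rule smooth_on_has_derivative[OF smooth_christoffel[OF c] x])
  have dG_eq: "dG c (X u) v a e = (\<Sum>i\<in>UNIV. \<Sum>j\<in>UNIV. (a $ i * e $ j) *\<^sub>R ?D i j v)" for v a e
  proof -
    have "((\<lambda>x. \<Sum>i\<in>UNIV. \<Sum>j\<in>UNIV. (a $ i * e $ j) *\<^sub>R ?\<Gamma> i j x) has_derivative
        (\<lambda>v. \<Sum>i\<in>UNIV. \<Sum>j\<in>UNIV. (a $ i * e $ j) *\<^sub>R ?D i j v)) (at (X u))"
      by (intro has_derivative_sum has_derivative_scaleR_right D)
    from frechet_derivative_eq[OF this] show ?thesis
      by (simp only: christoffel_expansion[of c _ a e, symmetric])
  qed
  have \<Gamma>: "((\<lambda>u. ?\<Gamma> i j (X u)) has_derivative (\<lambda>v. ?D i j (X' v))) (at u)" for i j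
    by (rule has_derivative_compose[OF X D])
  have nth: "((\<lambda>u. a u $ i) has_derivative (\<lambda>v. a' v $ i)) (at u)" "((\<lambda>u. e u $ i) has_derivative (\<lambda>v. e' v $ i)) (at u)" for i
    using bounded_linear.has_derivative[OF bounded_linear_vec_nth a] bounded_linear.has_derivative[OF bounded_linear_vec_nth e]
    by blast+
  have "((\<lambda>u. \<Sum>i\<in>UNIV. \<Sum>j\<in>UNIV. (a u $ i * e u $ j) *\<^sub>R ?\<Gamma> i j (X u)) has_derivative
      (\<lambda>v. \<Sum>i\<in>UNIV. \<Sum>j\<in>UNIV. (a u $ i * e u $ j) *\<^sub>R ?D i j (X' v)
        + (a u $ i * e' v $ j + a' v $ i * e u $ j) *\<^sub>R ?\<Gamma> i j (X u))) (at u)"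
    by (intro has_derivative_sum has_derivative_scaleR has_derivative_mult \<Gamma> nth)
  moreover have "(\<lambda>v. \<Sum>i\<in>UNIV. \<Sum>j\<in>UNIV. (a u $ i * e u $ j) *\<^sub>R ?D i j (X' v)
        + (a u $ i * e' v $ j + a' v $ i * e u $ j) *\<^sub>R ?\<Gamma> i j (X u)) =
      (\<lambda>v. dG c (X u) (X' v) (a u) (e u) + christoffel A nabla c (X u) (a' v) (e u)
        + christoffel A nabla c (X u) (a u) (e' v))"
    unfolding dG_eq[of "a u" "e u"] christoffel_expansion[of c _ "a' _"] christoffel_expansion[of c _ _ "e' _"]
    by (simp add: scaleR_add_left sum.distrib add_ac)
  ultimately show ?thesis
    unfolding christoffel_expansion[of c _ "a _" "e _"] by simp
qed

lemma smooth_on_christoffel_comp: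
  fixes X a e :: "'u::euclidean_space \<Rightarrow> real^'n"
  assumes "c \<in> A" "open S" "X ` S \<subseteq> snd c ` fst c" "smooth_on X S" "smooth_on a S" "smooth_on e S"
  shows "smooth_on (\<lambda>u. christoffel A nabla c (X u) (a u) (e u)) S"
proof -
  have "smooth_on (\<lambda>u. (\<lambda>x. christoffel A nabla c x (axis i 1) (axis j 1)) (X u)) S" for i j
    by (rule smooth_on_compose[OF assms(2) open_chart[OF assms(1)] smooth_christoffel[OF assms(1)] assms(4,3)])
  then have "smooth_on (\<lambda>u. \<Sum>i\<in>UNIV. \<Sum>j\<in>UNIV. (a u $ i * e u $ j) *\<^sub>R
      christoffel A nabla c (X u) (axis i 1) (axis j 1)) S"
    by (intro smooth_on_sum[OF assms(2)] smooth_on_scaleR[OF assms(2)] smooth_on_mult[OF assms(2)]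
        smooth_on_vec_nth[OF assms(2)] assms(5,6))
  then show ?thesis by (subst christoffel_expansion)
qed

end

definition contact_flat ::
  "('p, real^'n::finite) chart set \<Rightarrow> ('p, real^'n) connection \<Rightarrow> bool" where
  "contact_flat A nabla \<longleftrightarrow> (\<forall>c\<in>A. \<forall>x\<in>snd c ` fst c. \<forall>\<omega> a b e.
     \<omega> \<bullet> a = 0 \<and> \<omega> \<bullet> b = 0 \<and> \<omega> \<bullet> e = 0 \<longrightarrow> \<omega> \<bullet> riemann A nabla c x a b e = 0)"

lemma (in connected_atlas) weyl_vanishes_iff_contact_flat:
  assumes "CARD('n) \<ge> 3"
  shows "weyl_curvature_vanishes A nabla \<longleftrightarrow> contact_flat A nabla"
proof -
  have "(\<forall>a b i d. weyl_curvature A nabla c p a b i d = 0) \<longleftrightarrow>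
      (\<forall>\<omega> a b e. \<omega> \<bullet> a = 0 \<and> \<omega> \<bullet> b = 0 \<and> \<omega> \<bullet> e = 0 \<longrightarrow> \<omega> \<bullet> riemann A nabla c (snd c p) a b e = 0)"
    if c: "c \<in> A" "p \<in> fst c" for c p
  proof -
    note comp = curvature_comp_riemann[OF c]
    have x: "snd c p \<in> snd c ` fst c" using c by blast
    have anti: "curvature_comp A nabla c p a b i d = - curvature_comp A nabla c p b a i d" for a b i d
      unfolding comp using riemann_antisym[of A nabla c "snd c p" "axis a 1" "axis b 1"] by simp
    show ?thesis
      unfolding weyl_curvature_zero_iff[OF assms anti] comp
      by (rule pure_trace_iff_contact_flat[OF assms linear_riemann[OF c(1) x] riemann_antisym])
  qed
  then show ?thesis unfolding weyl_curvature_vanishes_def contact_flat_def by auto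
qed

section \<open>The horizontal lift and its derivative\<close>

context frame_connection
begin

lemma K_tangent_frame: "K (tangent_frame y h) = h"
  using K_coord[of "- (y \<bullet> h)" h] by (simp add: tangent_frame_def add.commute)

text \<open>Together with \<open>K_tangent_frame\<close> this makes \<open>K\<close> and
  \<open>tangent_frame y\<close> mutually inverse between the kernel of \<open>w + L y\<close> and
  the model space, so every vector of the kernel is available as a test vector.\<close>

lemma tangent_frame_K:
  assumes "(w + L y) \<bullet> a = 0"
  shows "tangent_frame y (K a) = a"
proof -
  have "y \<bullet> K a = a \<bullet> L y" using K_eq[of a y] by (simp add: inner_commute)
  also have "\<dots> = - (a \<bullet> w)"
  proof -
    have "a \<bullet> w + a \<bullet> L y = 0" using assms by (simp add: inner_add_right inner_commute)
    then show ?thesis by linarith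
  qed
  finally have "tangent_frame y (K a) = L (K a) + \<nu> a *\<^sub>R w" by (simp add: tangent_frame_def \<nu>_eq)
  also have "\<dots> = a" using split[of a] by (simp add: add.commute)
  finally show ?thesis .
qed

text \<open>The derivative of the horizontal lift of a fixed \<open>a\<close> in the direction of the vector with base
  component \<open>b\<close> and fibre component \<open>\<beta>\<close>.\<close>

definition lift_deriv :: "real^'n \<Rightarrow> 'f \<Rightarrow> real^'n \<Rightarrow> real^'n \<Rightarrow> 'f \<Rightarrow> 'f \<Rightarrow> real" where
  "lift_deriv x y a b \<beta> g = L \<beta> \<bullet> G x a (tangent_frame y g)
    + (w + L y) \<bullet> (dG c x b a (tangent_frame y g) + G x a (- (\<beta> \<bullet> g) *\<^sub>R w))"

text \<open>The term with \<open>a'\<close> is kept apart: on an integral manifold it contains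
  second derivatives of the base map and cancels by their symmetry.\<close>

lemma lift_has_derivative:
  assumes x: "X u \<in> snd c ` fst c"
    and X: "(X has_derivative X') (at u)" and Y: "(Y has_derivative Y') (at u)" and a: "(a has_derivative a') (at u)"
  shows "((\<lambda>u. (w + L (Y u)) \<bullet> G (X u) (a u) (tangent_frame (Y u) g)) has_derivative
    (\<lambda>v. lift_deriv (X u) (Y u) (a u) (X' v) (Y' v) g
      + (w + L (Y u)) \<bullet> G (X u) (a' v) (tangent_frame (Y u) g))) (at u)"
proof -
  have LY: "((\<lambda>u. w + L (Y u)) has_derivative (\<lambda>v. L (Y' v))) (at u)"
    using has_derivative_add[OF has_derivative_const[of w]
        bounded_linear.has_derivative[OF linear_conv_bounded_linear[THEN iffD1, OF L(1)] Y]] by simp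
  have frame: "((\<lambda>u. tangent_frame (Y u) g) has_derivative (\<lambda>v. - (Y' v \<bullet> g) *\<^sub>R w)) (at u)"
    using has_derivative_diff[OF has_derivative_const[of "L g"]
        has_derivative_scaleR_left[OF has_derivative_inner_left[OF Y, of g], of w]]
    unfolding tangent_frame_def by simp
  from has_derivative_inner[OF LY christoffel_has_derivative[OF c x X a frame]]
  show ?thesis by (rule has_derivative_eq_rhs) (auto simp: lift_deriv_def inner_add_right)
qed

text \<open>Differentiating the covector and the frame produces products such as
  \<open>(\<omega> \<bullet> G x a e) * (\<omega> \<bullet> G x b w)\<close>, whose sum is symmetric
  in \<open>a\<close> and \<open>b\<close> and drops out. What is left is the coordinate formula of
  the curvature, with arguments in the order \<open>b\<close>, \<open>a\<close>.\<close>

lemma lift_bracket: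
  assumes \<alpha>: "\<And>g. \<alpha> \<bullet> g = (w + L y) \<bullet> G x a (tangent_frame y g)"
    and \<beta>: "\<And>g. \<beta> \<bullet> g = (w + L y) \<bullet> G x b (tangent_frame y g)"
  shows "lift_deriv x y a b \<beta> g - lift_deriv x y b a \<alpha> g =
    (w + L y) \<bullet> riemann A nabla c x b a (tangent_frame y g)"
proof -
  define \<omega> where "\<omega> = w + L y"
  \<comment> \<open>Here \<sigma> need not lie in the kernel of \<omega>, to which the equation for
    \<gamma> refers. As \<open>L \<gamma>\<close> is orthogonal to \<open>w\<close>, it may be moved
    into the kernel along \<open>w\<close>.\<close>
  have LK: "L \<gamma> \<bullet> \<sigma> = \<omega> \<bullet> G x d \<sigma> - (\<omega> \<bullet> \<sigma>) * (\<omega> \<bullet> G x d w)"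
    if \<gamma>: "\<And>g. \<gamma> \<bullet> g = (w + L y) \<bullet> G x d (tangent_frame y g)" for \<gamma> d \<sigma>
  proof -
    have "L \<gamma> \<bullet> \<sigma> = \<gamma> \<bullet> K \<sigma>" using K_eq[of \<sigma> \<gamma>] by (simp add: inner_commute)
    also have "\<dots> = \<omega> \<bullet> G x d (tangent_frame y (K \<sigma>))" using \<gamma> by (simp add: \<omega>_def)
    also have "tangent_frame y (K \<sigma>) = \<sigma> - (\<omega> \<bullet> \<sigma>) *\<^sub>R w"
    proof -
      have "y \<bullet> K \<sigma> = \<sigma> \<bullet> L y" using K_eq[of \<sigma> y] by (simp add: inner_commute)
      then have "tangent_frame y (K \<sigma>) = L (K \<sigma>) - (\<sigma> \<bullet> L y) *\<^sub>R w" by (simp add: tangent_frame_def)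
      moreover have "L (K \<sigma>) = \<sigma> - \<nu> \<sigma> *\<^sub>R w" using split[of \<sigma>] by (simp add: algebra_simps)
      ultimately show ?thesis by (simp add: \<nu>_eq \<omega>_def inner_add_left inner_commute algebra_simps)
    qed
    finally show ?thesis by (simp add: christoffel_linear_simps inner_diff_right)
  qed
  define e where "e = tangent_frame y g"
  have "lift_deriv x y a b \<beta> g = \<omega> \<bullet> G x b (G x a e) - (\<omega> \<bullet> G x a e) * (\<omega> \<bullet> G x b w)
      + \<omega> \<bullet> dG c x b a e - (\<omega> \<bullet> G x b e) * (\<omega> \<bullet> G x a w)"
    unfolding lift_deriv_def LK[OF \<beta>] \<beta> \<omega>_def[symmetric] e_def[symmetric]
    by (simp add: christoffel_linear_simps inner_add_right del: scaleR_minus_left)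
  moreover have "lift_deriv x y b a \<alpha> g = \<omega> \<bullet> G x a (G x b e) - (\<omega> \<bullet> G x b e) * (\<omega> \<bullet> G x a w)
      + \<omega> \<bullet> dG c x a b e - (\<omega> \<bullet> G x a e) * (\<omega> \<bullet> G x b w)"
    unfolding lift_deriv_def LK[OF \<alpha>] \<alpha> \<omega>_def[symmetric] e_def[symmetric]
    by (simp add: christoffel_linear_simps inner_add_right del: scaleR_minus_left)
  ultimately show ?thesis
    unfolding riemann_def \<omega>_def[symmetric] e_def[symmetric]
    by (simp add: inner_add_right inner_diff_right algebra_simps)
qed

text \<open>The vector whose inner products with all \<open>g\<close> are the values required by
  \<open>HL_iff\<close>; see \<open>lift_inner\<close>.\<close>

definition lift :: "real^'n \<Rightarrow> 'f \<Rightarrow> real^'n \<Rightarrow> 'f" where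
  "lift x y a = (\<Sum>b\<in>Basis. ((w + L y) \<bullet> G x a (tangent_frame y b)) *\<^sub>R b)"

lemma linear_tangent_frame: "linear (tangent_frame y)"
  by (rule linearI)
    (simp_all add: tangent_frame_def linear_add[OF L(1)] linear_scale[OF L(1)] inner_add_right algebra_simps)

lemma lift_inner: "lift x y a \<bullet> g = (w + L y) \<bullet> G x a (tangent_frame y g)"
proof -
  have "linear (\<lambda>g. (w + L y) \<bullet> G x a (tangent_frame y g))"
    by (rule linearI) (simp_all add: christoffel_linear_simps linear_add[OF linear_tangent_frame]
        linear_scale[OF linear_tangent_frame] inner_add_right)
  from linear_sum[OF this, of "\<lambda>b. (g \<bullet> b) *\<^sub>R b" Basis] linear_scale[OF this]
  have "(w + L y) \<bullet> G x a (tangent_frame y g) = (\<Sum>b\<in>Basis. (g \<bullet> b) * ((w + L y) \<bullet> G x a (tangent_frame y b)))"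
    by (simp add: euclidean_representation)
  also have "\<dots> = lift x y a \<bullet> g"
    unfolding lift_def inner_sum_left inner_scaleR_left by (simp add: inner_commute mult.commute)
  finally show ?thesis ..
qed

lemma HL_coord_iff:
  assumes "x \<in> snd c ` fst c"
  shows "coord_tvec B chart (param (x, y)) (a, b) \<in> HL N A B nabla (param (x, y)) \<longleftrightarrow>
    (w + L y) \<bullet> a = 0 \<and> b = lift x y a"
proof -
  note q = param_mem[OF assms, of y]
  have "coord_tvec B chart (param (x, y)) (a, b) \<in> HL N A B nabla (param (x, y)) \<longleftrightarrow>
      (w + L y) \<bullet> a = 0 \<and> (\<forall>g. b \<bullet> g = lift x y a \<bullet> g)"
    unfolding HL_iff[OF q refl refl] chart_param[OF assms] lift_inner
    using B.coord_tvec_mem[OF chart_mem_B q] B.coord_tvec_self[OF chart_mem_B q] by simp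
  then show ?thesis unfolding vector_eq_rdot .
qed

section \<open>From integral manifolds to flatness\<close>

lemma integral_manifold_imp_flat:
  assumes imm: "injective_immersion (proj_cotangent N A) B S \<phi>"
    and tangent: "\<And>u. u \<in> S \<Longrightarrow> range (param_tangent_map B \<phi> u) = HL N A B nabla (\<phi> u)"
    and u0: "u0 \<in> S" "\<phi> u0 = param (x, y)" and x: "x \<in> snd c ` fst c"
    and ab: "(w + L y) \<bullet> a = 0" "(w + L y) \<bullet> b = 0" "(w + L y) \<bullet> e = 0"
  shows "(w + L y) \<bullet> riemann A nabla c x a b e = 0"
proof -
  \<comment> \<open>The immersion may leave the chart; only its open part inside the chart is
    differentiated.\<close>
  define T where "T = S \<inter> \<phi> -` fst chart"
  have T: "open T" "smooth_on (snd chart \<circ> \<phi>) T"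
    using imm chart_mem_B unfolding injective_immersion_def T_def by blast+
  have u0T: "u0 \<in> T" using u0 param_mem[OF x] by (simp add: T_def)
  define \<psi> where "\<psi> = snd chart \<circ> \<phi>"
  note \<psi> = T(2)[folded \<psi>_def]
  define X where "X u = fst (\<psi> u)" for u
  define Y where "Y u = snd (\<psi> u)" for u
  have smooth: "smooth_on X T" "smooth_on Y T"
    unfolding X_def[abs_def] Y_def[abs_def]
    by (rule smooth_on_fst[OF T(1) \<psi>], rule smooth_on_snd[OF T(1) \<psi>])
  let ?\<psi>' = "\<lambda>u. frechet_derivative \<psi> (at u)"
  let ?X' = "\<lambda>u. frechet_derivative X (at u)" and ?Y' = "\<lambda>u. frechet_derivative Y (at u)"
  have \<psi>': "?\<psi>' u h = (?X' u h, ?Y' u h)" if "u \<in> T" for u h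
    using frechet_derivative_eq[OF has_derivative_fst[OF smooth_on_has_derivative[OF \<psi> that]]]
      frechet_derivative_eq[OF has_derivative_snd[OF smooth_on_has_derivative[OF \<psi> that]]]
    unfolding X_def[abs_def] Y_def[abs_def] by simp
  have \<phi>_eq: "\<phi> u = param (X u, Y u)" "X u \<in> snd c ` fst c" if "u \<in> T" for u
    using chart_coords(4,5)[of "\<phi> u"] that by (auto simp: T_def X_def Y_def \<psi>_def)
  have tan: "param_tangent_map B \<phi> u h = coord_tvec B chart (param (X u, Y u)) (?X' u h, ?Y' u h)" if "u \<in> T" for u h
    using B.param_tangent_map_eq_coord_tvec[OF chart_mem_B T(1) that _
        smooth_on_has_derivative[OF \<psi> that, unfolded \<psi>_def], of h] \<phi>_eq(1)[OF that] \<psi>'[OF that]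
    by (simp add: T_def \<psi>_def)
  have Y'_eq: "?Y' u h = lift (X u) (Y u) (?X' u h)" if "u \<in> T" for u h
  proof -
    have "param_tangent_map B \<phi> u h \<in> HL N A B nabla (\<phi> u)"
      using tangent[of u] that by (auto simp: T_def)
    then show ?thesis
      unfolding tan[OF that] \<phi>_eq(1)[OF that] HL_coord_iff[OF \<phi>_eq(2)[OF that]] by blast
  qed
  have xy: "X u0 = x" "Y u0 = y" using u0(2) chart_param[OF x] by (simp_all add: X_def Y_def \<psi>_def)
  \<comment> \<open>The tangent space is the whole fibre of \<open>HL\<close>, so the base
    components of tangent vectors exhaust the kernel of the covector.\<close>
  have ex: "\<exists>h. ?X' u0 h = a" if "(w + L y) \<bullet> a = 0" for a
  proof -
    have "coord_tvec B chart (param (x, y)) (a, lift x y a) \<in> HL N A B nabla (\<phi> u0)"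
      unfolding u0(2) HL_coord_iff[OF x] using that by blast
    then obtain h where "coord_tvec B chart (param (x, y)) (a, lift x y a) = param_tangent_map B \<phi> u0 h"
      using tangent[OF u0(1)] by blast
    from fun_cong[OF this, of chart] have "(a, lift x y a) = (?X' u0 h, ?Y' u0 h)"
      unfolding tan[OF u0T] xy B.coord_tvec_self[OF chart_mem_B param_mem[OF x]] .
    then show ?thesis by blast
  qed
  obtain h k where h: "?X' u0 h = a" and k: "?X' u0 k = b" using ex ab(1,2) by blast
  define g where "g = K e"
  have e: "tangent_frame y g = e" using tangent_frame_K[OF ab(3)] by (simp add: g_def)
  \<comment> \<open>Derivative at \<open>u0\<close> of the identity \<open>Y'_eq\<close>, paired
    with a fixed \<open>g\<close>. The vector \<open>tangent_frame (Y u) g\<close> moves with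
    \<open>u\<close> and equals \<open>e\<close> at \<open>u0\<close>.\<close>
  have second: "frechet_derivative (\<lambda>u. ?Y' u h) (at u0) k \<bullet> g =
      lift_deriv x y (?X' u0 h) (?X' u0 k) (?Y' u0 k) g
      + (w + L y) \<bullet> G x (frechet_derivative (\<lambda>u. ?X' u h) (at u0) k) e" for h k
  proof -
    have "((\<lambda>u. ?X' u h) has_derivative frechet_derivative (\<lambda>u. ?X' u h) (at u0)) (at u0)"
      by (rule smooth_on_has_derivative[OF smooth_on_frechet_derivative[OF smooth(1)] u0T])
    from lift_has_derivative[OF \<phi>_eq(2)[OF u0T] smooth_on_has_derivative[OF smooth(1) u0T]
        smooth_on_has_derivative[OF smooth(2) u0T] this, of g]
    have d1: "((\<lambda>u. ?Y' u h \<bullet> g) has_derivative (\<lambda>v. lift_deriv x y (?X' u0 h) (?X' u0 v) (?Y' u0 v) g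
        + (w + L y) \<bullet> G x (frechet_derivative (\<lambda>u. ?X' u h) (at u0) v) e)) (at u0)"
      unfolding xy e
      by (rule has_derivative_transform_within_open[OF _ T(1) u0T]) (simp add: Y'_eq lift_inner)
    have d2: "((\<lambda>u. ?Y' u h \<bullet> g) has_derivative (\<lambda>v. frechet_derivative (\<lambda>u. ?Y' u h) (at u0) v \<bullet> g)) (at u0)"
      by (rule has_derivative_inner_left[OF smooth_on_has_derivative[OF smooth_on_frechet_derivative[OF smooth(2)] u0T]])
    show ?thesis by (rule fun_cong[OF has_derivative_unique[OF d2 d1], of k])
  qed
  \<comment> \<open>The second derivative of \<open>X\<close> need not lie in the kernel of the
    covector; its contribution disappears because it is the same for both orders of \<open>h\<close>
    and \<open>k\<close>.\<close>
  have "lift_deriv x y a b (?Y' u0 k) g = lift_deriv x y b a (?Y' u0 h) g"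
    using second[of h k] second[of k h]
      second_derivative_symmetric[OF T(1) smooth(1) u0T, of h k]
      second_derivative_symmetric[OF T(1) smooth(2) u0T, of h k] unfolding h k by simp
  moreover have "lift_deriv x y a b (?Y' u0 k) g - lift_deriv x y b a (?Y' u0 h) g = (w + L y) \<bullet> riemann A nabla c x b a e"
    using lift_bracket[of "?Y' u0 h" y x a "?Y' u0 k" b g] lift_inner
    unfolding Y'_eq[OF u0T] xy h k e by blast
  ultimately show ?thesis using riemann_antisym[of A nabla c x b a e] by simp
qed

section \<open>Construction of integral manifolds\<close>

lemma param_proj_cotangent:
  assumes "x \<in> snd c ` fst c"
  shows "param (x, y) \<in> proj_cotangent N A"
proof -
  have p: "chart_inv c x \<in> fst c" by (rule chart_inv_mem[OF assms subset_refl c])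
  have "coord_covec A c (chart_inv c x) (w + L y) \<noteq> (\<lambda>_. 0)"
  proof
    assume "coord_covec A c (chart_inv c x) (w + L y) = (\<lambda>_. 0)"
    then have "coord_covec A c (chart_inv c x) (w + L y) = coord_covec A c (chart_inv c x) 0"
      by (simp add: coord_covec_def cong: if_cong)
    then show False using coord_covec_inject[OF c p] frame_nonzero by blast
  qed
  then show ?thesis
    unfolding proj_cotangent_def param_eq using p domain[OF c] coord_covec_mem by blast
qed

lemma flat_imp_integral_manifold:
  assumes flat: "contact_flat A nabla" and x0: "x0 \<in> snd c ` fst c"
  shows "\<exists>(S :: 'f set) \<phi>. injective_immersion (proj_cotangent N A) B S \<phi> \<and> param (x0, 0) \<in> \<phi> ` S \<and>
    (\<forall>u\<in>S. range (param_tangent_map B \<phi> u) = HL N A B nabla (\<phi> u))"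
proof -
  \<comment> \<open>The independent variable \<open>z\<close> fixes the base point up to its
    component \<open>s\<close> along \<open>w\<close>; the unknown is \<open>q = (s, y)\<close>.
    \<open>P\<close> is the linear part of the resulting base position.\<close>
  define P :: "'f \<times> real \<times> 'f \<Rightarrow> real^'n" where "P p = L (fst p) + fst (snd p) *\<^sub>R w" for p
  define pos where "pos z q = x0 + P (z, q)" for z q
  \<comment> \<open>The first component makes the base velocity equal to
    \<open>tangent_frame (snd q) h\<close>, hence compatible with the contact distribution; the
    second is the horizontal lift of that velocity.\<close>
  define F where "F z q h = (- (snd q \<bullet> h), lift (pos z q) (snd q) (tangent_frame (snd q) h))" for z q h
  define W where "W = {p. pos (fst p) (snd p) \<in> snd c ` fst c}"
  have linP: "linear P"
    by (rule linearI) (simp_all add: P_def linear_add[OF L(1)] linear_scale[OF L(1)] algebra_simps)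
  have pos: "pos (fst p) (snd p) = x0 + P p" for p by (simp add: pos_def)
  have posD: "((\<lambda>p. pos (fst p) (snd p)) has_derivative P) (at p)" for p
    using has_derivative_add[OF has_derivative_const[of x0]
        linear_imp_has_derivative[OF linP]] unfolding pos by simp
  have pos_smooth: "smooth_on (\<lambda>p. pos (fst p) (snd p)) V" if "open V" for V
    unfolding pos by (rule smooth_on_add[OF that smooth_on_const[OF that] smooth_on_linear[OF linP that smooth_on_ident[OF that]]])
  have W: "open W"
    using continuous_open_preimage[OF smooth_on_continuous[OF pos_smooth[OF open_UNIV]] open_UNIV open_chart[OF c]]
    by (simp add: W_def vimage_def)
  have W0: "(0, 0, 0) \<in> W"
    using x0 by (simp add: W_def pos_def P_def linear_0[OF L(1)])
  have Y_smooth: "smooth_on (\<lambda>p. snd (snd p)) W"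
    by (rule smooth_on_snd[OF W smooth_on_snd[OF W smooth_on_ident[OF W]]])
  have frame_smooth: "smooth_on (\<lambda>p. tangent_frame (snd (snd p)) h) W" for h
    unfolding tangent_frame_def
    by (rule smooth_on_diff[OF W smooth_on_const[OF W] smooth_on_scaleR[OF W smooth_on_inner_left[OF W Y_smooth] smooth_on_const[OF W]]])
  have F_smooth: "smooth_on (\<lambda>p. F (fst p) (snd p) h) W" for h
  proof -
    have "smooth_on (\<lambda>p. w + L (snd (snd p))) W"
      by (rule smooth_on_add[OF W smooth_on_const[OF W] smooth_on_linear[OF L(1) W Y_smooth]])
    moreover have "smooth_on (\<lambda>p. G (pos (fst p) (snd p)) (tangent_frame (snd (snd p)) h) (tangent_frame (snd (snd p)) b)) W" for b
      by (rule smooth_on_christoffel_comp[OF c W _ pos_smooth[OF W] frame_smooth frame_smooth]) (auto simp: W_def)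
    ultimately have "smooth_on (\<lambda>p. lift (pos (fst p) (snd p)) (snd (snd p)) (tangent_frame (snd (snd p)) h)) W"
      unfolding lift_def
      by (intro smooth_on_sum[OF W]) (rule smooth_on_scaleR[OF W smooth_on_inner[OF W] smooth_on_const[OF W]])
    from smooth_on_Pair[OF W smooth_on_minus[OF W smooth_on_inner_left[OF W Y_smooth]] this]
    show ?thesis unfolding F_def .
  qed
  have lift_lin: "linear (lift x y)" for x y
    unfolding lift_def
    by (rule linearI) (simp_all add: christoffel_linear_simps inner_add_right scaleR_add_left sum.distrib scaleR_sum_right)
  have F_lin: "linear (F z q)" for z q
    by (rule linearI) (simp_all add: F_def linear_add[OF linear_tangent_frame] linear_scale[OF linear_tangent_frame]
        linear_add[OF lift_lin] linear_scale[OF lift_lin] inner_add_right)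
  have P_F: "P (k, F z q k) = tangent_frame (snd q) k" for z q k
    by (simp add: P_def F_def tangent_frame_def)
  have F_deriv: "frechet_derivative (\<lambda>p. F (fst p) (snd p) h) (at (z, q)) v =
      (- (snd (snd v) \<bullet> h), \<Sum>b\<in>Basis.
        (lift_deriv (pos z q) (snd q) (tangent_frame (snd q) h) (P v) (snd (snd v)) b
         + (w + L (snd q)) \<bullet> G (pos z q) (- (snd (snd v) \<bullet> h) *\<^sub>R w) (tangent_frame (snd q) b)) *\<^sub>R b)"
    if "(z, q) \<in> W" for z q h v
  proof -
    have Y': "((\<lambda>p. snd (snd p)) has_derivative (\<lambda>v. snd (snd v))) (at (z, q))"
      by (intro has_derivative_snd has_derivative_ident)
    have frame': "((\<lambda>p. tangent_frame (snd (snd p)) h) has_derivative (\<lambda>v. - (snd (snd v) \<bullet> h) *\<^sub>R w)) (at (z, q))"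
      using has_derivative_diff[OF has_derivative_const[of "L h"]
          has_derivative_scaleR_left[OF has_derivative_inner_left[OF Y', of h], of w]]
      unfolding tangent_frame_def by simp
    have x: "pos (fst (z, q)) (snd (z, q)) \<in> snd c ` fst c" using that by (simp add: W_def)
    note lift' = lift_has_derivative[where X="\<lambda>p. pos (fst p) (snd p)", OF x posD Y' frame']
    have "((\<lambda>p. F (fst p) (snd p) h) has_derivative (\<lambda>v. (- (snd (snd v) \<bullet> h), \<Sum>b\<in>Basis.
        (lift_deriv (pos z q) (snd q) (tangent_frame (snd q) h) (P v) (snd (snd v)) b
         + (w + L (snd q)) \<bullet> G (pos z q) (- (snd (snd v) \<bullet> h) *\<^sub>R w) (tangent_frame (snd q) b)) *\<^sub>R b))) (at (z, q))"
      unfolding F_def lift_def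
      by (intro has_derivative_Pair has_derivative_minus has_derivative_inner_left[OF Y'] has_derivative_sum
          has_derivative_scaleR_left lift'[unfolded fst_conv snd_conv])
    from frechet_derivative_eq[OF this] show ?thesis by simp
  qed
  \<comment> \<open>The first component needs the symmetry of the lift, a consequence of
    \<open>christoffel_symmetric\<close>. The same symmetry matches the terms along \<open>w\<close>
    in the second component; the others agree by \<open>lift_bracket\<close>, whose curvature term
    vanishes by flatness.\<close>
  have integ: "frechet_derivative (\<lambda>p. F (fst p) (snd p) h) (at (z, q)) (k, F z q k) =
      frechet_derivative (\<lambda>p. F (fst p) (snd p) k) (at (z, q)) (h, F z q h)" if zq: "(z, q) \<in> W" for z q h k
  proof -
    define x where "x = pos z q"
    define y where "y = snd q"
    have x: "x \<in> snd c ` fst c" using zq by (simp add: W_def x_def)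
    have sym: "lift x y (tangent_frame y k) \<bullet> h = lift x y (tangent_frame y h) \<bullet> k" for h k
      unfolding lift_inner using christoffel_symmetric[OF c x] by simp
    have "lift_deriv x y (tangent_frame y h) (tangent_frame y k) (lift x y (tangent_frame y k)) b =
        lift_deriv x y (tangent_frame y k) (tangent_frame y h) (lift x y (tangent_frame y h)) b" for b
    proof -
      have "(w + L y) \<bullet> riemann A nabla c x (tangent_frame y k) (tangent_frame y h) (tangent_frame y b) = 0"
        using flat c x frame_tangent unfolding contact_flat_def by blast
      then show ?thesis
        using lift_bracket[OF lift_inner lift_inner, of x y "tangent_frame y h" "tangent_frame y k" b] by simp
    qed
    then show ?thesis
      unfolding F_deriv[OF zq] P_F using sym[of k h]
      by (simp add: F_def flip: x_def y_def)
  qed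
  obtain r f where r: "r > 0" and f: "f 0 = (0, 0)"
    "\<And>z. z \<in> ball 0 r \<Longrightarrow> (z, f z) \<in> W" "\<And>z. z \<in> ball 0 r \<Longrightarrow> (f has_derivative F z (f z)) (at z)"
    using frobenius_graph[where F=F, OF W W0 F_smooth F_lin integ] by blast
  let ?S = "ball (0::'f) r"
  have f_smooth: "smooth_on f ?S"
    by (rule smooth_on_integral_curve[OF open_ball W f(2) F_smooth f(3)])
  define X where "X z = pos z (f z)" for z
  define Y where "Y z = snd (f z)" for z
  define \<phi> where "\<phi> z = param (X z, Y z)" for z
  have X_in: "X z \<in> snd c ` fst c" if "z \<in> ?S" for z
    using f(2)[OF that] by (simp add: W_def X_def)
  have zf: "((\<lambda>z. (z, f z)) has_derivative (\<lambda>h. (h, F z (f z) h))) (at z)" if "z \<in> ?S" for z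
    by (rule has_derivative_Pair[OF has_derivative_ident f(3)[OF that]])
  have X': "(X has_derivative tangent_frame (Y z)) (at z)" if "z \<in> ?S" for z
    using has_derivative_compose[OF zf[OF that] posD] unfolding fst_conv snd_conv P_F X_def[abs_def] Y_def .
  have Y': "(Y has_derivative (\<lambda>h. lift (X z) (Y z) (tangent_frame (Y z) h))) (at z)" if "z \<in> ?S" for z
    using has_derivative_snd[OF f(3)[OF that]] unfolding F_def snd_conv X_def Y_def[abs_def] .
  define \<psi> where "\<psi> z = (X z, Y z)" for z
  have \<psi>_smooth: "smooth_on \<psi> ?S"
  proof -
    have "smooth_on (\<lambda>z. (\<lambda>p. pos (fst p) (snd p)) (z, f z)) ?S"
      by (rule smooth_on_compose[OF open_ball open_UNIV pos_smooth[OF open_UNIV]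
        smooth_on_Pair[OF open_ball smooth_on_ident[OF open_ball] f_smooth]]) simp
    then show ?thesis unfolding \<psi>_def[abs_def] X_def Y_def
      using smooth_on_Pair[OF open_ball _ smooth_on_snd[OF open_ball f_smooth]] by simp
  qed
  have \<psi>': "(\<psi> has_derivative (\<lambda>h. (tangent_frame (Y z) h, lift (X z) (Y z) (tangent_frame (Y z) h)))) (at z)"
    if "z \<in> ?S" for z
    unfolding \<psi>_def by (rule has_derivative_Pair[OF X'[OF that] Y'[OF that]])
  have \<phi>_chart: "\<phi> z \<in> fst chart" "snd chart (\<phi> z) = \<psi> z" if "z \<in> ?S" for z
    using param_mem[OF X_in[OF that]] chart_param[OF X_in[OF that]] by (simp_all add: \<phi>_def \<psi>_def)
  have tan: "param_tangent_map B \<phi> z h =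
      coord_tvec B chart (\<phi> z) (tangent_frame (Y z) h, lift (X z) (Y z) (tangent_frame (Y z) h))" if z: "z \<in> ?S" for z h
  proof (rule B.param_tangent_map_eq_coord_tvec[OF chart_mem_B open_ball z \<phi>_chart(1)])
    show "(snd chart \<circ> \<phi> has_derivative (\<lambda>h. (tangent_frame (Y z) h, lift (X z) (Y z) (tangent_frame (Y z) h)))) (at z)"
      by (rule has_derivative_transform_within_open[OF \<psi>'[OF z] open_ball z]) (simp add: \<phi>_chart)
  qed
  have "injective_immersion (proj_cotangent N A) B ?S \<phi>"
    unfolding injective_immersion_def
  proof (intro conjI ballI)
    show "open ?S" by (rule open_ball)
    show "\<phi> ` ?S \<subseteq> proj_cotangent N A"
      using param_proj_cotangent X_in by (auto simp: \<phi>_def)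
    show "inj_on \<phi> ?S"
    proof (rule inj_onI)
      fix z z' assume z: "z \<in> ?S" "z' \<in> ?S" "\<phi> z = \<phi> z'"
      have "X z = X z'" using \<phi>_chart(2)[OF z(1)] \<phi>_chart(2)[OF z(2)] z(3) by (simp add: \<psi>_def)
      \<comment> \<open>The graph property: \<open>K\<close> projects the base position back to the
        parameter.\<close>
      moreover have "K (X z - x0) = z" for z
        using K_coord[of "fst (f z)" z] by (simp add: X_def pos_def P_def add.commute)
      ultimately show "z = z'" by metis
    qed
    fix d assume d: "d \<in> B"
    \<comment> \<open>An immersion is tested in all bundle charts \<open>d\<close>; each is reached
      through its overlap with the one chart that contains the image.\<close>
    let ?O = "snd chart ` (fst chart \<inter> fst d)"
    have eq: "?S \<inter> \<phi> -` fst d = ?S \<inter> \<psi> -` ?O"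
    proof (intro equalityI subsetI)
      fix z assume "z \<in> ?S \<inter> \<phi> -` fst d"
      then show "z \<in> ?S \<inter> \<psi> -` ?O" using \<phi>_chart[of z] by (metis IntD1 IntD2 IntI imageI vimageD vimageI2)
    next
      fix z assume "z \<in> ?S \<inter> \<psi> -` ?O"
      then have z: "z \<in> ?S" "\<psi> z \<in> ?O" by auto
      then have "chart_inv chart (\<psi> z) \<in> fst chart \<inter> fst d"
        using B.chart_inv_mem[OF z(2) _ chart_mem_B] by blast
      moreover have "chart_inv chart (\<psi> z) = \<phi> z"
        using B.chart_inv_left[OF chart_mem_B \<phi>_chart(1)[OF z(1)]] \<phi>_chart(2)[OF z(1)] by simp
      ultimately show "z \<in> ?S \<inter> \<phi> -` fst d" using z(1) by auto
    qed
    show op: "open (?S \<inter> \<phi> -` fst d)"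
      unfolding eq by (rule continuous_open_preimage[OF smooth_on_continuous[OF \<psi>_smooth] open_ball B.open_overlap[OF chart_mem_B d]])
    have "smooth_on (\<lambda>z. (snd d \<circ> chart_inv chart) (\<psi> z)) (?S \<inter> \<phi> -` fst d)"
      by (rule smooth_on_compose[OF op B.open_overlap[OF chart_mem_B d] B.smooth_transition[OF chart_mem_B d]
          smooth_on_subset[OF \<psi>_smooth]]) (use eq in auto)
    then show "smooth_on (snd d \<circ> \<phi>) (?S \<inter> \<phi> -` fst d)"
    proof (rule smooth_on_cong[THEN iffD1, OF op, rotated])
      fix z assume "z \<in> ?S \<inter> \<phi> -` fst d"
      then have z: "z \<in> ?S" by blast
      show "(snd d \<circ> chart_inv chart) (\<psi> z) = (snd d \<circ> \<phi>) z"
        using B.chart_inv_left[OF chart_mem_B \<phi>_chart(1)[OF z]] \<phi>_chart(2)[OF z] by simp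
    qed
  next
    fix z assume z: "z \<in> ?S"
    show "inj (param_tangent_map B \<phi> z)"
    proof (rule injI)
      fix h k assume "param_tangent_map B \<phi> z h = param_tangent_map B \<phi> z k"
      from fun_cong[OF this, of chart] have "tangent_frame (Y z) h = tangent_frame (Y z) k"
        unfolding tan[OF z] B.coord_tvec_self[OF chart_mem_B \<phi>_chart(1)[OF z]] by simp
      then show "h = k" using K_tangent_frame by metis
    qed
  qed
  moreover have "param (x0, 0) \<in> \<phi> ` ?S"
  proof (rule image_eqI)
    show "param (x0, 0) = \<phi> 0" by (simp add: \<phi>_def X_def Y_def f(1) pos_def P_def linear_0[OF L(1)])
  qed (use r in simp)
  moreover have "range (param_tangent_map B \<phi> z) = HL N A B nabla (\<phi> z)" if z: "z \<in> ?S" for z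
  proof (intro equalityI subsetI)
    fix \<xi> assume "\<xi> \<in> range (param_tangent_map B \<phi> z)"
    then obtain h where "\<xi> = param_tangent_map B \<phi> z h" by blast
    then show "\<xi> \<in> HL N A B nabla (\<phi> z)"
      unfolding tan[OF z] \<phi>_def using HL_coord_iff[OF X_in[OF z]] frame_tangent by simp
  next
    fix \<xi> assume \<xi>: "\<xi> \<in> HL N A B nabla (\<phi> z)"
    then have "\<xi> \<in> tangent_space B (\<phi> z)"
      using HL_iff[OF \<phi>_chart(1)[OF z] refl refl] by blast
    then have \<xi>_eq: "\<xi> = coord_tvec B chart (\<phi> z) (fst (\<xi> chart), snd (\<xi> chart))"
      using B.tangent_eq_coord_tvec[OF _ chart_mem_B \<phi>_chart(1)[OF z]] by simp
    have "(w + L (Y z)) \<bullet> fst (\<xi> chart) = 0" "snd (\<xi> chart) = lift (X z) (Y z) (fst (\<xi> chart))"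
      using HL_coord_iff[OF X_in[OF z], of "Y z" "fst (\<xi> chart)" "snd (\<xi> chart)"] \<xi> \<xi>_eq unfolding \<phi>_def by simp_all
    then have "\<xi> = param_tangent_map B \<phi> z (K (fst (\<xi> chart)))"
      unfolding tan[OF z] using \<xi>_eq tangent_frame_K by simp
    then show "\<xi> \<in> range (param_tangent_map B \<phi> z)" by blast
  qed
  ultimately show ?thesis by blast
qed

end

section \<open>Integrability and the Weyl curvature\<close>

locale cotangent_connection = connected_atlas A N nabla + cotangent_atlas A B
  for A :: "('p, real^'n::finite) chart set" and N nabla
    and B :: "('p \<times> ('p, real^'n) covec set, (real^'n) \<times> 'f::euclidean_space) chart set"
begin

text \<open>The dimension count provides an isometry from the model space into the orthogonal
  complement of \<omega>; polarization turns preservation of norms into preservation of inner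
  products.\<close>

lemma frame_exists:
  fixes \<omega> :: "real^'n"
  assumes c: "c \<in> A" and "\<omega> \<noteq> 0"
  shows "\<exists>L K \<nu>. frame_connection A N nabla B c (inverse (norm \<omega>) *\<^sub>R \<omega>) L K \<nu>"
proof -
  define w where "w = inverse (norm \<omega>) *\<^sub>R \<omega>"
  have w: "w \<bullet> w = 1" "w \<noteq> 0"
    using \<open>\<omega> \<noteq> 0\<close> by (auto simp: w_def dot_square_norm power2_eq_square)
  have "dim (UNIV :: 'f set) \<le> dim {v. w \<bullet> v = 0}"
    using dim by (simp add: dim_hyperplane[OF w(2)])
  then obtain L :: "'f \<Rightarrow> real^'n" where L: "linear L" "L \<in> UNIV \<rightarrow> {v. w \<bullet> v = 0}" "\<And>y. y \<in> UNIV \<Longrightarrow> norm (L y) = norm y"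
    using isometry_subset_subspace[OF subspace_UNIV subspace_hyperplane] by metis
  have w_L: "w \<bullet> L y = 0" for y using L(2) by blast
  have L_L: "L y \<bullet> L z = y \<bullet> z" for y z
    using L(3) by (simp add: dot_norm linear_add[OF L(1), symmetric])
  have "inj L"
    unfolding linear_injective_0[OF L(1)] using L(3) by (metis UNIV_I norm_eq_zero)
  moreover have "w \<notin> range L" using w(1) w_L by force
  ultimately obtain K \<nu> where "proj_frame A B c w L K \<nu>"
    using proj_frame_exists[OF c L(1)] by blast
  then have "frame_connection A N nabla B c w L K \<nu>"
    using connected_atlas_axioms w(1) w_L L_L by (intro frame_connection.intro frame_connection_axioms.intro)
  then show ?thesis unfolding w_def by blast
qed

lemma proj_cotangent_frame:
  assumes "(\<Union>c\<in>A. fst c) = N" "q \<in> proj_cotangent N A"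
  shows "\<exists>c w L K \<nu> x. frame_connection A N nabla B c w L K \<nu> \<and> x \<in> snd c ` fst c \<and>
    q = proj_cotangent_param A c w L (x, 0)"
proof -
  obtain p \<alpha> where q: "q = (p, covec_line \<alpha>)" "p \<in> N" "\<alpha> \<in> cotangent_space A p" "\<alpha> \<noteq> (\<lambda>_. 0)"
    using assms(2) unfolding proj_cotangent_def by blast
  obtain c where c: "c \<in> A" "p \<in> fst c" using q(2) assms(1) by blast
  obtain \<omega> where \<omega>: "\<alpha> = coord_covec A c p \<omega>"
    using cotangent_eq_coord_covec[OF q(3) c] by blast
  have "\<omega> \<noteq> 0" using q(4) by (auto simp: \<omega> coord_covec_def)
  then obtain L K \<nu> where "frame_connection A N nabla B c (inverse (norm \<omega>) *\<^sub>R \<omega>) L K \<nu>"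
    using frame_exists[OF c(1)] by blast
  moreover from this interpret F: frame_connection A N nabla B c "inverse (norm \<omega>) *\<^sub>R \<omega>" L K \<nu> .
  have "covec_line (coord_covec A c p \<omega>) = covec_line (coord_covec A c p (inverse (norm \<omega>) *\<^sub>R \<omega>))"
    using \<open>\<omega> \<noteq> 0\<close> by (subst covec_line_eq_iff[OF c \<open>\<omega> \<noteq> 0\<close>]) (intro exI[of _ "inverse (norm \<omega>)"], simp)
  then have "q = F.param (snd c p, 0)"
    using c by (simp add: F.param_eq q(1) \<omega> linear_0[OF F.L(1)])
  ultimately show ?thesis using c(2) by blast
qed

text \<open>A nonzero covector is, up to scaling, the point \<open>y = 0\<close> of its own frame.
  The curvature identity is homogeneous in \<omega>, so these frames reach all covectors.\<close>

lemma integrable_iff_contact_flat: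
  assumes "(\<Union>c\<in>A. fst c) = N"
  shows "integrable_distribution TYPE('f) (proj_cotangent N A) B (HL N A B nabla) \<longleftrightarrow> contact_flat A nabla"
proof
  assume int: "integrable_distribution TYPE('f) (proj_cotangent N A) B (HL N A B nabla)"
  show "contact_flat A nabla"
    unfolding contact_flat_def
  proof (intro ballI allI impI; elim conjE)
    fix c and x \<omega> a b e :: "real^'n"
    assume c: "c \<in> A" and x: "x \<in> snd c ` fst c" and 0: "\<omega> \<bullet> a = 0" "\<omega> \<bullet> b = 0" "\<omega> \<bullet> e = 0"
    show "\<omega> \<bullet> riemann A nabla c x a b e = 0"
    proof (cases "\<omega> = 0")
      case False
      let ?w = "inverse (norm \<omega>) *\<^sub>R \<omega>"
      obtain L K \<nu> where "frame_connection A N nabla B c ?w L K \<nu>"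
        using frame_exists[OF c False] by blast
      then interpret F: frame_connection A N nabla B c ?w L K \<nu> .
      from int[unfolded integrable_distribution_def, rule_format, OF F.param_proj_cotangent[OF x, of 0]]
      obtain S :: "'f set" and \<phi> where
        imm: "injective_immersion (proj_cotangent N A) B S \<phi>" and image: "F.param (x, 0) \<in> \<phi> ` S"
        and tangent: "\<forall>u\<in>S. range (param_tangent_map B \<phi> u) = HL N A B nabla (\<phi> u)"
        by (elim exE conjE) (rule that; assumption)
      from image obtain u0 where u0: "u0 \<in> S" "\<phi> u0 = F.param (x, 0)" by auto
      have "(?w + L 0) \<bullet> riemann A nabla c x a b e = 0"
        by (rule F.integral_manifold_imp_flat[OF imm tangent[rule_format] u0 x])
          (simp_all add: linear_0[OF F.L(1)] 0)
      then show ?thesis using False by (simp add: linear_0[OF F.L(1)])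
    qed simp
  qed
next
  assume flat: "contact_flat A nabla"
  show "integrable_distribution TYPE('f) (proj_cotangent N A) B (HL N A B nabla)"
    unfolding integrable_distribution_def
  proof
    fix q assume "q \<in> proj_cotangent N A"
    from proj_cotangent_frame[OF assms this]
    obtain c w L K \<nu> x where F: "frame_connection A N nabla B c w L K \<nu>"
      and x: "x \<in> snd c ` fst c" and q: "q = proj_cotangent_param A c w L (x, 0)"
      by (elim exE conjE) (rule that; assumption)
    interpret F: frame_connection A N nabla B c w L K \<nu> by (rule F)
    show "\<exists>(S :: 'f set) \<phi>. injective_immersion (proj_cotangent N A) B S \<phi> \<and> q \<in> \<phi> ` S \<and>
        (\<forall>u\<in>S. range (param_tangent_map B \<phi> u) = HL N A B nabla (\<phi> u))"
      unfolding q by (rule F.flat_imp_integral_manifold[OF flat x])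
  qed
qed

text \<open>The added terms are multiples of \<open>e\<close> and \<open>a\<close>. They pair to
  zero with the covector, because \<open>a\<close> is in its kernel by the contact condition and
  \<open>e\<close> is a \<open>tangent_frame\<close> vector.\<close>

lemma HL_projective_invariant:
  assumes "cotangent_connection A N nabla' B" "(\<Union>c\<in>A. fst c) = N" "q \<in> proj_cotangent N A"
    and change: "\<And>c x. c \<in> A \<Longrightarrow> x \<in> snd c ` fst c \<Longrightarrow> \<exists>u. \<forall>a e. christoffel A nabla' c x a e =
      christoffel A nabla c x a e + (u \<bullet> a) *\<^sub>R e + (u \<bullet> e) *\<^sub>R a"
  shows "HL N A B nabla q = HL N A B nabla' q"
proof -
  from proj_cotangent_frame[OF assms(2,3)]
  obtain c w L K \<nu> x where F: "frame_connection A N nabla B c w L K \<nu>"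
    and x: "x \<in> snd c ` fst c" and q: "q = proj_cotangent_param A c w L (x, 0)"
    by (elim exE conjE) (rule that; assumption)
  interpret F: frame_connection A N nabla B c w L K \<nu> by (rule F)
  interpret C': cotangent_connection A N nabla' B by fact
  interpret F': frame_connection A N nabla' B c w L K \<nu>
    by (intro frame_connection.intro C'.connected_atlas_axioms F.proj_frame_axioms frame_connection_axioms.intro
        F.norm_w F.w_L F.L_L)
  have q_mem: "q \<in> fst F.chart" unfolding q by (rule F.param_mem[OF x])
  obtain u where u: "\<And>a e. christoffel A nabla' c x a e = christoffel A nabla c x a e + (u \<bullet> a) *\<^sub>R e + (u \<bullet> e) *\<^sub>R a"
    using change[OF F.c x] by blast
  have coords: "snd F.chart q = (x, 0)" unfolding q by (rule F.chart_param[OF x])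
  have "\<xi> \<in> HL N A B nabla q \<longleftrightarrow> \<xi> \<in> HL N A B nabla' q" for \<xi>
  proof -
    have "(w + L 0) \<bullet> christoffel A nabla' c x a (F.tangent_frame 0 g) = (w + L 0) \<bullet> christoffel A nabla c x a (F.tangent_frame 0 g)"
      if "(w + L 0) \<bullet> a = 0" for a g
      unfolding u using that F.frame_tangent[of 0 g] by (simp add: inner_add_right)
    then show ?thesis
      unfolding F.HL_iff[OF q_mem refl refl] F'.HL_iff[OF q_mem refl refl] coords fst_conv snd_conv
      by auto
  qed
  then show ?thesis by blast
qed

end

text \<open>Immersions take values in \<open>M\<close>, so only fibres over \<open>M\<close> are
  compared.\<close>

lemma integrable_distribution_cong:
  fixes K :: "'k::euclidean_space itself"
  assumes "\<And>p. p \<in> M \<Longrightarrow> D p = D' p"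
  shows "integrable_distribution K M A D \<longleftrightarrow> integrable_distribution K M A D'"
proof -
  have eq: "D (\<phi> u) = D' (\<phi> u)" if "injective_immersion M A S \<phi>" "u \<in> S" for S \<phi> u
    using that by (intro assms) (auto simp: injective_immersion_def)
  then have "(injective_immersion M A S \<phi> \<and> p \<in> \<phi> ` S \<and> (\<forall>u\<in>S. range (param_tangent_map A \<phi> u) = D (\<phi> u))) \<longleftrightarrow>
      (injective_immersion M A S \<phi> \<and> p \<in> \<phi> ` S \<and> (\<forall>u\<in>S. range (param_tangent_map A \<phi> u) = D' (\<phi> u)))" for S :: "'k set" and \<phi> p
    by (intro conj_cong refl ball_cong) (simp_all add: eq)
  then show ?thesis unfolding integrable_distribution_def by simp
qed

theorem theorem4p2:
  fixes N :: "'p set"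
    and A :: "('p, real^'n) chart set"
    and B :: "('p \<times> ('p, real^'n) covec set, (real^'n) \<times> (real^'m)) chart set"
    and P :: "('p, real^'n) connection set"
  assumes "smooth_manifold N A"
    and "CARD('n) \<ge> 3" and "CARD('n) = CARD('m) + 1"
    and "B = proj_cotangent_atlas A"
    and "projective_structure N A P"
    and "nabla \<in> P" and "nabla' \<in> P"
  shows "integrable_distribution TYPE(real^'m) (proj_cotangent N A) B (HL N A B nabla)
           \<longleftrightarrow> weyl_curvature_vanishes A nabla'"
proof -
  have cover: "(\<Union>c\<in>A. fst c) = N" using assms(1) by (simp add: smooth_manifold_def)
  obtain nabla0 where 0: "linear_connection N A nabla0" "torsion_free N A nabla0"
    and P: "P = {nabla'. linear_connection N A nabla' \<and> torsion_free N A nabla' \<and>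
                     projectively_equivalent N A nabla0 nabla'}"
    using assms(5) unfolding projective_structure_def by blast
  have conn: "connected_atlas A N n" if "linear_connection N A n" "torsion_free N A n" for n
    by (intro connected_atlas.intro smooth_manifold_imp_atlas[OF assms(1)] connected_atlas_axioms.intro that)
      (use cover in blast)
  have "cotangent_atlas A B"
    by (intro cotangent_atlas.intro smooth_manifold_imp_atlas[OF assms(1)] cotangent_atlas_axioms.intro assms(4))
      (use assms(3) in simp)
  then have cc: "cotangent_connection A N n B" if "linear_connection N A n" "torsion_free N A n" for n
    by (intro cotangent_connection.intro conn[OF that])
  have N: "linear_connection N A nabla" "torsion_free N A nabla" "projectively_equivalent N A nabla0 nabla"
    and N': "linear_connection N A nabla'" "torsion_free N A nabla'" "projectively_equivalent N A nabla0 nabla'"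
    using assms(6,7) unfolding P by auto
  interpret C: cotangent_connection A N nabla B by (rule cc[OF N(1,2)])
  interpret C': cotangent_connection A N nabla' B by (rule cc[OF N'(1,2)])
  \<comment> \<open>The distribution is formed with one representative of the class and the Weyl
    curvature with another; replacing \<open>nabla\<close> by \<open>nabla'\<close> in the
    distribution brings both to the same connection.\<close>
  have "HL N A B nabla q = HL N A B nabla' q" if "q \<in> proj_cotangent N A" for q
  proof (rule C.HL_projective_invariant[OF C'.cotangent_connection_axioms cover that])
    fix c x assume cx: "c \<in> A" "x \<in> snd c ` fst c"
    \<comment> \<open>Each connection is compared with the base connection \<open>nabla0\<close> of
      the class; the difference of the two covectors relates them directly.\<close>
    obtain u u' where
      "\<And>a e. christoffel A nabla c x a e = christoffel A nabla0 c x a e + (u \<bullet> a) *\<^sub>R e + (u \<bullet> e) *\<^sub>R a"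
      "\<And>a e. christoffel A nabla' c x a e = christoffel A nabla0 c x a e + (u' \<bullet> a) *\<^sub>R e + (u' \<bullet> e) *\<^sub>R a"
      using christoffel_projective_change[OF conn[OF 0] N(3) cx] christoffel_projective_change[OF conn[OF 0] N'(3) cx]
      by blast
    then have "christoffel A nabla' c x a e = christoffel A nabla c x a e + ((u' - u) \<bullet> a) *\<^sub>R e + ((u' - u) \<bullet> e) *\<^sub>R a" for a e
      by (simp add: inner_diff_left scaleR_diff_left)
    then show "\<exists>u. \<forall>a e. christoffel A nabla' c x a e = christoffel A nabla c x a e + (u \<bullet> a) *\<^sub>R e + (u \<bullet> e) *\<^sub>R a"
      by blast
  qed
  then have "integrable_distribution TYPE(real^'m) (proj_cotangent N A) B (HL N A B nabla) \<longleftrightarrow>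
      integrable_distribution TYPE(real^'m) (proj_cotangent N A) B (HL N A B nabla')"
    by (intro integrable_distribution_cong)
  then show ?thesis
    unfolding C'.integrable_iff_contact_flat[OF cover] C'.weyl_vanishes_iff_contact_flat[OF assms(2)] .
qed

end
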